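(* Let $\Lambda$ be the single-vertex $2$-graph with vertex $v$, two edges $e_1,e_2$ of degree $(1,0)$, two edges $f_1,f_2$ of degree $(0,1)$, and factorization rule $e_if_j=f_ie_j$ for $i,j\in\{1,2\}$. Let $\eta$ be Lebesgue measure on $[0,1]\times[-1,1]$. Let $D_v=[0,1]\times[-1,1]$, $R_{e_1}=R_{f_1}=[0,1]\times[0,1]$ and $R_{e_2}=R_{f_2}=[0,1]\times[-1,0]$. Define maps $f_{e_1},f_{f_1}:D_v\to R_{e_1}$ by $f_{e_1}(x,y)=(x^2,\frac y2+\frac12)$ and $f_{f_1}(x,y)=(\sqrt{x},\frac y2+\frac12)$, and maps $f_{e_2},f_{f_2}:D_v\to R_{f_2}$ by $f_{e_2}(x,y)=(x^2,\frac y2-\frac12)$ and $f_{f_2}(x,y)=(\sqrt{x},\frac y2-\frac12)$. Then the representation of $C^*(\Lambda)$ on $L^2([0,1]\times[-1,1],\eta)$ arising from this branching system is faithful.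
   Context: A $2$-graph is a countable small category $\Lambda$ together with a functor $d:\Lambda\to\mathbb{N}^2$ ($\mathbb{N}=\{0,1,2,\dots\}$) with the factorization property: whenever $d(\mu)=n+m$ there are unique $\nu,\alpha\in\Lambda$ with $d(\nu)=n$, $d(\alpha)=m$, $s(\nu)=r(\alpha)$, $\mu=\nu\alpha$. Here $\Lambda$ is the $2$-graph with one object $v$ generated, as a monoid, by $e_1,e_2,f_1,f_2$ subject to the relations $e_if_j=f_ie_j$. Put $\Lambda^n:=d^{-1}(n)$. $C^*(\Lambda)$ is the universal C*-algebra generated by partial isometries $\{s_\mu\}_{\mu\in\Lambda}$ such that $s_v$ is a projection; $s_{\mu\nu}=s_\mu s_\nu$ for all $\mu,\nu$; $s_\mu^*s_\mu=s_v$ for all $\mu$; and $s_v=\sum_{\mu\in\Lambda^n}s_\mu s_\mu^*$ for all $n\in\mathbb{N}^2$. For such $\Lambda$, a $\Lambda$-branching system on $(X,\eta)$ is a family $\{D_v,R_\mu,f_\mu\}_{\mu\in\Lambda^{(1,0)}\cup\Lambda^{(0,1)}}$ with $D_v,R_\mu\subseteq X$ measurable such that: (1) $R_\mu\cap R_\nu=\emptyset$ $\eta$-a.e. if $\mu\ne\nu$ are edges of the same degree; (2) for each edge $\mu$ there are measurable maps $f_\mu:D_v\to R_\mu$ and $f_\mu^{-1}:R_\mu\to D_v$, mutually inverse $\eta$-a.e., such that the pushforward measure $\eta\circ f_\mu$ (under $f_\mu^{-1}$) on $D_v$ is absolutely continuous with respect to $\eta$ on $D_v$, and the pushforward measure $\eta\circ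 f_\mu^{-1}$ (under $f_\mu$) on $R_\mu$ is absolutely continuous with respect to $\eta$ on $R_\mu$; (3) if $\mu,\nu,\alpha,\beta$ are edges and $\mu\nu=\alpha\beta$ then $f_\mu\circ f_\nu=f_\alpha\circ f_\beta$ $\eta$-a.e.; (4) for each of the two degrees, the union of the $R_\mu$ over the edges $\mu$ of that degree equals $D_v$ $\eta$-a.e. The representation arising from a branching system is the unique $*$-homomorphism $\pi:C^*(\Lambda)\to B(L^2(X,\eta))$ with $\pi(s_\mu)(\phi)=\Phi_{f_\mu^{-1}}^{1/2}(\phi\circ f_\mu^{-1})$ (extended by $0$ off $R_\mu$), where $\Phi_{f_\mu^{-1}}=d(\eta\circ f_\mu^{-1})/d\eta$ is the Radon–Nikodym derivative, and $\pi(s_v)(\phi)=\chi_{D_v}\phi$, for all edges $\mu$ and $\phi\in L^2(X,\eta)$. *)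

theory Defs
  imports "HOL-Analysis.Analysis"
begin

section \<open>Single-vertex 2-graphs\<close>

text \<open>A category with a single object is a monoid.  The object \<open>v\<close> is identified with its identity
  morphism \<open>1\<close>, which is the only element of degree \<open>0\<close>.\<close>

class two_graph_monoid = monoid_mult +
  fixes deg :: "'a \<Rightarrow> nat \<times> nat"
  assumes countable_UNIV: "countable (UNIV :: 'a set)"
    and deg_one: "deg 1 = 0"
    and deg_mult: "deg (\<mu> * \<nu>) = deg \<mu> + deg \<nu>"
    and factorization: "deg \<mu> = m + n \<Longrightarrow> \<exists>!(\<nu>, \<alpha>). deg \<nu> = m \<and> deg \<alpha> = n \<and> \<mu> = \<nu> * \<alpha>"

text \<open>Finiteness of all \<open>\<Lambda>\<^sup>n\<close> is what gives a meaning to the finite sums in the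
  Cuntz-Krieger relations below.\<close>

class finite_two_graph_monoid = two_graph_monoid +
  assumes finite_deg: "finite {\<mu>. deg \<mu> = n}"

definition edges :: "'m::two_graph_monoid set" where
  "edges = {\<mu>. deg \<mu> = (1, 0) \<or> deg \<mu> = (0, 1)}"


subsection \<open>The 2-graph with relations \<open>e\<^sub>i f\<^sub>j = f\<^sub>i e\<^sub>j\<close>\<close>

datatype idx = I1 | I2

datatype letter = E idx | F idx

inductive swap :: "letter list \<Rightarrow> letter list \<Rightarrow> bool" where
  "swap (u @ [E i, F j] @ w) (u @ [F i, E j] @ w)"

lemma swap_append: "swap x y \<Longrightarrow> swap (u @ x @ w) (u @ y @ w)"
proof (induction rule: swap.induct)
  case (1 u' i j w')
  show ?case using swap.intros[of "u @ u'" i j "w' @ w"] by simp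
qed

lemma equivclp_swap_append:
  assumes "equivclp swap x y"
  shows "equivclp swap (u @ x @ w) (u @ y @ w)"
  using assms
proof (induction rule: equivclp_induct)
  case (step y z)
  then have "equivclp swap (u @ y @ w) (u @ z @ w)"
    by (metis swap_append r_into_equivclp equivclp_sym)
  with step.IH show ?case by (rule equivclp_trans)
qed simp

quotient_type graph = "letter list" / "equivclp swap"
  morphisms rep_graph graph_of_word
  by (rule equivpI) (blast intro: reflpI sympI transpI equivclp_refl equivclp_sym equivclp_trans)+

fun letter_idx :: "letter \<Rightarrow> idx" where
  "letter_idx (E i) = i" | "letter_idx (F i) = i"

fun letter_deg :: "letter \<Rightarrow> nat \<times> nat" where
  "letter_deg (E i) = (1, 0)" | "letter_deg (F i) = (0, 1)"

definition word_deg :: "letter list \<Rightarrow> nat \<times> nat" where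
  "word_deg w = sum_list (map letter_deg w)"

lemma swap_invariants:
  assumes "equivclp swap x y"
  shows "word_deg x = word_deg y \<and> map letter_idx x = map letter_idx y"
  using assms
proof (induction rule: equivclp_induct)
  case (step y z)
  then show ?case by (auto elim!: swap.cases simp: word_deg_def add_ac)
qed simp

instantiation graph :: monoid_mult
begin
lift_definition one_graph :: graph is "[]" .
lift_definition times_graph :: "graph \<Rightarrow> graph \<Rightarrow> graph" is "(@)"
  by (metis equivclp_swap_append append.left_neutral append.right_neutral equivclp_trans)
instance by standard (transfer; simp)+
end


definition normal_word :: "nat \<Rightarrow> idx list \<Rightarrow> letter list" where
  "normal_word m xs = map E (take m xs) @ map F (drop m xs)"

lemma move_F_right: "equivclp swap (F i # map E us) (map E (butlast (i # us)) @ [F (last (i # us))])"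
proof (induction us arbitrary: i)
  case (Cons u us)
  have "swap ([] @ [E i, F u] @ map E us) ([] @ [F i, E u] @ map E us)"
    by (rule swap.intros)
  then have "equivclp swap (F i # map E (u # us)) (E i # F u # map E us)"
    by (simp add: equivclp_sym r_into_equivclp)
  moreover have "equivclp swap (E i # F u # map E us)
      (E i # map E (butlast (u # us)) @ [F (last (u # us))])"
    using equivclp_swap_append[OF Cons[of u], of "[E i]" "[]"] by simp
  ultimately show ?case by (auto intro: equivclp_trans)
qed simp

lemma equivclp_normal_word:
  "equivclp swap w (normal_word (fst (word_deg w)) (map letter_idx w))
    \<and> fst (word_deg w) + snd (word_deg w) = length w"
proof (induction w)
  case Nil
  then show ?case by (simp add: normal_word_def word_deg_def)
next
  case (Cons a w)
  define m xs where "m = fst (word_deg w)" and "xs = map letter_idx w"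
  have m: "m \<le> length xs" using Cons by (simp add: m_def xs_def)
  have IH: "equivclp swap (a # w) (a # normal_word m xs)"
    using equivclp_swap_append[of w "normal_word m xs" "[a]" "[]"] Cons by (simp add: m_def xs_def)
  show ?case
  proof (cases a)
    case (E i)
    then show ?thesis using IH Cons by (simp add: normal_word_def m_def xs_def word_deg_def)
  next
    case (F i)
    have "equivclp swap (F i # map E (take m xs) @ map F (drop m xs))
        (map E (butlast (i # take m xs)) @ [F (last (i # take m xs))] @ map F (drop m xs))"
      using equivclp_swap_append[OF move_F_right[of i "take m xs"], of "[]" "map F (drop m xs)"]
      by simp
    moreover have "map E (butlast (i # take m xs)) = map E (take m (i # xs))"
      using m by (simp add: butlast_conv_take take_Cons')
    moreover have "[F (last (i # take m xs))] @ map F (drop m xs) = map F (drop m (i # xs))"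
    proof (cases m)
      case (Suc k)
      then have "last (i # take m xs) = xs ! k" "drop k xs = xs ! k # drop m xs"
        using m by (auto simp: last_conv_nth Cons_nth_drop_Suc)
      then show ?thesis using Suc by simp
    qed simp
    ultimately have "equivclp swap (a # normal_word m xs) (normal_word m (i # xs))"
      by (simp add: normal_word_def F)
    then show ?thesis using IH Cons F
      by (auto simp: m_def xs_def word_deg_def intro: equivclp_trans)
  qed
qed

lift_definition graph_idx :: "graph \<Rightarrow> idx list" is "map letter_idx"
  using swap_invariants by blast

lift_definition graph_deg :: "graph \<Rightarrow> nat \<times> nat" is word_deg
  using swap_invariants by blast

lemma graph_eqI: "graph_deg x = graph_deg y \<Longrightarrow> graph_idx x = graph_idx y \<Longrightarrow> x = y"
  by transfer (metis equivclp_normal_word equivclp_sym equivclp_trans)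

lemma length_graph_idx: "length (graph_idx x) = fst (graph_deg x) + snd (graph_deg x)"
  by transfer (simp add: equivclp_normal_word)

lemma graph_idx_mult: "graph_idx (x * y) = graph_idx x @ graph_idx y"
  by transfer simp

lemma graph_deg_mult: "graph_deg (x * y) = graph_deg x + graph_deg y"
  by transfer (simp add: word_deg_def)

lemma word_deg_map_E: "word_deg (map E xs) = (length xs, 0)"
  by (induction xs) (auto simp: word_deg_def zero_prod_def)

lemma word_deg_map_F: "word_deg (map F xs) = (0, length xs)"
  by (induction xs) (auto simp: word_deg_def zero_prod_def)

lemma graph_exists:
  assumes "length xs = fst n + snd n"
  shows "\<exists>x. graph_idx x = xs \<and> graph_deg x = n"
proof -
  define w where "w = normal_word (fst n) xs"
  have "map letter_idx w = xs"
    unfolding w_def normal_word_def by (simp add: comp_def)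
  moreover have "word_deg w = word_deg (map E (take (fst n) xs)) + word_deg (map F (drop (fst n) xs))"
    unfolding w_def normal_word_def by (simp add: word_deg_def)
  then have "word_deg w = n"
    using assms by (simp add: word_deg_map_E word_deg_map_F)
  ultimately show ?thesis
    by (metis graph_idx.abs_eq graph_deg.abs_eq)
qed

instantiation graph :: finite_two_graph_monoid
begin

definition deg_graph :: "graph \<Rightarrow> nat \<times> nat" where "deg_graph = graph_deg"

instance
proof
  have "(UNIV :: idx set) = {I1, I2}"
    using idx.exhaust by auto
  then have fin_idx: "finite (UNIV :: idx set)"
    by (metis finite.emptyI finite_insert)
  have inj: "inj (\<lambda>x. (graph_deg x, graph_idx x))"
    by (auto intro!: injI graph_eqI)
  show fin: "finite {\<mu>::graph. deg \<mu> = n}" for n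
  proof (rule finite_imageD)
    have "(\<lambda>x. (graph_deg x, graph_idx x)) ` {\<mu>. deg \<mu> = n}
        \<subseteq> {n} \<times> {xs. set xs \<subseteq> UNIV \<and> length xs = fst n + snd n}"
      by (auto simp: deg_graph_def length_graph_idx)
    then show "finite ((\<lambda>x. (graph_deg x, graph_idx x)) ` {\<mu>. deg \<mu> = n})"
      by (rule finite_subset) (intro finite_cartesian_product finite_lists_length_eq fin_idx; simp)
    show "inj_on (\<lambda>x. (graph_deg x, graph_idx x)) {\<mu>. deg \<mu> = n}"
      using inj by (rule inj_on_subset) simp
  qed
  have "(UNIV :: graph set) = (\<Union>n. {\<mu>. deg \<mu> = n})" by auto
  then show "countable (UNIV :: graph set)"
    using fin by (metis countable_UN countable_finite uncountable_def countableI_type)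
  show "deg (1::graph) = 0"
    unfolding deg_graph_def by transfer (simp add: word_deg_def)
  show "deg (\<mu> * \<nu>) = deg \<mu> + deg \<nu>" for \<mu> \<nu> :: graph
    by (simp add: deg_graph_def graph_deg_mult)
  fix \<mu> :: graph and m n
  assume deg: "deg \<mu> = m + n"
  define k where "k = fst m + snd m"
  have len: "length (graph_idx \<mu>) = k + (fst n + snd n)"
    using deg by (simp add: length_graph_idx deg_graph_def k_def)
  obtain \<nu> where \<nu>: "graph_idx \<nu> = take k (graph_idx \<mu>)" "graph_deg \<nu> = m"
    using graph_exists[of "take k (graph_idx \<mu>)" m] len by (auto simp: k_def)
  obtain \<alpha> where \<alpha>: "graph_idx \<alpha> = drop k (graph_idx \<mu>)" "graph_deg \<alpha> = n"
    using graph_exists[of "drop k (graph_idx \<mu>)" n] len by auto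
  show "\<exists>!(\<nu>, \<alpha>). deg \<nu> = m \<and> deg \<alpha> = n \<and> \<mu> = \<nu> * \<alpha>"
  proof (rule ex1I[of _ "(\<nu>, \<alpha>)"], goal_cases)
    case 1
    have "\<mu> = \<nu> * \<alpha>"
      by (rule graph_eqI)
        (use deg \<nu> \<alpha> in \<open>auto simp: graph_idx_mult graph_deg_mult deg_graph_def\<close>)
    then show ?case using \<nu> \<alpha> by (simp add: deg_graph_def)
  next
    case (2 p)
    obtain \<nu>' \<alpha>' where p: "p = (\<nu>', \<alpha>')" by fastforce
    have d: "graph_deg \<nu>' = m" "graph_deg \<alpha>' = n" "\<mu> = \<nu>' * \<alpha>'"
      using 2 by (auto simp: p deg_graph_def)
    then have "graph_idx \<nu>' = take k (graph_idx \<mu>)" "graph_idx \<alpha>' = drop k (graph_idx \<mu>)"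
      using length_graph_idx[of \<nu>'] by (auto simp: graph_idx_mult k_def)
    then show ?case
      using d \<nu> \<alpha> by (auto simp: p intro!: graph_eqI)
  qed
qed

end

abbreviation "e1 \<equiv> graph_of_word [E I1]"
abbreviation "e2 \<equiv> graph_of_word [E I2]"
abbreviation "f1 \<equiv> graph_of_word [F I1]"
abbreviation "f2 \<equiv> graph_of_word [F I2]"

lemma graph_deg_eq_1:
  "{\<mu>. deg \<mu> = (1, 0)} = {e1, e2}" "{\<mu>. deg \<mu> = (0, 1)} = {f1, f2}"
proof -
  have idx: "xs = [I1] \<or> xs = [I2]" if "length xs = Suc 0" for xs
    using that by (cases xs; cases "hd xs"; simp)
  have *: "graph_idx (graph_of_word [E i]) = [i]" "graph_idx (graph_of_word [F i]) = [i]"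
    "graph_deg (graph_of_word [E i]) = (1, 0)" "graph_deg (graph_of_word [F i]) = (0, 1)" for i
    by (simp_all add: graph_idx.abs_eq graph_deg.abs_eq word_deg_def)
  have "\<mu> = e1 \<or> \<mu> = e2" if "graph_deg \<mu> = (1, 0)" for \<mu>
    using idx[of "graph_idx \<mu>"] length_graph_idx[of \<mu>] that
    by (metis * graph_eqI fst_conv snd_conv add_0_right One_nat_def)
  then show "{\<mu>. deg \<mu> = (1, 0)} = {e1, e2}"
    by (auto simp: * deg_graph_def)
  have "\<mu> = f1 \<or> \<mu> = f2" if "graph_deg \<mu> = (0, 1)" for \<mu>
    using idx[of "graph_idx \<mu>"] length_graph_idx[of \<mu>] that
    by (metis * graph_eqI fst_conv snd_conv add_0 One_nat_def)
  then show "{\<mu>. deg \<mu> = (0, 1)} = {f1, f2}"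
    by (auto simp: * deg_graph_def)
qed

lemma graph_distinct: "distinct [e1, e2, f1, f2]"
proof -
  have "graph_idx (graph_of_word [E i]) = [i]" "graph_idx (graph_of_word [F i]) = [i]"
    "graph_deg (graph_of_word [E i]) = (1, 0)" "graph_deg (graph_of_word [F i]) = (0, 1)" for i
    by (simp_all add: graph_idx.abs_eq graph_deg.abs_eq word_deg_def)
  then show ?thesis
    by (metis distinct_length_2_or_more distinct_singleton idx.distinct(1) list.inject
        prod.inject zero_neq_one)
qed


section \<open>C*-algebras\<close>

class star_algebra = ring +
  fixes scaleC :: "complex \<Rightarrow> 'a \<Rightarrow> 'a"  (infixr "*\<^sub>C" 75)
    and star :: "'a \<Rightarrow> 'a"
  assumes scaleC_add_right: "c *\<^sub>C (x + y) = c *\<^sub>C x + c *\<^sub>C y"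
    and scaleC_add_left: "(c + d) *\<^sub>C x = c *\<^sub>C x + d *\<^sub>C x"
    and scaleC_scaleC: "c *\<^sub>C d *\<^sub>C x = (c * d) *\<^sub>C x"
    and scaleC_one: "1 *\<^sub>C x = x"
    and mult_scaleC_left: "(c *\<^sub>C x) * y = c *\<^sub>C (x * y)"
    and mult_scaleC_right: "x * (c *\<^sub>C y) = c *\<^sub>C (x * y)"
    and star_add: "star (x + y) = star x + star y"
    and star_scaleC: "star (c *\<^sub>C x) = cnj c *\<^sub>C star x"
    and star_mult: "star (x * y) = star y * star x"
    and star_star: "star (star x) = x"

class cstar_algebra = star_algebra + real_normed_algebra + complete_space +
  assumes scaleR_scaleC: "r *\<^sub>R x = of_real r *\<^sub>C x"
    and norm_scaleC: "norm (c *\<^sub>C x) = cmod c * norm x"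
    and norm_star_mult: "norm (star x * x) = (norm x)\<^sup>2"

definition star_hom :: "('a::star_algebra \<Rightarrow> 'b::star_algebra) \<Rightarrow> bool" where
  "star_hom h \<longleftrightarrow> (\<forall>x y. h (x + y) = h x + h y) \<and> (\<forall>c x. h (c *\<^sub>C x) = c *\<^sub>C h x)
     \<and> (\<forall>x y. h (x * y) = h x * h y) \<and> (\<forall>x. h (star x) = star (h x))"

definition cstar_seminorm :: "('a::star_algebra \<Rightarrow> real) \<Rightarrow> bool" where
  "cstar_seminorm p \<longleftrightarrow> (\<forall>x y. p (x + y) \<le> p x + p y) \<and> (\<forall>c x. p (c *\<^sub>C x) = cmod c * p x)
     \<and> (\<forall>x y. p (x * y) \<le> p x * p y) \<and> (\<forall>x. p (star x * x) = (p x)\<^sup>2)"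

lemma scaleC_zero_left [simp]: "0 *\<^sub>C x = (0::'a::star_algebra)"
  using scaleC_add_left[of 0 0 x] by simp

lemma scaleC_minus_one: "(-1) *\<^sub>C x = - (x::'a::star_algebra)"
  using scaleC_add_left[of 1 "-1" x] by (simp add: scaleC_one eq_neg_iff_add_eq_0 add.commute)

lemma star_zero [simp]: "star 0 = (0::'a::star_algebra)"
  using star_add[of 0 "0::'a"] by simp

lemma star_minus: "star (- x) = - star (x::'a::star_algebra)"
  by (metis scaleC_minus_one star_scaleC complex_cnj_minus complex_cnj_one)

lemma star_diff: "star (x - y) = star x - star (y::'a::star_algebra)"
  by (metis star_add star_minus diff_conv_add_uminus)

lemma star_sum: "star (sum f A) = (\<Sum>i\<in>A. star (f i :: 'a::star_algebra))"
  by (induction A rule: infinite_finite_induct) (auto simp: star_add)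

context
  fixes p :: "'a::star_algebra \<Rightarrow> real"
  assumes p: "cstar_seminorm p"
begin

lemma cstar_seminorm_triangle: "p (x + y) \<le> p x + p y"
  and cstar_seminorm_scaleC: "p (c *\<^sub>C x) = cmod c * p x"
  and cstar_seminorm_mult: "p (x * y) \<le> p x * p y"
  and cstar_seminorm_star_mult: "p (star x * x) = (p x)\<^sup>2"
  using p by (auto simp: cstar_seminorm_def)

lemma cstar_seminorm_zero: "p 0 = 0"
  using cstar_seminorm_scaleC[of 0 0] by simp

lemma cstar_seminorm_minus: "p (- x) = p x"
  using cstar_seminorm_scaleC[of "-1" x] by (simp add: scaleC_minus_one)

lemma cstar_seminorm_minus_commute: "p (x - y) = p (y - x)"
  using cstar_seminorm_minus[of "x - y"] by simp

lemma cstar_seminorm_nonneg: "0 \<le> p x"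
  using cstar_seminorm_triangle[of x "- x"] by (simp add: cstar_seminorm_zero cstar_seminorm_minus)

lemma cstar_seminorm_star: "p (star x) = p x"
proof -
  have le: "p x \<le> p (star x)" for x
    using cstar_seminorm_mult[of "star x" x] cstar_seminorm_nonneg[of x] cstar_seminorm_nonneg[of "star x"]
    by (cases "p x = 0") (auto simp: cstar_seminorm_star_mult power2_eq_square)
  show ?thesis using le[of x] le[of "star x"] by (simp add: star_star)
qed

lemma cstar_seminorm_triangle_diff: "p (x - z) \<le> p (x - y) + p (y - z)"
  using cstar_seminorm_triangle[of "x - y" "y - z"] by simp

lemma cstar_seminorm_abs_diff: "\<bar>p x - p y\<bar> \<le> p (x - y)"
  using cstar_seminorm_triangle[of "x - y" y] cstar_seminorm_triangle[of "y - x" x]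
  by (simp add: cstar_seminorm_minus_commute[of y x])

end


subsection \<open>The free *-algebra on a set of generators\<close>

text \<open>Terms in the generators and the *-algebra operations, modulo the congruence generated by the
  axioms of \<open>star_algebra\<close>.  There is no unit.\<close>

datatype 'm expr = Gen 'm | Zero | Add "'m expr" "'m expr" | Neg "'m expr"
  | Mult "'m expr" "'m expr" | Scale complex "'m expr" | Star "'m expr"

inductive expr_eq :: "'m expr \<Rightarrow> 'm expr \<Rightarrow> bool"  (infix "\<asymp>" 50) where
  expr_refl: "x \<asymp> x"
| expr_sym: "x \<asymp> y \<Longrightarrow> y \<asymp> x"
| expr_trans: "x \<asymp> y \<Longrightarrow> y \<asymp> z \<Longrightarrow> x \<asymp> z"
| cong_Add: "x \<asymp> x' \<Longrightarrow> y \<asymp> y' \<Longrightarrow> Add x y \<asymp> Add x' y'"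
| cong_Neg: "x \<asymp> x' \<Longrightarrow> Neg x \<asymp> Neg x'"
| cong_Mult: "x \<asymp> x' \<Longrightarrow> y \<asymp> y' \<Longrightarrow> Mult x y \<asymp> Mult x' y'"
| cong_Scale: "x \<asymp> x' \<Longrightarrow> Scale c x \<asymp> Scale c x'"
| cong_Star: "x \<asymp> x' \<Longrightarrow> Star x \<asymp> Star x'"
| "Add (Add x y) z \<asymp> Add x (Add y z)"
| "Add x y \<asymp> Add y x"
| "Add Zero x \<asymp> x"
| "Add (Neg x) x \<asymp> Zero"
| "Mult (Mult x y) z \<asymp> Mult x (Mult y z)"
| "Mult (Add x y) z \<asymp> Add (Mult x z) (Mult y z)"
| "Mult x (Add y z) \<asymp> Add (Mult x y) (Mult x z)"
| "Scale c (Add x y) \<asymp> Add (Scale c x) (Scale c y)"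
| "Scale (c + d) x \<asymp> Add (Scale c x) (Scale d x)"
| "Scale c (Scale d x) \<asymp> Scale (c * d) x"
| "Scale 1 x \<asymp> x"
| "Mult (Scale c x) y \<asymp> Scale c (Mult x y)"
| "Mult x (Scale c y) \<asymp> Scale c (Mult x y)"
| "Star (Add x y) \<asymp> Add (Star x) (Star y)"
| "Star (Scale c x) \<asymp> Scale (cnj c) (Star x)"
| "Star (Mult x y) \<asymp> Mult (Star y) (Star x)"
| "Star (Star x) \<asymp> x"

quotient_type 'm free_star = "'m expr" / expr_eq
  by (rule equivpI) (blast intro: reflpI sympI transpI expr_refl expr_sym expr_trans)+

instantiation free_star :: (type) star_algebra
begin
lift_definition zero_free_star :: "'a free_star" is Zero .
lift_definition plus_free_star :: "'a free_star \<Rightarrow> 'a free_star \<Rightarrow> 'a free_star" is Add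
  by (rule cong_Add)
lift_definition uminus_free_star :: "'a free_star \<Rightarrow> 'a free_star" is Neg
  by (rule cong_Neg)
lift_definition times_free_star :: "'a free_star \<Rightarrow> 'a free_star \<Rightarrow> 'a free_star" is Mult
  by (rule cong_Mult)
lift_definition scaleC_free_star :: "complex \<Rightarrow> 'a free_star \<Rightarrow> 'a free_star" is Scale
  by (rule cong_Scale)
lift_definition star_free_star :: "'a free_star \<Rightarrow> 'a free_star" is Star
  by (rule cong_Star)
definition minus_free_star :: "'a free_star \<Rightarrow> 'a free_star \<Rightarrow> 'a free_star" where
  "minus_free_star x y = x + - y"
instance
  by standard (simp add: minus_free_star_def | transfer, rule expr_eq.intros(9-25))+
end

lift_definition gen :: "'m \<Rightarrow> 'm free_star" is Gen .

lemma free_star_induct [case_names gen zero add uminus mult scaleC star]: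
  assumes "\<And>m. P (gen m)" "P 0" "\<And>x y. P x \<Longrightarrow> P y \<Longrightarrow> P (x + y)" "\<And>x. P x \<Longrightarrow> P (- x)"
    "\<And>x y. P x \<Longrightarrow> P y \<Longrightarrow> P (x * y)" "\<And>c x. P x \<Longrightarrow> P (c *\<^sub>C x)" "\<And>x. P x \<Longrightarrow> P (star x)"
  shows "P x"
proof -
  have "P (abs_free_star t)" for t
    using assms
    by (induction t) (simp_all flip: gen.abs_eq zero_free_star.abs_eq plus_free_star.abs_eq
        uminus_free_star.abs_eq times_free_star.abs_eq scaleC_free_star.abs_eq star_free_star.abs_eq)
  then show ?thesis by (metis Quotient3_abs_rep Quotient3_free_star)
qed

primrec eval_expr :: "('m \<Rightarrow> 'a::star_algebra) \<Rightarrow> 'm expr \<Rightarrow> 'a" where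
  "eval_expr S (Gen m) = S m"
| "eval_expr S Zero = 0"
| "eval_expr S (Add x y) = eval_expr S x + eval_expr S y"
| "eval_expr S (Neg x) = - eval_expr S x"
| "eval_expr S (Mult x y) = eval_expr S x * eval_expr S y"
| "eval_expr S (Scale c x) = c *\<^sub>C eval_expr S x"
| "eval_expr S (Star x) = star (eval_expr S x)"

lemma eval_expr_cong: "x \<asymp> y \<Longrightarrow> eval_expr S x = eval_expr S y"
  by (induction rule: expr_eq.induct)
    (auto simp: scaleC_add_right scaleC_add_left scaleC_scaleC scaleC_one mult_scaleC_left
      mult_scaleC_right star_add star_scaleC star_mult star_star algebra_simps)

lift_definition free_eval :: "('m \<Rightarrow> 'a::star_algebra) \<Rightarrow> 'm free_star \<Rightarrow> 'a" is eval_expr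
  by (rule eval_expr_cong)

lemma free_eval_simps [simp]:
  "free_eval S (gen m) = S m"
  "free_eval S 0 = 0"
  "free_eval S (x + y) = free_eval S x + free_eval S y"
  "free_eval S (- x) = - free_eval S x"
  "free_eval S (x * y) = free_eval S x * free_eval S y"
  "free_eval S (c *\<^sub>C x) = c *\<^sub>C free_eval S x"
  "free_eval S (star x) = star (free_eval S x)"
  by (transfer, simp)+

lemma free_eval_diff [simp]: "free_eval S (x - y) = free_eval S x - free_eval S y"
  by (metis free_eval_simps(3,4) diff_conv_add_uminus)

lemma free_eval_sum [simp]: "free_eval S (sum f A) = (\<Sum>i\<in>A. free_eval S (f i))"
  by (induction A rule: infinite_finite_induct) auto


section \<open>The C*-algebra of a single-vertex 2-graph\<close>

definition ck_family :: "('m::finite_two_graph_monoid \<Rightarrow> 'a::star_algebra) \<Rightarrow> bool" where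
  "ck_family S \<longleftrightarrow>
     S 1 * S 1 = S 1 \<and> star (S 1) = S 1
     \<and> (\<forall>\<mu>. S \<mu> * star (S \<mu>) * S \<mu> = S \<mu>)
     \<and> (\<forall>\<mu> \<nu>. S (\<mu> * \<nu>) = S \<mu> * S \<nu>)
     \<and> (\<forall>\<mu>. star (S \<mu>) * S \<mu> = S 1)
     \<and> (\<forall>n. S 1 = (\<Sum>\<mu> | deg \<mu> = n. S \<mu> * star (S \<mu>)))"

definition ck_relators :: "('m::finite_two_graph_monoid \<Rightarrow> 'a::star_algebra) \<Rightarrow> 'a set" where
  "ck_relators S =
     {S 1 * S 1 - S 1, star (S 1) - S 1}
     \<union> range (\<lambda>\<mu>. S \<mu> * star (S \<mu>) * S \<mu> - S \<mu>)
     \<union> range (\<lambda>(\<mu>, \<nu>). S (\<mu> * \<nu>) - S \<mu> * S \<nu>)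
     \<union> range (\<lambda>\<mu>. star (S \<mu>) * S \<mu> - S 1)
     \<union> range (\<lambda>n. S 1 - (\<Sum>\<mu> | deg \<mu> = n. S \<mu> * star (S \<mu>)))"

lemma ck_family_iff: "ck_family S \<longleftrightarrow> (\<forall>r\<in>ck_relators S. r = 0)"
  unfolding ck_family_def ck_relators_def by (auto simp: ball_Un)

lemma ck_relators_free_eval: "ck_relators S = free_eval S ` ck_relators gen"
  unfolding ck_relators_def image_Un image_insert image_empty image_image
  by (simp add: case_prod_unfold)

text \<open>\<open>C*(\<Lambda>)\<close> is the Hausdorff completion of the free *-algebra on \<open>\<Lambda>\<close> in the largest
  C*-seminorm that annihilates the Cuntz-Krieger relations.  Its universal property is
  \<open>ck_algebra_universal\<close> below.\<close>

definition ck_seminorms :: "('m::finite_two_graph_monoid free_star \<Rightarrow> real) set" where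
  "ck_seminorms = {p. cstar_seminorm p \<and> (\<forall>r\<in>ck_relators gen. p r = 0)}"

definition ck_norm :: "'m::finite_two_graph_monoid free_star \<Rightarrow> real" where
  "ck_norm x = (SUP p\<in>ck_seminorms. p x)"

lemma zero_in_ck_seminorms: "(\<lambda>_. 0) \<in> ck_seminorms"
  by (simp add: ck_seminorms_def cstar_seminorm_def)

lemma ck_seminorm_gen_le_1:
  assumes "p \<in> ck_seminorms"
  shows "p (gen \<mu>) \<le> 1"
proof -
  have p: "cstar_seminorm p" and rel: "\<And>r. r \<in> ck_relators gen \<Longrightarrow> p r = 0"
    using assms by (auto simp: ck_seminorms_def)
  have eq: "p x = p y" if "x - y \<in> ck_relators gen" for x y
    using cstar_seminorm_abs_diff[OF p, of x y] rel[OF that] by simp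
  have *: "(p (gen \<mu>))\<^sup>2 = p (gen 1)" for \<mu>
    using eq[of "star (gen \<mu>) * gen \<mu>" "gen 1"]
    by (auto simp: ck_relators_def cstar_seminorm_star_mult[OF p])
  have "p (gen 1) \<le> 1"
    using *[of 1] by (auto simp: power2_eq_square)
  then show ?thesis
    using *[of \<mu>] by (metis abs_le_square_iff abs_1 abs_le_D1 one_power2)
qed

lemma bdd_ck_seminorms: "bdd_above ((\<lambda>p. p x) ` ck_seminorms)"
proof -
  have "\<exists>B. \<forall>p\<in>ck_seminorms. p x \<le> B"
  proof (induction x rule: free_star_induct)
    case (gen m)
    then show ?case using ck_seminorm_gen_le_1 by blast
  next
    case zero
    then show ?case
      by (auto simp: ck_seminorms_def cstar_seminorm_zero intro!: exI[of _ 0])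
  next
    case (add x y)
    then obtain B C where "\<forall>p\<in>ck_seminorms. p x \<le> B" "\<forall>p\<in>ck_seminorms. p y \<le> C" by blast
    then have "p (x + y) \<le> B + C" if "p \<in> ck_seminorms" for p
      using that cstar_seminorm_triangle[of p x y] by (force simp: ck_seminorms_def)
    then show ?case by blast
  next
    case (uminus x)
    then show ?case by (auto simp: ck_seminorms_def cstar_seminorm_minus)
  next
    case (mult x y)
    then obtain B C where "\<forall>p\<in>ck_seminorms. p x \<le> B" "\<forall>p\<in>ck_seminorms. p y \<le> C" by blast
    then have "p (x * y) \<le> B * C" if "p \<in> ck_seminorms" for p
    proof -
      have p: "cstar_seminorm p" using that by (simp add: ck_seminorms_def)
      have "p x * p y \<le> B * C"
        using \<open>\<forall>p\<in>ck_seminorms. p x \<le> B\<close> \<open>\<forall>p\<in>ck_seminorms. p y \<le> C\<close> that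
        by (intro mult_mono' cstar_seminorm_nonneg[OF p]) auto
      then show ?thesis using cstar_seminorm_mult[OF p, of x y] by linarith
    qed
    then show ?case by blast
  next
    case (scaleC c x)
    then obtain B where "\<forall>p\<in>ck_seminorms. p x \<le> B" by blast
    then have "p (c *\<^sub>C x) \<le> cmod c * B" if "p \<in> ck_seminorms" for p
      using that by (simp add: ck_seminorms_def cstar_seminorm_scaleC mult_left_mono)
    then show ?case by blast
  next
    case (star x)
    then show ?case by (auto simp: ck_seminorms_def cstar_seminorm_star)
  qed
  then show ?thesis by (auto intro: bdd_aboveI)
qed

lemma ck_seminorm_le: "p \<in> ck_seminorms \<Longrightarrow> p x \<le> ck_norm x"
  unfolding ck_norm_def by (rule cSUP_upper[OF _ bdd_ck_seminorms])

lemma ck_norm_least: "(\<And>p. p \<in> ck_seminorms \<Longrightarrow> p x \<le> B) \<Longrightarrow> ck_norm x \<le> B"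
  unfolding ck_norm_def using zero_in_ck_seminorms by (intro cSUP_least) auto

lemma ck_norm_nonneg: "0 \<le> ck_norm x"
  using ck_seminorm_le[OF zero_in_ck_seminorms] .

lemma cstar_seminorm_ck_norm: "cstar_seminorm ck_norm"
  unfolding cstar_seminorm_def
proof (intro conjI allI)
  fix x y :: "'a free_star" and c
  have p: "cstar_seminorm p" if "p \<in> ck_seminorms" for p :: "'a free_star \<Rightarrow> real"
    using that by (simp add: ck_seminorms_def)
  show "ck_norm (x + y) \<le> ck_norm x + ck_norm y"
    by (rule ck_norm_least)
      (auto intro: order_trans[OF cstar_seminorm_triangle[OF p]] add_mono ck_seminorm_le)
  show "ck_norm (x * y) \<le> ck_norm x * ck_norm y"
  proof (rule ck_norm_least)
    fix q :: "'a free_star \<Rightarrow> real"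
    assume q: "q \<in> ck_seminorms"
    have "q x * q y \<le> ck_norm x * ck_norm y"
      by (intro mult_mono' ck_seminorm_le[OF q] cstar_seminorm_nonneg[OF p[OF q]])
    then show "q (x * y) \<le> ck_norm x * ck_norm y"
      using cstar_seminorm_mult[OF p[OF q], of x y] by linarith
  qed
  have le: "ck_norm (c *\<^sub>C x) \<le> cmod c * ck_norm x" for c and x :: "'a free_star"
    by (rule ck_norm_least) (simp add: cstar_seminorm_scaleC[OF p] mult_left_mono ck_seminorm_le)
  have "ck_norm x \<le> ck_norm (c *\<^sub>C x) / cmod c" if "c \<noteq> 0"
    using le[of "inverse c" "c *\<^sub>C x"] that
    by (simp add: scaleC_scaleC scaleC_one norm_inverse divide_inverse mult.commute)
  then show "ck_norm (c *\<^sub>C x) = cmod c * ck_norm x"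
    using le[of c x] ck_norm_nonneg[of "c *\<^sub>C x"]
    by (cases "c = 0") (auto simp: field_simps intro: antisym)
  show "ck_norm (star x * x) = (ck_norm x)\<^sup>2"
  proof (rule antisym)
    show "ck_norm (star x * x) \<le> (ck_norm x)\<^sup>2"
      by (rule ck_norm_least)
        (auto simp: cstar_seminorm_star_mult[OF p] intro!: power_mono ck_seminorm_le
          cstar_seminorm_nonneg[OF p])
    have "p x \<le> sqrt (ck_norm (star x * x))" if "p \<in> ck_seminorms" for p
      using ck_seminorm_le[OF that, of "star x * x"]
      by (intro real_le_rsqrt) (simp add: cstar_seminorm_star_mult[OF p[OF that]])
    then have "ck_norm x \<le> sqrt (ck_norm (star x * x))"
      by (rule ck_norm_least)
    then show "(ck_norm x)\<^sup>2 \<le> ck_norm (star x * x)"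
      using ck_norm_nonneg by (metis power_mono real_sqrt_pow2)
  qed
qed

lemma ck_norm_relators: "r \<in> ck_relators gen \<Longrightarrow> ck_norm r = 0"
  by (intro antisym ck_norm_least ck_norm_nonneg) (simp add: ck_seminorms_def)

lemmas ck_norm_triangle = cstar_seminorm_triangle[OF cstar_seminorm_ck_norm]
  and ck_norm_scaleC = cstar_seminorm_scaleC[OF cstar_seminorm_ck_norm]
  and ck_norm_mult = cstar_seminorm_mult[OF cstar_seminorm_ck_norm]
  and ck_norm_star_mult = cstar_seminorm_star_mult[OF cstar_seminorm_ck_norm]
  and ck_norm_zero = cstar_seminorm_zero[OF cstar_seminorm_ck_norm]
  and ck_norm_minus = cstar_seminorm_minus[OF cstar_seminorm_ck_norm]
  and ck_norm_minus_commute = cstar_seminorm_minus_commute[OF cstar_seminorm_ck_norm]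
  and ck_norm_star = cstar_seminorm_star[OF cstar_seminorm_ck_norm]
  and ck_norm_triangle_diff = cstar_seminorm_triangle_diff[OF cstar_seminorm_ck_norm]
  and ck_norm_abs_diff = cstar_seminorm_abs_diff[OF cstar_seminorm_ck_norm]

definition ck_Cauchy :: "(nat \<Rightarrow> 'm::finite_two_graph_monoid free_star) \<Rightarrow> bool" where
  "ck_Cauchy X \<longleftrightarrow> (\<forall>e>0. \<exists>M. \<forall>m\<ge>M. \<forall>n\<ge>M. ck_norm (X m - X n) < e)"

lemma ck_CauchyD:
  "ck_Cauchy X \<Longrightarrow> e > 0 \<Longrightarrow> \<exists>M. \<forall>m n. m \<ge> M \<longrightarrow> n \<ge> M \<longrightarrow> ck_norm (X m - X n) < e"
  unfolding ck_Cauchy_def by blast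

definition ck_equiv ::
  "(nat \<Rightarrow> 'm::finite_two_graph_monoid free_star) \<Rightarrow> (nat \<Rightarrow> 'm free_star) \<Rightarrow> bool" where
  "ck_equiv X Y \<longleftrightarrow> ck_Cauchy X \<and> ck_Cauchy Y \<and> (\<lambda>n. ck_norm (X n - Y n)) \<longlonglongrightarrow> 0"

lemma ck_equiv_refl: "ck_equiv X X \<longleftrightarrow> ck_Cauchy X"
  by (auto simp: ck_equiv_def ck_norm_zero)

lemma ck_Cauchy_const: "ck_Cauchy (\<lambda>_. x)"
  by (auto simp: ck_Cauchy_def ck_norm_zero)

lemma ck_Cauchy_lipschitz:
  assumes "ck_Cauchy X" and le: "\<And>m n. ck_norm (Y m - Y n) \<le> C * ck_norm (X m - X n)"
  shows "ck_Cauchy Y"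
  unfolding ck_Cauchy_def
proof (intro allI impI)
  fix e :: real
  assume "e > 0"
  then have "e / (\<bar>C\<bar> + 1) > 0" by simp
  then obtain M where M: "\<And>m n. m \<ge> M \<Longrightarrow> n \<ge> M \<Longrightarrow> ck_norm (X m - X n) < e / (\<bar>C\<bar> + 1)"
    using ck_CauchyD[OF assms(1)] by blast
  have "ck_norm (Y m - Y n) < e" if "m \<ge> M" "n \<ge> M" for m n
  proof -
    have "ck_norm (Y m - Y n) \<le> (\<bar>C\<bar> + 1) * ck_norm (X m - X n)"
      by (rule order_trans[OF le]) (intro mult_right_mono ck_norm_nonneg; simp)
    also have "\<dots> < e"
      using M[OF that] by (simp add: field_simps)
    finally show ?thesis .
  qed
  then show "\<exists>M. \<forall>m\<ge>M. \<forall>n\<ge>M. ck_norm (Y m - Y n) < e" by blast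
qed

lemma ck_Cauchy_norm_convergent:
  assumes "ck_Cauchy X"
  shows "convergent (\<lambda>n. ck_norm (X n))"
proof -
  have "Cauchy (\<lambda>n. ck_norm (X n))"
    unfolding Cauchy_def dist_real_def
    using ck_CauchyD[OF assms] le_less_trans[OF ck_norm_abs_diff] by meson
  then show ?thesis by (rule Cauchy_convergent)
qed

lemma ck_Cauchy_bounded:
  assumes "ck_Cauchy X"
  obtains B where "B > 0" "\<And>n. ck_norm (X n) \<le> B"
proof -
  have "Bseq (\<lambda>n. ck_norm (X n))"
    using ck_Cauchy_norm_convergent[OF assms] by (rule convergent_imp_Bseq)
  then obtain B where "B > 0" "\<And>n. \<bar>ck_norm (X n)\<bar> \<le> B"
    by (auto simp: Bseq_def)
  then show ?thesis using that by (meson abs_le_D1)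
qed

lemma ck_Cauchy_add:
  assumes "ck_Cauchy X" "ck_Cauchy Y"
  shows "ck_Cauchy (\<lambda>n. X n + Y n)"
  unfolding ck_Cauchy_def
proof (intro allI impI)
  fix e :: real
  assume "e > 0"
  then have e: "e / 2 > 0" by simp
  obtain M where M: "\<And>m n. m \<ge> M \<Longrightarrow> n \<ge> M \<Longrightarrow> ck_norm (X m - X n) < e / 2"
    using ck_CauchyD[OF assms(1)] e by blast
  obtain N where N: "\<And>m n. m \<ge> N \<Longrightarrow> n \<ge> N \<Longrightarrow> ck_norm (Y m - Y n) < e / 2"
    using ck_CauchyD[OF assms(2)] e by blast
  have "ck_norm (X m + Y m - (X n + Y n)) < e" if "m \<ge> max M N" "n \<ge> max M N" for m n
    using M[of m n] N[of m n] that ck_norm_triangle[of "X m - X n" "Y m - Y n"]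
    by (simp add: add_diff_add)
  then show "\<exists>M. \<forall>m\<ge>M. \<forall>n\<ge>M. ck_norm (X m + Y m - (X n + Y n)) < e" by blast
qed

lemma ck_norm_mult_diff:
  "ck_norm (a * b - a' * b') \<le> ck_norm a * ck_norm (b - b') + ck_norm (a - a') * ck_norm b'"
proof -
  have "a * b - a' * b' = a * (b - b') + (a - a') * b'" by (simp add: algebra_simps)
  then show ?thesis
    using ck_norm_triangle[of "a * (b - b')" "(a - a') * b'"] ck_norm_mult[of a "b - b'"]
      ck_norm_mult[of "a - a'" b'] by simp
qed

lemma ck_Cauchy_mult:
  assumes "ck_Cauchy X" "ck_Cauchy Y"
  shows "ck_Cauchy (\<lambda>n. X n * Y n)"
  unfolding ck_Cauchy_def
proof (intro allI impI)
  fix e :: real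
  assume "e > 0"
  obtain B where B: "B > 0" "\<And>n. ck_norm (X n) \<le> B" using ck_Cauchy_bounded[OF assms(1)] by blast
  obtain C where C: "C > 0" "\<And>n. ck_norm (Y n) \<le> C" using ck_Cauchy_bounded[OF assms(2)] by blast
  have e: "e / (2 * C) > 0" "e / (2 * B) > 0" using \<open>e > 0\<close> B C by auto
  obtain M where M: "\<And>m n. m \<ge> M \<Longrightarrow> n \<ge> M \<Longrightarrow> ck_norm (X m - X n) < e / (2 * C)"
    using ck_CauchyD[OF assms(1)] e by blast
  obtain N where N: "\<And>m n. m \<ge> N \<Longrightarrow> n \<ge> N \<Longrightarrow> ck_norm (Y m - Y n) < e / (2 * B)"
    using ck_CauchyD[OF assms(2)] e by blast
  have "ck_norm (X m * Y m - X n * Y n) < e" if "m \<ge> max M N" "n \<ge> max M N" for m n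
  proof -
    have "ck_norm (X m) * ck_norm (Y m - Y n) \<le> B * ck_norm (Y m - Y n)"
      using B by (intro mult_right_mono ck_norm_nonneg)
    also have "\<dots> < e / 2" using N[of m n] that B(1) by (simp add: field_simps)
    finally have 1: "ck_norm (X m) * ck_norm (Y m - Y n) < e / 2" .
    have "ck_norm (X m - X n) * ck_norm (Y n) \<le> ck_norm (X m - X n) * C"
      using C by (intro mult_left_mono ck_norm_nonneg)
    also have "\<dots> < e / 2" using M[of m n] that C(1) by (simp add: field_simps)
    finally show ?thesis using 1 ck_norm_mult_diff[of "X m" "Y m" "X n" "Y n"] by linarith
  qed
  then show "\<exists>M. \<forall>m\<ge>M. \<forall>n\<ge>M. ck_norm (X m * Y m - X n * Y n) < e" by blast
qed

lemma ck_null_le: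
  assumes "\<And>n. ck_norm (X n) \<le> b n" "b \<longlonglongrightarrow> 0"
  shows "(\<lambda>n. ck_norm (X n)) \<longlonglongrightarrow> 0"
  using assms by (intro tendsto_sandwich[OF _ _ tendsto_const assms(2)]) (auto simp: ck_norm_nonneg)

lemma ck_equiv_lipschitz:
  assumes "ck_equiv X Y" and le: "\<And>x y. ck_norm (f x - f y) \<le> C * ck_norm (x - y)"
  shows "ck_equiv (\<lambda>n. f (X n)) (\<lambda>n. f (Y n))"
  unfolding ck_equiv_def
proof (intro conjI)
  show "ck_Cauchy (\<lambda>n. f (X n))" "ck_Cauchy (\<lambda>n. f (Y n))"
    using assms by (auto simp: ck_equiv_def intro: ck_Cauchy_lipschitz)
  have "(\<lambda>n. C * ck_norm (X n - Y n)) \<longlonglongrightarrow> C * 0"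
    using assms(1) by (intro tendsto_intros) (simp add: ck_equiv_def)
  then show "(\<lambda>n. ck_norm (f (X n) - f (Y n))) \<longlonglongrightarrow> 0"
    by (intro ck_null_le[OF le]) simp
qed

lemma ck_equiv_add:
  assumes "ck_equiv X X'" "ck_equiv Y Y'"
  shows "ck_equiv (\<lambda>n. X n + Y n) (\<lambda>n. X' n + Y' n)"
  unfolding ck_equiv_def
proof (intro conjI)
  show "ck_Cauchy (\<lambda>n. X n + Y n)" "ck_Cauchy (\<lambda>n. X' n + Y' n)"
    using assms by (auto simp: ck_equiv_def intro: ck_Cauchy_add)
  have le: "ck_norm (X n + Y n - (X' n + Y' n)) \<le> ck_norm (X n - X' n) + ck_norm (Y n - Y' n)" for n
    using ck_norm_triangle[of "X n - X' n" "Y n - Y' n"] by (simp add: add_diff_add)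
  have "(\<lambda>n. ck_norm (X n - X' n) + ck_norm (Y n - Y' n)) \<longlonglongrightarrow> 0 + 0"
    using assms by (intro tendsto_intros) (auto simp: ck_equiv_def)
  then show "(\<lambda>n. ck_norm (X n + Y n - (X' n + Y' n))) \<longlonglongrightarrow> 0"
    by (intro ck_null_le[OF le]) simp
qed

lemma ck_equiv_mult:
  assumes "ck_equiv X X'" "ck_equiv Y Y'"
  shows "ck_equiv (\<lambda>n. X n * Y n) (\<lambda>n. X' n * Y' n)"
  unfolding ck_equiv_def
proof (intro conjI)
  show "ck_Cauchy (\<lambda>n. X n * Y n)" "ck_Cauchy (\<lambda>n. X' n * Y' n)"
    using assms by (auto simp: ck_equiv_def intro: ck_Cauchy_mult)
  have X: "ck_Cauchy X" and Y': "ck_Cauchy Y'" using assms by (auto simp: ck_equiv_def)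
  obtain B where B: "B > 0" "\<And>n. ck_norm (X n) \<le> B" using ck_Cauchy_bounded[OF X] by blast
  obtain C where C: "C > 0" "\<And>n. ck_norm (Y' n) \<le> C" using ck_Cauchy_bounded[OF Y'] by blast
  have le: "ck_norm (X n * Y n - X' n * Y' n)
      \<le> B * ck_norm (Y n - Y' n) + ck_norm (X n - X' n) * C" for n
    by (rule order_trans[OF ck_norm_mult_diff])
      (intro add_mono mult_left_mono mult_right_mono B C ck_norm_nonneg)
  have "(\<lambda>n. B * ck_norm (Y n - Y' n) + ck_norm (X n - X' n) * C) \<longlonglongrightarrow> B * 0 + 0 * C"
    using assms by (intro tendsto_intros) (auto simp: ck_equiv_def)
  then show "(\<lambda>n. ck_norm (X n * Y n - X' n * Y' n)) \<longlonglongrightarrow> 0"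
    by (intro ck_null_le[OF le]) simp
qed

lemma ck_equiv_trans:
  assumes "ck_equiv X Y" "ck_equiv Y Z"
  shows "ck_equiv X Z"
proof -
  have "(\<lambda>n. ck_norm (X n - Y n) + ck_norm (Y n - Z n)) \<longlonglongrightarrow> 0 + 0"
    using assms by (intro tendsto_intros) (auto simp: ck_equiv_def)
  then have "(\<lambda>n. ck_norm (X n - Z n)) \<longlonglongrightarrow> 0"
    by (intro ck_null_le[of "\<lambda>n. X n - Z n" "\<lambda>n. ck_norm (X n - Y n) + ck_norm (Y n - Z n)"]
        ck_norm_triangle_diff) simp
  then show "ck_equiv X Z" using assms by (auto simp: ck_equiv_def)
qed

lemma ck_equiv_sym: "ck_equiv X Y \<Longrightarrow> ck_equiv Y X"
  by (auto simp: ck_equiv_def ck_norm_minus_commute)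

lemma ck_equiv_part_equivp: "part_equivp ck_equiv"
  using ck_Cauchy_const ck_equiv_refl
  by (intro part_equivpI sympI transpI) (blast intro: ck_equiv_sym ck_equiv_trans)+

quotient_type (overloaded) 'm ck_algebra =
    "nat \<Rightarrow> 'm::finite_two_graph_monoid free_star" / partial: ck_equiv
  morphisms rep_ck_algebra ck_lim
  by (rule ck_equiv_part_equivp)

lemma ck_norm_uminus_diff: "ck_norm (- x - - y) \<le> 1 * ck_norm (x - y)"
  using ck_norm_minus_commute[of x y] by simp

lemma ck_norm_scaleC_diff: "ck_norm (c *\<^sub>C x - c *\<^sub>C y) \<le> cmod c * ck_norm (x - y)"
proof -
  have "c *\<^sub>C x - c *\<^sub>C y = c *\<^sub>C (x - y)"
    using scaleC_add_right[of c "x - y" y] by simp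
  then show ?thesis by (simp add: ck_norm_scaleC)
qed

lemma ck_norm_star_diff: "ck_norm (star x - star y) \<le> 1 * ck_norm (x - y)"
  by (simp add: ck_norm_star flip: star_diff)

lemma ck_Cauchy_norm_LIMSEQ:
  "ck_Cauchy X \<Longrightarrow> (\<lambda>n. ck_norm (X n)) \<longlonglongrightarrow> lim (\<lambda>n. ck_norm (X n))"
  using ck_Cauchy_norm_convergent by (simp only: convergent_LIMSEQ_iff)

lemma ck_equiv_lim:
  assumes "ck_equiv X Y"
  shows "lim (\<lambda>n. ck_norm (X n)) = lim (\<lambda>n. ck_norm (Y n))"
proof -
  have c: "ck_Cauchy X" "ck_Cauchy Y" and z: "(\<lambda>n. ck_norm (X n - Y n)) \<longlonglongrightarrow> 0"
    using assms by (auto simp only: ck_equiv_def)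
  have "\<forall>\<^sub>F n in sequentially. norm (ck_norm (X n) - ck_norm (Y n)) \<le> ck_norm (X n - Y n)"
    by (intro always_eventually allI) (simp only: real_norm_def ck_norm_abs_diff)
  then have "(\<lambda>n. ck_norm (X n) - ck_norm (Y n)) \<longlonglongrightarrow> 0"
    using z by (rule Lim_null_comparison)
  with tendsto_diff[OF ck_Cauchy_norm_LIMSEQ[OF c(1)] ck_Cauchy_norm_LIMSEQ[OF c(2)]]
  have "lim (\<lambda>n. ck_norm (X n)) - lim (\<lambda>n. ck_norm (Y n)) = 0"
    by (rule LIMSEQ_unique)
  then show ?thesis by (simp only: right_minus_eq)
qed

instantiation ck_algebra :: (finite_two_graph_monoid) star_algebra
begin
lift_definition zero_ck_algebra :: "'a ck_algebra" is "\<lambda>_. 0"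
  by (simp add: ck_equiv_refl ck_Cauchy_const)
lift_definition plus_ck_algebra :: "'a ck_algebra \<Rightarrow> 'a ck_algebra \<Rightarrow> 'a ck_algebra"
  is "\<lambda>X Y n. X n + Y n" by (rule ck_equiv_add)
lift_definition uminus_ck_algebra :: "'a ck_algebra \<Rightarrow> 'a ck_algebra"
  is "\<lambda>X n. - X n" using ck_equiv_lipschitz[OF _ ck_norm_uminus_diff] .
lift_definition times_ck_algebra :: "'a ck_algebra \<Rightarrow> 'a ck_algebra \<Rightarrow> 'a ck_algebra"
  is "\<lambda>X Y n. X n * Y n" by (rule ck_equiv_mult)
lift_definition scaleC_ck_algebra :: "complex \<Rightarrow> 'a ck_algebra \<Rightarrow> 'a ck_algebra"
  is "\<lambda>c X n. c *\<^sub>C X n" using ck_equiv_lipschitz[OF _ ck_norm_scaleC_diff] .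
lift_definition star_ck_algebra :: "'a ck_algebra \<Rightarrow> 'a ck_algebra"
  is "\<lambda>X n. star (X n)" using ck_equiv_lipschitz[OF _ ck_norm_star_diff] .
definition minus_ck_algebra :: "'a ck_algebra \<Rightarrow> 'a ck_algebra \<Rightarrow> 'a ck_algebra" where
  "minus_ck_algebra x y = x + - y"

instance
proof
  have C: "ck_Cauchy (\<lambda>n. - X n)" if "ck_Cauchy X" for X :: "nat \<Rightarrow> 'a free_star"
    using that by (rule ck_Cauchy_lipschitz) (rule ck_norm_uminus_diff)
  have S: "ck_Cauchy (\<lambda>n. c *\<^sub>C X n)" if "ck_Cauchy X" for c and X :: "nat \<Rightarrow> 'a free_star"
    using that by (rule ck_Cauchy_lipschitz) (rule ck_norm_scaleC_diff)
  have T: "ck_Cauchy (\<lambda>n. star (X n))" if "ck_Cauchy X" for X :: "nat \<Rightarrow> 'a free_star"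
    using that by (rule ck_Cauchy_lipschitz) (rule ck_norm_star_diff)
  note closed = ck_equiv_refl ck_Cauchy_const ck_Cauchy_add ck_Cauchy_mult C S T
  fix a b c :: "'a ck_algebra" and k l
  show "a + b + c = a + (b + c)" by transfer (simp add: closed add.assoc)
  show "a + b = b + a" by transfer (simp add: closed add.commute)
  show "0 + a = a" by transfer (simp add: closed)
  show "- a + a = 0" by transfer (simp add: closed)
  show "a - b = a + - b" by (simp add: minus_ck_algebra_def)
  show "a * b * c = a * (b * c)" by transfer (simp add: closed mult.assoc)
  show "(a + b) * c = a * c + b * c" by transfer (simp add: closed distrib_right)
  show "a * (b + c) = a * b + a * c" by transfer (simp add: closed distrib_left)
  show "k *\<^sub>C (a + b) = k *\<^sub>C a + k *\<^sub>C b" by transfer (simp add: closed scaleC_add_right)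
  show "(k + l) *\<^sub>C a = k *\<^sub>C a + l *\<^sub>C a" by transfer (simp add: closed scaleC_add_left)
  show "k *\<^sub>C l *\<^sub>C a = (k * l) *\<^sub>C a" by transfer (simp add: closed scaleC_scaleC)
  show "1 *\<^sub>C a = a" by transfer (simp add: closed scaleC_one)
  show "(k *\<^sub>C a) * b = k *\<^sub>C (a * b)" by transfer (simp add: closed mult_scaleC_left)
  show "a * (k *\<^sub>C b) = k *\<^sub>C (a * b)" by transfer (simp add: closed mult_scaleC_right)
  show "star (a + b) = star a + star b" by transfer (simp add: closed star_add)
  show "star (k *\<^sub>C a) = cnj k *\<^sub>C star a" by transfer (simp add: closed star_scaleC)
  show "star (a * b) = star b * star a" by transfer (simp add: closed star_mult)
  show "star (star a) = a" by transfer (simp add: closed star_star)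
qed

end

lemma ck_lim_plus:
  "ck_Cauchy X \<Longrightarrow> ck_Cauchy Y \<Longrightarrow> ck_lim X + ck_lim Y = ck_lim (\<lambda>n. X n + Y n)"
  by (rule plus_ck_algebra.abs_eq) (simp_all only: ck_equiv_refl)

lemma ck_lim_mult:
  "ck_Cauchy X \<Longrightarrow> ck_Cauchy Y \<Longrightarrow> ck_lim X * ck_lim Y = ck_lim (\<lambda>n. X n * Y n)"
  by (rule times_ck_algebra.abs_eq) (simp_all only: ck_equiv_refl)

lemma ck_lim_uminus: "ck_Cauchy X \<Longrightarrow> - ck_lim X = ck_lim (\<lambda>n. - X n)"
  by (rule uminus_ck_algebra.abs_eq) (simp_all only: ck_equiv_refl)

lemma ck_lim_scaleC: "ck_Cauchy X \<Longrightarrow> c *\<^sub>C ck_lim X = ck_lim (\<lambda>n. c *\<^sub>C X n)"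
  by (rule scaleC_ck_algebra.abs_eq) (simp_all only: ck_equiv_refl)

lemma ck_lim_star: "ck_Cauchy X \<Longrightarrow> star (ck_lim X) = ck_lim (\<lambda>n. star (X n))"
  by (rule star_ck_algebra.abs_eq) (simp_all only: ck_equiv_refl)

lemma ck_Cauchy_uminus: "ck_Cauchy X \<Longrightarrow> ck_Cauchy (\<lambda>n. - X n)"
  by (erule ck_Cauchy_lipschitz) (rule ck_norm_uminus_diff)

lemma ck_Cauchy_diff: "ck_Cauchy X \<Longrightarrow> ck_Cauchy Y \<Longrightarrow> ck_Cauchy (\<lambda>n. X n - Y n)"
  using ck_Cauchy_add[OF _ ck_Cauchy_uminus, of X Y] by simp

lemma ck_Cauchy_scaleC: "ck_Cauchy X \<Longrightarrow> ck_Cauchy (\<lambda>n. c *\<^sub>C X n)"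
  by (erule ck_Cauchy_lipschitz) (rule ck_norm_scaleC_diff)

lemma ck_Cauchy_star: "ck_Cauchy X \<Longrightarrow> ck_Cauchy (\<lambda>n. star (X n))"
  by (erule ck_Cauchy_lipschitz) (rule ck_norm_star_diff)

lemma ck_lim_diff:
  "ck_Cauchy X \<Longrightarrow> ck_Cauchy Y \<Longrightarrow> ck_lim X - ck_lim Y = ck_lim (\<lambda>n. X n - Y n)"
  by (simp add: minus_ck_algebra_def ck_lim_uminus ck_lim_plus ck_Cauchy_uminus)

lemma ck_lim_eq_0_iff:
  assumes "ck_Cauchy X"
  shows "ck_lim X = 0 \<longleftrightarrow> (\<lambda>n. ck_norm (X n)) \<longlonglongrightarrow> 0"
proof -
  have "ck_lim X = 0 \<longleftrightarrow> ck_equiv X (\<lambda>_. 0)"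
    unfolding zero_ck_algebra_def
    using Quotient_rel[OF Quotient_ck_algebra, of X "\<lambda>_. 0"] assms
    by (simp only: ck_equiv_refl ck_Cauchy_const simp_thms)
  also have "\<dots> \<longleftrightarrow> (\<lambda>n. ck_norm (X n)) \<longlonglongrightarrow> 0"
    using assms by (simp add: ck_equiv_def ck_Cauchy_const)
  finally show ?thesis .
qed

lemma ck_lim_cases: obtains X where "ck_Cauchy X" "a = ck_lim X"
proof -
  have "ck_equiv (rep_ck_algebra a) (rep_ck_algebra a)" "ck_lim (rep_ck_algebra a) = a"
    using Quotient_rep_reflp[OF Quotient_ck_algebra] Quotient_abs_rep[OF Quotient_ck_algebra] by auto
  then show ?thesis using that by (metis ck_equiv_refl)
qed

instantiation ck_algebra :: (finite_two_graph_monoid) real_normed_algebra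
begin
lift_definition norm_ck_algebra :: "'a ck_algebra \<Rightarrow> real" is "\<lambda>X. lim (\<lambda>n. ck_norm (X n))"
  by (rule ck_equiv_lim)
definition scaleR_ck_algebra :: "real \<Rightarrow> 'a ck_algebra \<Rightarrow> 'a ck_algebra" where
  "scaleR_ck_algebra r x = of_real r *\<^sub>C x"
definition sgn_ck_algebra :: "'a ck_algebra \<Rightarrow> 'a ck_algebra" where
  "sgn_ck_algebra x = inverse (norm x) *\<^sub>R x"
definition dist_ck_algebra :: "'a ck_algebra \<Rightarrow> 'a ck_algebra \<Rightarrow> real" where
  "dist_ck_algebra x y = norm (x - y)"
definition uniformity_ck_algebra :: "('a ck_algebra \<times> 'a ck_algebra) filter" where
  "uniformity_ck_algebra = (INF e\<in>{0<..}. principal {(x, y). dist x y < e})"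
definition open_ck_algebra :: "'a ck_algebra set \<Rightarrow> bool" where
  "open_ck_algebra U \<longleftrightarrow> (\<forall>x\<in>U. \<forall>\<^sub>F (x', y) in uniformity. x' = x \<longrightarrow> y \<in> U)"

lemma norm_ck_lim: "ck_Cauchy X \<Longrightarrow> (\<lambda>n. ck_norm (X n)) \<longlonglongrightarrow> norm (ck_lim X)"
  using ck_Cauchy_norm_LIMSEQ norm_ck_algebra.abs_eq by (metis ck_equiv_refl)

instance
proof
  fix a b :: "'a ck_algebra" and r s :: real
  obtain X where X: "ck_Cauchy X" "a = ck_lim X" by (rule ck_lim_cases)
  obtain Y where Y: "ck_Cauchy Y" "b = ck_lim Y" by (rule ck_lim_cases)
  show "r *\<^sub>R (a + b) = r *\<^sub>R a + r *\<^sub>R b" "(r + s) *\<^sub>R a = r *\<^sub>R a + s *\<^sub>R a"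
    "r *\<^sub>R s *\<^sub>R a = (r * s) *\<^sub>R a" "1 *\<^sub>R a = a"
    "r *\<^sub>R a * b = r *\<^sub>R (a * b)" "a * r *\<^sub>R b = r *\<^sub>R (a * b)"
    by (simp_all add: scaleR_ck_algebra_def scaleC_add_right scaleC_add_left scaleC_scaleC
        scaleC_one mult_scaleC_left mult_scaleC_right)
  show "dist a b = norm (a - b)" "sgn a = inverse (norm a) *\<^sub>R a"
    by (rule dist_ck_algebra_def sgn_ck_algebra_def)+
  show "uniformity = (INF e\<in>{0<..}. principal {(x, y :: 'a ck_algebra). dist x y < e})"
    by (rule uniformity_ck_algebra_def)
  show "open U \<longleftrightarrow> (\<forall>x\<in>U. \<forall>\<^sub>F (x', y) in uniformity. x' = x \<longrightarrow> y \<in> U)" for U :: "'a ck_algebra set"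
    by (rule open_ck_algebra_def)
  show "norm a = 0 \<longleftrightarrow> a = 0"
    unfolding X(2) ck_lim_eq_0_iff[OF X(1)]
    using norm_ck_lim[OF X(1)] by (metis LIMSEQ_unique)
  have "(\<lambda>n. ck_norm (X n + Y n)) \<longlonglongrightarrow> norm (a + b)"
    unfolding X(2) Y(2) ck_lim_plus[OF X(1) Y(1)] by (intro norm_ck_lim ck_Cauchy_add X Y)
  moreover have "(\<lambda>n. ck_norm (X n) + ck_norm (Y n)) \<longlonglongrightarrow> norm a + norm b"
    unfolding X(2) Y(2) by (intro tendsto_add norm_ck_lim X Y)
  ultimately show "norm (a + b) \<le> norm a + norm b"
    by (rule LIMSEQ_le) (use ck_norm_triangle in blast)
  have "(\<lambda>n. ck_norm (X n * Y n)) \<longlonglongrightarrow> norm (a * b)"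
    unfolding X(2) Y(2) ck_lim_mult[OF X(1) Y(1)] by (intro norm_ck_lim ck_Cauchy_mult X Y)
  moreover have "(\<lambda>n. ck_norm (X n) * ck_norm (Y n)) \<longlonglongrightarrow> norm a * norm b"
    unfolding X(2) Y(2) by (intro tendsto_mult norm_ck_lim X Y)
  ultimately show "norm (a * b) \<le> norm a * norm b"
    by (rule LIMSEQ_le) (use ck_norm_mult in blast)
  have "(\<lambda>n. ck_norm (of_real r *\<^sub>C X n)) \<longlonglongrightarrow> norm (r *\<^sub>R a)"
    unfolding X(2) scaleR_ck_algebra_def ck_lim_scaleC[OF X(1)]
    by (intro norm_ck_lim ck_Cauchy_scaleC X)
  moreover have "(\<lambda>n. ck_norm (of_real r *\<^sub>C X n)) \<longlonglongrightarrow> \<bar>r\<bar> * norm a"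
    unfolding X(2) ck_norm_scaleC norm_of_real by (intro tendsto_mult tendsto_const norm_ck_lim X)
  ultimately show "norm (r *\<^sub>R a) = \<bar>r\<bar> * norm a"
    by (rule LIMSEQ_unique)
qed
end

definition ck_embed :: "'m::finite_two_graph_monoid free_star \<Rightarrow> 'm ck_algebra" where
  "ck_embed x = ck_lim (\<lambda>_. x)"

lemma norm_ck_embed: "norm (ck_embed x) = ck_norm x"
  using norm_ck_lim[OF ck_Cauchy_const, of x] unfolding ck_embed_def
  by (metis LIMSEQ_unique tendsto_const)

lemma ck_embed_simps:
  "ck_embed 0 = 0"
  "ck_embed (x + y) = ck_embed x + ck_embed y"
  "ck_embed (x - y) = ck_embed x - ck_embed y"
  "ck_embed (x * y) = ck_embed x * ck_embed y"
  "ck_embed (c *\<^sub>C x) = c *\<^sub>C ck_embed x"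
  "ck_embed (star x) = star (ck_embed x)"
  by (simp_all add: ck_embed_def ck_lim_plus ck_lim_diff ck_lim_mult ck_lim_scaleC ck_lim_star
      ck_Cauchy_const zero_ck_algebra_def)

lemma ck_embed_LIMSEQ:
  assumes "ck_Cauchy X"
  shows "(\<lambda>n. ck_embed (X n)) \<longlonglongrightarrow> ck_lim X"
proof (rule metric_LIMSEQ_I)
  fix e :: real
  assume "e > 0"
  then have "e / 2 > 0" by simp
  then obtain M where M: "\<And>m n. m \<ge> M \<Longrightarrow> n \<ge> M \<Longrightarrow> ck_norm (X m - X n) < e / 2"
    using ck_CauchyD[OF assms] by blast
  have "dist (ck_embed (X m)) (ck_lim X) < e" if "m \<ge> M" for m
  proof -
    have "(\<lambda>n. ck_norm (X m - X n)) \<longlonglongrightarrow> norm (ck_embed (X m) - ck_lim X)"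
      unfolding ck_embed_def ck_lim_diff[OF ck_Cauchy_const assms]
      by (intro norm_ck_lim ck_Cauchy_diff ck_Cauchy_const assms)
    moreover have "\<forall>n\<ge>M. ck_norm (X m - X n) \<le> e / 2"
      using M[OF that] less_imp_le by blast
    ultimately have "norm (ck_embed (X m) - ck_lim X) \<le> e / 2"
      using LIMSEQ_le_const2 by blast
    then show ?thesis using \<open>e > 0\<close> by (simp add: dist_norm)
  qed
  then show "\<exists>M. \<forall>m\<ge>M. dist (ck_embed (X m)) (ck_lim X) < e" by blast
qed

instance ck_algebra :: (finite_two_graph_monoid) cstar_algebra
proof
  fix a :: "'a ck_algebra" and r :: real and c :: complex
  obtain X where X: "ck_Cauchy X" "a = ck_lim X" by (rule ck_lim_cases)
  show "r *\<^sub>R a = of_real r *\<^sub>C a" by (rule scaleR_ck_algebra_def)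
  have "(\<lambda>n. ck_norm (c *\<^sub>C X n)) \<longlonglongrightarrow> norm (c *\<^sub>C a)"
    unfolding X(2) ck_lim_scaleC[OF X(1)] by (intro norm_ck_lim ck_Cauchy_scaleC X)
  moreover have "(\<lambda>n. ck_norm (c *\<^sub>C X n)) \<longlonglongrightarrow> cmod c * norm a"
    unfolding X(2) ck_norm_scaleC by (intro tendsto_mult tendsto_const norm_ck_lim X)
  ultimately show "norm (c *\<^sub>C a) = cmod c * norm a"
    by (rule LIMSEQ_unique)
  have "(\<lambda>n. ck_norm (star (X n) * X n)) \<longlonglongrightarrow> norm (star a * a)"
    unfolding X(2) ck_lim_star[OF X(1)] ck_lim_mult[OF ck_Cauchy_star[OF X(1)] X(1)]
    by (intro norm_ck_lim ck_Cauchy_mult ck_Cauchy_star X)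
  moreover have "(\<lambda>n. ck_norm (star (X n) * X n)) \<longlonglongrightarrow> (norm a)\<^sup>2"
    unfolding X(2) ck_norm_star_mult by (intro tendsto_power norm_ck_lim X)
  ultimately show "norm (star a * a) = (norm a)\<^sup>2"
    by (rule LIMSEQ_unique)
next
  fix A :: "nat \<Rightarrow> 'a ck_algebra"
  assume A: "Cauchy A"
  have "\<exists>x. dist (ck_embed x) (A k) < inverse (Suc k)" for k
  proof -
    obtain X where X: "ck_Cauchy X" "A k = ck_lim X" by (rule ck_lim_cases)
    show ?thesis
      using metric_LIMSEQ_D[OF ck_embed_LIMSEQ[OF X(1)], of "inverse (Suc k)"] X(2) by auto
  qed
  then obtain x where x: "\<And>k. dist (ck_embed (x k)) (A k) < inverse (Suc k)" by metis
  have lim: "(\<lambda>k. dist (ck_embed (x k)) (A k)) \<longlonglongrightarrow> 0"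
  proof (rule tendsto_sandwich[OF _ _ tendsto_const LIMSEQ_inverse_real_of_nat])
    show "\<forall>\<^sub>F k in sequentially. 0 \<le> dist (ck_embed (x k)) (A k)"
      by (intro always_eventually allI zero_le_dist)
    show "\<forall>\<^sub>F k in sequentially. dist (ck_embed (x k)) (A k) \<le> inverse (Suc k)"
      by (intro always_eventually allI less_imp_le x)
  qed
  have "ck_Cauchy x"
    unfolding ck_Cauchy_def
  proof (intro allI impI)
    fix e :: real
    assume "e > 0"
    then have e: "e / 3 > 0" by simp
    obtain M where M: "\<And>m n. m \<ge> M \<Longrightarrow> n \<ge> M \<Longrightarrow> dist (A m) (A n) < e / 3"
      using metric_CauchyD[OF A e] by blast
    obtain N where N: "\<And>m. m \<ge> N \<Longrightarrow> dist (ck_embed (x m)) (A m) < e / 3"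
      using metric_LIMSEQ_D[OF lim e] by auto
    have "ck_norm (x m - x n) < e" if "m \<ge> max M N" "n \<ge> max M N" for m n
    proof -
      have "dist (ck_embed (x m)) (ck_embed (x n))
          \<le> dist (ck_embed (x m)) (A m) + (dist (A m) (A n) + dist (ck_embed (x n)) (A n))"
        using dist_triangle[of "ck_embed (x m)" "ck_embed (x n)" "A m"]
          dist_triangle[of "A m" "ck_embed (x n)" "A n"] by (simp only: dist_commute)
      also have "\<dots> < e" using M[of m n] N[of m] N[of n] that by auto
      finally show ?thesis by (simp only: dist_norm norm_ck_embed flip: ck_embed_simps(3))
    qed
    then show "\<exists>M. \<forall>m\<ge>M. \<forall>n\<ge>M. ck_norm (x m - x n) < e" by blast
  qed
  then have "(\<lambda>k. ck_embed (x k)) \<longlonglongrightarrow> ck_lim x" by (rule ck_embed_LIMSEQ)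
  moreover have "(\<lambda>k. ck_embed (x k) - A k) \<longlonglongrightarrow> 0"
    using lim by (simp only: dist_norm tendsto_norm_zero_iff)
  ultimately have "A \<longlonglongrightarrow> ck_lim x" by (rule Lim_transform2)
  then show "convergent A" by (auto simp: convergent_def)
qed

definition ck_gen :: "'m::finite_two_graph_monoid \<Rightarrow> 'm ck_algebra" where
  "ck_gen \<mu> = ck_embed (gen \<mu>)"

lemma ck_embed_sum: "ck_embed (sum f A) = (\<Sum>i\<in>A. ck_embed (f i))"
  by (induction A rule: infinite_finite_induct) (simp_all add: ck_embed_simps)

lemma ck_family_ck_gen: "ck_family (ck_gen :: 'm::finite_two_graph_monoid \<Rightarrow> 'm ck_algebra)"
proof -
  have "ck_relators (ck_gen :: 'm \<Rightarrow> _) = ck_embed ` ck_relators gen"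
    unfolding ck_relators_def image_Un image_insert image_empty image_image
    by (simp add: case_prod_unfold ck_gen_def ck_embed_simps ck_embed_sum)
  moreover have "ck_embed r = 0" if "r \<in> ck_relators gen" for r :: "'m free_star"
    using ck_norm_relators[OF that] norm_ck_embed[of r] by (simp only: norm_eq_zero)
  ultimately show ?thesis by (auto simp: ck_family_iff)
qed

lemma cstar_seminorm_norm: "cstar_seminorm (norm :: 'a::cstar_algebra \<Rightarrow> real)"
  by (simp add: cstar_seminorm_def norm_triangle_ineq norm_scaleC norm_mult_ineq norm_star_mult)

lemma norm_free_eval_le:
  fixes S :: "'m::finite_two_graph_monoid \<Rightarrow> 'a::cstar_algebra"
  assumes "ck_family S"
  shows "norm (free_eval S x) \<le> ck_norm x"
proof (rule ck_seminorm_le)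
  have "cstar_seminorm (\<lambda>x. norm (free_eval S x))"
    by (simp add: cstar_seminorm_def norm_triangle_ineq norm_scaleC norm_mult_ineq norm_star_mult)
  moreover have "free_eval S r = 0" if "r \<in> ck_relators gen" for r
    using assms that unfolding ck_family_iff ck_relators_free_eval[of S] by blast
  ultimately show "(\<lambda>x. norm (free_eval S x)) \<in> ck_seminorms"
    by (simp add: ck_seminorms_def)
qed

lemma tendsto_scaleC:
  fixes L :: "'a::cstar_algebra"
  assumes "X \<longlonglongrightarrow> L"
  shows "(\<lambda>n. c *\<^sub>C X n) \<longlonglongrightarrow> c *\<^sub>C L"
proof (rule Lim_null_comparison[THEN LIM_zero_cancel])
  have "c *\<^sub>C X n - c *\<^sub>C L = c *\<^sub>C (X n - L)" for n
    using scaleC_add_right[of c "X n - L" L] by simp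
  then show "\<forall>\<^sub>F n in sequentially. norm (c *\<^sub>C X n - c *\<^sub>C L) \<le> cmod c * norm (X n - L)"
    by (simp add: norm_scaleC)
  show "(\<lambda>n. cmod c * norm (X n - L)) \<longlonglongrightarrow> 0"
    using assms by (intro tendsto_mult_right_zero tendsto_norm_zero LIM_zero)
qed

lemma tendsto_star:
  fixes L :: "'a::cstar_algebra"
  assumes "X \<longlonglongrightarrow> L"
  shows "(\<lambda>n. star (X n)) \<longlonglongrightarrow> star L"
proof (rule Lim_null_comparison[THEN LIM_zero_cancel])
  show "\<forall>\<^sub>F n in sequentially. norm (star (X n) - star L) \<le> norm (X n - L)"
    by (simp add: cstar_seminorm_star[OF cstar_seminorm_norm] flip: star_diff)
  show "(\<lambda>n. norm (X n - L)) \<longlonglongrightarrow> 0"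
    using assms by (intro tendsto_norm_zero LIM_zero)
qed

theorem ck_algebra_universal:
  fixes S :: "'m::finite_two_graph_monoid \<Rightarrow> 'a::cstar_algebra"
  assumes "ck_family S"
  shows "\<exists>!h. star_hom h \<and> continuous_on UNIV h \<and> (\<forall>\<mu>. h (ck_gen \<mu>) = S \<mu>)"
proof -
  have "\<exists>L. \<forall>X. ck_Cauchy X \<longrightarrow> ck_lim X = a \<longrightarrow> (\<lambda>n. free_eval S (X n)) \<longlonglongrightarrow> L" for a
  proof -
    obtain X where X: "ck_Cauchy X" "a = ck_lim X" by (rule ck_lim_cases)
    have "Cauchy (\<lambda>n. free_eval S (X n))"
      unfolding Cauchy_def dist_norm free_eval_diff[symmetric]
      using ck_CauchyD[OF X(1)] le_less_trans[OF norm_free_eval_le[OF assms]] by meson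
    then obtain L where L: "(\<lambda>n. free_eval S (X n)) \<longlonglongrightarrow> L"
      using Cauchy_convergent convergent_def by blast
    have "(\<lambda>n. free_eval S (Y n)) \<longlonglongrightarrow> L" if Y: "ck_Cauchy Y" "ck_lim Y = a" for Y
    proof (rule Lim_transform[OF L])
      have "ck_lim (\<lambda>n. Y n - X n) = ck_lim Y - ck_lim X"
        by (rule ck_lim_diff[OF Y(1) X(1), symmetric])
      also have "\<dots> = 0" by (simp only: Y(2) X(2)[symmetric] diff_self)
      finally have "(\<lambda>n. ck_norm (Y n - X n)) \<longlonglongrightarrow> 0"
        by (rule ck_lim_eq_0_iff[OF ck_Cauchy_diff[OF Y(1) X(1)], THEN iffD1])
      moreover have "\<forall>\<^sub>F n in sequentially. norm (free_eval S (Y n) - free_eval S (X n)) \<le> ck_norm (Y n - X n)"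
        unfolding free_eval_diff[symmetric]
        by (intro always_eventually allI norm_free_eval_le[OF assms])
      ultimately show "(\<lambda>n. free_eval S (Y n) - free_eval S (X n)) \<longlonglongrightarrow> 0"
        by (rule Lim_null_comparison[rotated])
    qed
    then show ?thesis by blast
  qed
  then obtain h where h: "\<And>X. ck_Cauchy X \<Longrightarrow> (\<lambda>n. free_eval S (X n)) \<longlonglongrightarrow> h (ck_lim X)"
    by metis
  have h_embed: "h (ck_embed x) = free_eval S x" for x
    using h[OF ck_Cauchy_const, of x] unfolding ck_embed_def by (rule LIMSEQ_unique) (rule tendsto_const)
  have add: "h (a + b) = h a + h b" and mult: "h (a * b) = h a * h b"
    and scale: "h (c *\<^sub>C a) = c *\<^sub>C h a" and star: "h (star a) = star (h a)"
    and le: "norm (h a) \<le> norm a" for a b c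
  proof -
    obtain X where X: "ck_Cauchy X" "a = ck_lim X" by (rule ck_lim_cases)
    obtain Y where Y: "ck_Cauchy Y" "b = ck_lim Y" by (rule ck_lim_cases)
    note hX = h[OF X(1)] and hY = h[OF Y(1)]
    show "h (a + b) = h a + h b"
      using h[OF ck_Cauchy_add[OF X(1) Y(1)]] tendsto_add[OF hX hY]
      unfolding X(2) Y(2) ck_lim_plus[OF X(1) Y(1)] free_eval_simps by (rule LIMSEQ_unique)
    show "h (a * b) = h a * h b"
      using h[OF ck_Cauchy_mult[OF X(1) Y(1)]] tendsto_mult[OF hX hY]
      unfolding X(2) Y(2) ck_lim_mult[OF X(1) Y(1)] free_eval_simps by (rule LIMSEQ_unique)
    show "h (c *\<^sub>C a) = c *\<^sub>C h a"
      using h[OF ck_Cauchy_scaleC[OF X(1)]] tendsto_scaleC[OF hX]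
      unfolding X(2) ck_lim_scaleC[OF X(1)] free_eval_simps by (rule LIMSEQ_unique)
    show "h (star a) = star (h a)"
      using h[OF ck_Cauchy_star[OF X(1)]] tendsto_star[OF hX]
      unfolding X(2) ck_lim_star[OF X(1)] free_eval_simps by (rule LIMSEQ_unique)
    show "norm (h a) \<le> norm a"
      unfolding X(2) using tendsto_norm[OF hX] norm_ck_lim[OF X(1)]
      by (rule LIMSEQ_le) (use norm_free_eval_le[OF assms] in blast)
  qed
  have hom: "star_hom h"
    by (simp add: star_hom_def add mult scale star)
  have "h (- a) = - h a" for a
    using scale[of "-1" a] by (simp only: scaleC_minus_one)
  then have diff: "h (a - b) = h a - h b" for a b
    using add[of a "- b"] by simp
  have cont: "continuous_on UNIV h"
    unfolding continuous_on_iff dist_norm diff[symmetric] using le_less_trans[OF le] by blast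
  show ?thesis
  proof (rule ex1I[of _ h])
    show "star_hom h \<and> continuous_on UNIV h \<and> (\<forall>\<mu>. h (ck_gen \<mu>) = S \<mu>)"
      using hom cont by (simp add: ck_gen_def h_embed)
  next
    fix g
    assume g: "star_hom g \<and> continuous_on UNIV g \<and> (\<forall>\<mu>. g (ck_gen \<mu>) = S \<mu>)"
    then have g_add: "g (a + b) = g a + g b" and g_mult: "g (a * b) = g a * g b"
      and g_scale: "g (c *\<^sub>C a) = c *\<^sub>C g a" and g_star: "g (star a) = star (g a)" for a b c
      by (simp_all add: star_hom_def)
    have g_zero: "g 0 = 0" using g_scale[of 0 0] by simp
    have g_embed: "g (ck_embed x) = free_eval S x" for x
    proof (induction x rule: free_star_induct)
      case (gen m)
      then show ?case using g by (simp add: ck_gen_def)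
    next
      case (uminus x)
      have "g (ck_embed ((-1) *\<^sub>C x)) = (-1) *\<^sub>C g (ck_embed x)"
        by (simp only: ck_embed_simps g_scale)
      then show ?case by (simp only: uminus scaleC_minus_one free_eval_simps)
    qed (simp_all add: ck_embed_simps g_zero g_add g_mult g_scale g_star)
    have "g a = h a" for a
    proof -
      obtain X where X: "ck_Cauchy X" "a = ck_lim X" by (rule ck_lim_cases)
      have "(\<lambda>n. g (ck_embed (X n))) \<longlonglongrightarrow> g (ck_lim X)"
        using g ck_embed_LIMSEQ[OF X(1)] by (auto intro: continuous_on_tendsto_compose)
      then show ?thesis
        unfolding X(2) g_embed using h[OF X(1)] by (rule LIMSEQ_unique)
    qed
    then show "g = h" by blast
  qed
qed


section \<open>The Hilbert space \<open>L\<^sup>2\<close>\<close>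

definition l2_fun :: "'x measure \<Rightarrow> ('x \<Rightarrow> complex) set" where
  "l2_fun M = {\<phi> \<in> borel_measurable M. integrable M (\<lambda>x. (cmod (\<phi> x))\<^sup>2)}"

definition l2_class :: "'x measure \<Rightarrow> ('x \<Rightarrow> complex) \<Rightarrow> ('x \<Rightarrow> complex) set" where
  "l2_class M \<phi> = {\<psi> \<in> l2_fun M. AE x in M. \<psi> x = \<phi> x}"

definition l2 :: "'x measure \<Rightarrow> ('x \<Rightarrow> complex) set set" where
  "l2 M = l2_class M ` l2_fun M"

text \<open>The operations on classes are computed on representatives; see \<open>l2_add_class\<close> etc.\<close>

definition l2_rep :: "('x \<Rightarrow> complex) set \<Rightarrow> 'x \<Rightarrow> complex" where
  "l2_rep A = (SOME \<phi>. \<phi> \<in> A)"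

definition l2_add ::
  "'x measure \<Rightarrow> ('x \<Rightarrow> complex) set \<Rightarrow> ('x \<Rightarrow> complex) set \<Rightarrow> ('x \<Rightarrow> complex) set" where
  "l2_add M A B = l2_class M (\<lambda>x. l2_rep A x + l2_rep B x)"

definition l2_scale ::
  "'x measure \<Rightarrow> complex \<Rightarrow> ('x \<Rightarrow> complex) set \<Rightarrow> ('x \<Rightarrow> complex) set" where
  "l2_scale M c A = l2_class M (\<lambda>x. c * l2_rep A x)"

definition l2_inner ::
  "'x measure \<Rightarrow> ('x \<Rightarrow> complex) set \<Rightarrow> ('x \<Rightarrow> complex) set \<Rightarrow> complex" where
  "l2_inner M A B = (\<integral>x. l2_rep A x * cnj (l2_rep B x) \<partial>M)"

definition l2_norm :: "'x measure \<Rightarrow> ('x \<Rightarrow> complex) set \<Rightarrow> real" where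
  "l2_norm M A = sqrt (\<integral>x. (cmod (l2_rep A x))\<^sup>2 \<partial>M)"

lemma l2_rep_AE:
  assumes "\<phi> \<in> l2_fun M"
  shows "l2_rep (l2_class M \<phi>) \<in> l2_fun M" "AE x in M. l2_rep (l2_class M \<phi>) x = \<phi> x"
proof -
  have "\<phi> \<in> l2_class M \<phi>" using assms by (simp add: l2_class_def)
  then have "l2_rep (l2_class M \<phi>) \<in> l2_class M \<phi>"
    unfolding l2_rep_def by (rule someI[of "\<lambda>\<psi>. \<psi> \<in> l2_class M \<phi>"])
  then show "l2_rep (l2_class M \<phi>) \<in> l2_fun M" "AE x in M. l2_rep (l2_class M \<phi>) x = \<phi> x"
    by (auto simp: l2_class_def)
qed

lemma l2_class_cong: "AE x in M. \<phi> x = \<psi> x \<Longrightarrow> l2_class M \<phi> = l2_class M \<psi>"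
  unfolding l2_class_def by (auto elim: AE_mp)

lemma l2_class_eq_iff:
  assumes "\<phi> \<in> l2_fun M" 
  shows "l2_class M \<phi> = l2_class M \<psi> \<longleftrightarrow> (AE x in M. \<phi> x = \<psi> x)"
  using assms by (auto simp: l2_class_def intro: l2_class_cong[unfolded l2_class_def])

lemma l2_add_class:
  assumes "\<phi> \<in> l2_fun M" "\<psi> \<in> l2_fun M"
  shows "l2_add M (l2_class M \<phi>) (l2_class M \<psi>) = l2_class M (\<lambda>x. \<phi> x + \<psi> x)"
  unfolding l2_add_def by (rule l2_class_cong) (use assms[THEN l2_rep_AE(2)] in auto)

lemma l2_scale_class:
  assumes "\<phi> \<in> l2_fun M"
  shows "l2_scale M c (l2_class M \<phi>) = l2_class M (\<lambda>x. c * \<phi> x)"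
  unfolding l2_scale_def by (rule l2_class_cong) (use l2_rep_AE(2)[OF assms] in auto)

lemma l2_inner_class:
  assumes "\<phi> \<in> l2_fun M" "\<psi> \<in> l2_fun M"
  shows "l2_inner M (l2_class M \<phi>) (l2_class M \<psi>) = (\<integral>x. \<phi> x * cnj (\<psi> x) \<partial>M)"
proof -
  have "AE x in M. l2_rep (l2_class M \<phi>) x * cnj (l2_rep (l2_class M \<psi>) x) = \<phi> x * cnj (\<psi> x)"
    using assms[THEN l2_rep_AE(2)] by auto
  moreover note assms[THEN l2_rep_AE(1)]
  ultimately show ?thesis
    unfolding l2_inner_def
    using assms
    by (intro integral_cong_AE borel_measurable_times
        measurable_compose[OF _ borel_measurable_continuous_onI[OF continuous_on_cnj[OF continuous_on_id]]])
      (auto simp: l2_fun_def)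
qed

text \<open>Elements of \<open>B(L\<^sup>2)\<close> are \<open>undefined\<close> outside \<open>L\<^sup>2\<close>, so that equality of operators is
  equality of functions.\<close>

definition bounded_operators ::
  "'x measure \<Rightarrow> (('x \<Rightarrow> complex) set \<Rightarrow> ('x \<Rightarrow> complex) set) set" where
  "bounded_operators M = {T \<in> l2 M \<rightarrow>\<^sub>E l2 M.
     (\<forall>A\<in>l2 M. \<forall>B\<in>l2 M. T (l2_add M A B) = l2_add M (T A) (T B))
     \<and> (\<forall>c. \<forall>A\<in>l2 M. T (l2_scale M c A) = l2_scale M c (T A))
     \<and> (\<exists>C. \<forall>A\<in>l2 M. l2_norm M (T A) \<le> C * l2_norm M A)}"

definition l2_star_hom ::
  "'x measure \<Rightarrow> ('a::star_algebra \<Rightarrow> ('x \<Rightarrow> complex) set \<Rightarrow> ('x \<Rightarrow> complex) set) \<Rightarrow> bool" where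
  "l2_star_hom M \<pi> \<longleftrightarrow>
     (\<forall>a. \<pi> a \<in> bounded_operators M)
     \<and> (\<forall>a b. \<forall>A\<in>l2 M. \<pi> (a + b) A = l2_add M (\<pi> a A) (\<pi> b A))
     \<and> (\<forall>c a. \<forall>A\<in>l2 M. \<pi> (c *\<^sub>C a) A = l2_scale M c (\<pi> a A))
     \<and> (\<forall>a b. \<forall>A\<in>l2 M. \<pi> (a * b) A = \<pi> a (\<pi> b A))
     \<and> (\<forall>a. \<forall>A\<in>l2 M. \<forall>B\<in>l2 M. l2_inner M (\<pi> (star a) A) B = l2_inner M A (\<pi> a B))"


section \<open>Branching systems\<close>

text \<open>The last argument \<open>g\<close> is the family of the (almost everywhere) inverse maps
  \<open>f\<^sub>\<mu>\<^sup>-\<^sup>1\<close>.  Only the values of \<open>R\<close>, \<open>f\<close>, \<open>g\<close> on edges matter.\<close>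

definition branching_system ::
  "'x measure \<Rightarrow> 'x set \<Rightarrow> ('m::two_graph_monoid \<Rightarrow> 'x set)
    \<Rightarrow> ('m \<Rightarrow> 'x \<Rightarrow> 'x) \<Rightarrow> ('m \<Rightarrow> 'x \<Rightarrow> 'x) \<Rightarrow> bool" where
  "branching_system \<eta> D R f g \<longleftrightarrow>
     D \<in> sets \<eta> \<and> (\<forall>\<mu>\<in>edges. R \<mu> \<in> sets \<eta>)
     \<and> (\<forall>\<mu>\<in>edges. \<forall>\<nu>\<in>edges. deg \<mu> = deg \<nu> \<longrightarrow> \<mu> \<noteq> \<nu> \<longrightarrow> R \<mu> \<inter> R \<nu> \<in> null_sets \<eta>)
     \<and> (\<forall>\<mu>\<in>edges.
          f \<mu> \<in> restrict_space \<eta> D \<rightarrow>\<^sub>M restrict_space \<eta> (R \<mu>)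
          \<and> g \<mu> \<in> restrict_space \<eta> (R \<mu>) \<rightarrow>\<^sub>M restrict_space \<eta> D
          \<and> (AE x in restrict_space \<eta> D. g \<mu> (f \<mu> x) = x)
          \<and> (AE x in restrict_space \<eta> (R \<mu>). f \<mu> (g \<mu> x) = x)
          \<and> absolutely_continuous (restrict_space \<eta> D)
               (distr (restrict_space \<eta> (R \<mu>)) (restrict_space \<eta> D) (g \<mu>))
          \<and> absolutely_continuous (restrict_space \<eta> (R \<mu>))
               (distr (restrict_space \<eta> D) (restrict_space \<eta> (R \<mu>)) (f \<mu>)))
     \<and> (\<forall>\<mu>\<in>edges. \<forall>\<nu>\<in>edges. \<forall>\<alpha>\<in>edges. \<forall>\<beta>\<in>edges. \<mu> * \<nu> = \<alpha> * \<beta> \<longrightarrow>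
          (AE x in restrict_space \<eta> D. f \<mu> (f \<nu> x) = f \<alpha> (f \<beta> x)))
     \<and> (\<forall>n\<in>{(1, 0), (0, 1)}. AE x in \<eta>. x \<in> (\<Union>\<mu>\<in>{\<mu>. deg \<mu> = n}. R \<mu>) \<longleftrightarrow> x \<in> D)"

text \<open>The Radon-Nikodym derivative of \<open>\<eta> \<circ> f\<^sub>\<mu>\<^sup>-\<^sup>1\<close>, the push-forward under \<open>f\<^sub>\<mu>\<close> of
  \<open>\<eta>\<close> on \<open>D\<close>, with respect to \<open>\<eta>\<close> on \<open>R\<^sub>\<mu>\<close>.\<close>

definition branching_density ::
  "'x measure \<Rightarrow> 'x set \<Rightarrow> ('m \<Rightarrow> 'x set) \<Rightarrow> ('m \<Rightarrow> 'x \<Rightarrow> 'x) \<Rightarrow> 'm \<Rightarrow> 'x \<Rightarrow> real" where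
  "branching_density \<eta> D R f \<mu> x =
     enn2real (RN_deriv (restrict_space \<eta> (R \<mu>))
       (distr (restrict_space \<eta> D) (restrict_space \<eta> (R \<mu>)) (f \<mu>)) x)"

definition arises_from_branching_system ::
  "'x measure \<Rightarrow> 'x set \<Rightarrow> ('m::finite_two_graph_monoid \<Rightarrow> 'x set)
    \<Rightarrow> ('m \<Rightarrow> 'x \<Rightarrow> 'x) \<Rightarrow> ('m \<Rightarrow> 'x \<Rightarrow> 'x)
    \<Rightarrow> ('m ck_algebra \<Rightarrow> ('x \<Rightarrow> complex) set \<Rightarrow> ('x \<Rightarrow> complex) set) \<Rightarrow> bool" where
  "arises_from_branching_system \<eta> D R f g \<pi> \<longleftrightarrow>
     l2_star_hom \<eta> \<pi>
     \<and> (\<forall>\<mu>\<in>edges. \<forall>\<phi>\<in>l2_fun \<eta>. \<pi> (ck_gen \<mu>) (l2_class \<eta> \<phi>) =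
          l2_class \<eta> (\<lambda>x. if x \<in> R \<mu>
            then of_real (sqrt (branching_density \<eta> D R f \<mu> x)) * \<phi> (g \<mu> x) else 0))
     \<and> (\<forall>\<phi>\<in>l2_fun \<eta>. \<pi> (ck_gen 1) (l2_class \<eta> \<phi>) = l2_class \<eta> (\<lambda>x. indicator D x * \<phi> x))"

definition branching_representation ::
  "'x measure \<Rightarrow> 'x set \<Rightarrow> ('m::finite_two_graph_monoid \<Rightarrow> 'x set)
    \<Rightarrow> ('m \<Rightarrow> 'x \<Rightarrow> 'x) \<Rightarrow> ('m \<Rightarrow> 'x \<Rightarrow> 'x)
    \<Rightarrow> 'm ck_algebra \<Rightarrow> ('x \<Rightarrow> complex) set \<Rightarrow> ('x \<Rightarrow> complex) set" where
  "branching_representation \<eta> D R f g = (THE \<pi>. arises_from_branching_system \<eta> D R f g \<pi>)"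

end

theory Submission
  imports Defs
begin

text \<open>
  Call a vector \<open>\<zeta>\<close> separating up to \<open>K\<close> if the vectors \<open>\<pi>(s\<^sub>\<mu>)\<zeta>\<close> with \<open>d(\<mu>) \<le> (K, K)\<close> are
  nonzero and pairwise orthogonal.  A combination \<open>y\<close> of products \<open>s\<^sub>\<mu> s\<^sub>\<nu>\<^sup>*\<close> with degrees at most
  \<open>(L, L)\<close> can be rewritten with \<open>d(\<nu>) = (L, L)\<close> and \<open>d(\<mu>) \<le> (2L, 2L)\<close>.  Testing \<open>\<pi>(y)\<close> on the span
  of the \<open>\<pi>(s\<^sub>\<nu>)\<zeta>\<close> shows that each of the \<open>(2L + 1)\<^sup>2\<close> parts of \<open>y\<close> of fixed \<open>d(\<mu>)\<close> has norm at most
  \<open>\<parallel>\<pi>(y)\<parallel>\<close>, so \<open>\<parallel>y\<parallel> \<le> (2L + 1)\<^sup>2 \<parallel>\<pi>(y)\<parallel>\<close>.  The constant grows polynomially in \<open>L\<close>; applying the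
  bound to high powers of \<open>x\<^sup>*x\<close> therefore gives \<open>\<parallel>x\<parallel> \<le> \<parallel>\<pi>(x)\<parallel>\<close>, first on a dense *-subalgebra and
  then, *-homomorphisms being contractive, everywhere.

  On the square, \<open>x \<mapsto> x\<^sup>2\<close> and \<open>x \<mapsto> \<surd>x\<close> shift the integer \<open>\<lfloor>log\<^sub>2 (- ln x)\<rfloor>\<close> by one up and down, and
  the binary expansion of \<open>y\<close> records the indices of the edges.  Since \<open>\<mu>\<close> is determined by \<open>d(\<mu>)\<close> and
  its word of indices, a function supported where that integer is constant and the expansion
  begins with \<open>1\<dots>12\<close> is separating.
\<close>

section \<open>Operators on a complex Hilbert space\<close>

text \<open>Faithfulness is not automatic. Since
  \<open>e\<^sub>i f\<^sub>j = f\<^sub>i e\<^sub>j\<close>, removing an e or an f from the front of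
  a path leaves the same indices: the graph is periodic, and the sum over i of
  \<open>s(e\<^sub>i) star(s(f\<^sub>i))\<close> is a central unitary. Uniqueness theorems for
  aperiodic graphs do not apply, and a representation on functions of y alone could send that
  unitary to 1. The coordinate x breaks the periodicity: there the unitary acts through x -> x^4,
  which raises the level by 2. Levels and index words take the place of a gauge action, for they
  make the parts of different degree orthogonal. The obstacle in the norm estimate is that the
  number of paths grows exponentially with the degree, while the number of degrees in a box grows
  only quadratically. Counting paths is affordable only inside a span of one fixed degree, which is
  closed under multiplication, so that taking powers removes the count. Across degrees only the
  number of degrees may enter.\<close>

text \<open>A complex Hilbert space is a real one with an orthogonal complex structure \<open>imul\<close>
  (multiplication by \<open>\<i>\<close>); \<open>inner\<close> is then the real part of the complex inner product.\<close>

class complex_hilbert = real_inner + complete_space +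
  fixes imul :: "'a \<Rightarrow> 'a"
  assumes imul_add: "imul (x + y) = imul x + imul y"
    and imul_scaleR: "imul (r *\<^sub>R x) = r *\<^sub>R imul x"
    and imul_imul [simp]: "imul (imul x) = - x"
    and inner_imul_imul: "inner (imul x) (imul y) = inner x y"
begin
subclass banach ..
end

lemma imul_zero [simp]: "imul 0 = (0::'h::complex_hilbert)"
  using imul_scaleR[of 0 0] by simp

lemma imul_minus: "imul (- x) = - imul (x::'h::complex_hilbert)"
  using imul_scaleR[of "-1" x] by simp

lemma inner_imul_left: "inner (imul x) y = - inner x (imul (y::'h::complex_hilbert))"
  using inner_imul_imul[of x "- imul y"] by (simp add: imul_minus)

lemma inner_imul_self [simp]: "inner x (imul (x::'h::complex_hilbert)) = 0" "inner (imul x) x = 0"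
  using inner_imul_left[of x x] by (simp_all add: inner_commute)

definition cscale :: "complex \<Rightarrow> 'h \<Rightarrow> 'h::complex_hilbert" where
  "cscale c x = Re c *\<^sub>R x + Im c *\<^sub>R imul x"

lemma cscale_simps:
  "cscale c (x + y) = cscale c x + cscale c y"
  "cscale (c + d) x = cscale c x + cscale d x"
  "cscale c (cscale d x) = cscale (c * d) x"
  "cscale 1 x = x"
  "cscale c 0 = 0"
  "cscale 0 x = 0"
  "cscale c (r *\<^sub>R x) = r *\<^sub>R cscale c x"
  "cscale c (imul x) = imul (cscale c x)"
  by (simp_all add: cscale_def algebra_simps imul_add imul_scaleR imul_minus)

lemma norm_cscale: "norm (cscale c x) = cmod c * norm x"
  for x :: "'h::complex_hilbert"
proof -
  have "(norm (cscale c x))\<^sup>2 = (Re c)\<^sup>2 * inner x x + (Im c)\<^sup>2 * inner x x"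
    by (simp add: cscale_def power2_norm_eq_inner inner_imul_imul inner_add_left inner_add_right)
      (simp add: power2_eq_square)
  also have "\<dots> = (cmod c * norm x)\<^sup>2"
    by (simp add: cmod_power2 power2_norm_eq_inner power_mult_distrib distrib_right)
  finally show ?thesis by simp
qed

lemma inner_cscale_left: "inner (cscale c x) y = inner x (cscale (cnj c) y)"
  by (simp add: cscale_def inner_add_left inner_diff_right inner_imul_left)

lemma cscale_sum: "cscale c (sum f A) = (\<Sum>i\<in>A. cscale c (f i))"
  by (induction A rule: infinite_finite_induct) (auto simp: cscale_simps)

section \<open>The C*-algebra of adjointable operators\<close>

definition is_adjoint :: "('h::complex_hilbert \<Rightarrow>\<^sub>L 'h) \<Rightarrow> ('h \<Rightarrow>\<^sub>L 'h) \<Rightarrow> bool" where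
  "is_adjoint T T' \<longleftrightarrow> (\<forall>x y. inner (T x) y = inner x (T' y))"

lemma is_adjoint_sym: "is_adjoint T T' \<Longrightarrow> is_adjoint T' T"
  unfolding is_adjoint_def by (metis inner_commute)

text \<open>Every bounded operator has an adjoint; requiring one spares the Riesz representation
  theorem.\<close>

definition adjointable :: "('h::complex_hilbert \<Rightarrow>\<^sub>L 'h) \<Rightarrow> bool" where
  "adjointable T \<longleftrightarrow> (\<forall>x. T (imul x) = imul (T x)) \<and> (\<exists>T'. is_adjoint T T')"

text \<open>Testing against all vectors moves \<open>imul\<close> across the adjoint relation, so
  complex linearity passes to the adjoint. This keeps \<open>star\<close> inside the type
  \<open>adj_op\<close>.\<close>

lemma adjointable_adjoint:
  assumes "adjointable T" "is_adjoint T T'"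
  shows "adjointable T'"
proof -
  have "T' (imul y) = imul (T' y)" for y
  proof (rule vector_eq_ldot[THEN iffD1], intro allI)
    fix x
    have "inner x (T' (imul y)) = inner (T x) (imul y)"
      using assms(2) by (simp add: is_adjoint_def)
    also have "\<dots> = - inner (T (imul x)) y"
      using assms(1) by (simp add: adjointable_def inner_imul_left)
    also have "\<dots> = inner x (imul (T' y))"
      using assms(2) by (simp add: is_adjoint_def inner_imul_left)
    finally show "inner x (T' (imul y)) = inner x (imul (T' y))" .
  qed
  then show ?thesis using assms is_adjoint_sym by (auto simp: adjointable_def)
qed

lemma is_adjoint_intros:
  "is_adjoint T T' \<Longrightarrow> is_adjoint S S' \<Longrightarrow> is_adjoint (T + S) (T' + S')"
  "is_adjoint T T' \<Longrightarrow> is_adjoint S S' \<Longrightarrow> is_adjoint (T o\<^sub>L S) (S' o\<^sub>L T')"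
  "is_adjoint 0 0" "is_adjoint T T' \<Longrightarrow> is_adjoint (- T) (- T')"
  "is_adjoint id_blinfun id_blinfun"
  by (auto simp: is_adjoint_def inner_add blinfun.add_left blinfun.minus_left)

lemma adjointable_intros:
  "adjointable T \<Longrightarrow> adjointable S \<Longrightarrow> adjointable (T + S)"
  "adjointable T \<Longrightarrow> adjointable S \<Longrightarrow> adjointable (T o\<^sub>L S)"
  "adjointable 0" "adjointable T \<Longrightarrow> adjointable (- T)" "adjointable id_blinfun"
  unfolding adjointable_def
  by (auto simp: blinfun.add_left blinfun.minus_left imul_add imul_minus intro: is_adjoint_intros)

lift_definition cscale_blinfun :: "complex \<Rightarrow> 'h \<Rightarrow>\<^sub>L 'h::complex_hilbert" is cscale
  by (rule_tac bounded_linear_intro) (auto simp: cscale_simps norm_cscale intro!: eq_refl mult.commute)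

lemma is_adjoint_cscale: "is_adjoint (cscale_blinfun c) (cscale_blinfun (cnj c))"
  by (simp add: is_adjoint_def cscale_blinfun.rep_eq inner_cscale_left)

lemma adjointable_cscale: "adjointable (cscale_blinfun c)"
  unfolding adjointable_def using is_adjoint_cscale
  by (auto simp: cscale_blinfun.rep_eq cscale_simps)

typedef (overloaded) 'h adj_op = "{T :: 'h::complex_hilbert \<Rightarrow>\<^sub>L 'h. adjointable T}"
  morphisms op_blinfun Adj_op
  using adjointable_intros(3) by blast

setup_lifting type_definition_adj_op

definition op_apply :: "'h::complex_hilbert adj_op \<Rightarrow> 'h \<Rightarrow> 'h" (infixr "\<cdot>" 90) where
  "op_apply T = blinfun_apply (op_blinfun T)"

lemma op_eqI: "(\<And>x. T \<cdot> x = S \<cdot> x) \<Longrightarrow> T = S"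
  unfolding op_apply_def by (rule op_blinfun_inject[THEN iffD1], rule blinfun_eqI)

instantiation adj_op :: (complex_hilbert) "{star_algebra, real_normed_algebra}"
begin
lift_definition zero_adj_op :: "'a adj_op" is 0 by (rule adjointable_intros)
lift_definition plus_adj_op :: "'a adj_op \<Rightarrow> 'a adj_op \<Rightarrow> 'a adj_op" is "(+)" by (rule adjointable_intros)
lift_definition uminus_adj_op :: "'a adj_op \<Rightarrow> 'a adj_op" is "uminus" by (rule adjointable_intros)
lift_definition times_adj_op :: "'a adj_op \<Rightarrow> 'a adj_op \<Rightarrow> 'a adj_op" is "(o\<^sub>L)" by (rule adjointable_intros)
lift_definition scaleC_adj_op :: "complex \<Rightarrow> 'a adj_op \<Rightarrow> 'a adj_op" is "\<lambda>c T. cscale_blinfun c o\<^sub>L T"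
  by (intro adjointable_intros adjointable_cscale)
lift_definition star_adj_op :: "'a adj_op \<Rightarrow> 'a adj_op" is "\<lambda>T. SOME T'. is_adjoint T T'"
  by (rule adjointable_adjoint, assumption, rule someI_ex) (simp add: adjointable_def)
lift_definition norm_adj_op :: "'a adj_op \<Rightarrow> real" is norm .
definition minus_adj_op :: "'a adj_op \<Rightarrow> 'a adj_op \<Rightarrow> 'a adj_op" where "minus_adj_op x y = x + - y"
definition scaleR_adj_op :: "real \<Rightarrow> 'a adj_op \<Rightarrow> 'a adj_op" where
  "scaleR_adj_op r x = of_real r *\<^sub>C x"
definition sgn_adj_op :: "'a adj_op \<Rightarrow> 'a adj_op" where
  "sgn_adj_op x = inverse (norm x) *\<^sub>R x"
definition dist_adj_op :: "'a adj_op \<Rightarrow> 'a adj_op \<Rightarrow> real" where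
  "dist_adj_op x y = norm (x - y)"
definition uniformity_adj_op :: "('a adj_op \<times> 'a adj_op) filter" where
  "uniformity_adj_op = (INF e\<in>{0<..}. principal {(x, y). dist x y < e})"
definition open_adj_op :: "'a adj_op set \<Rightarrow> bool" where
  "open_adj_op U \<longleftrightarrow> (\<forall>x\<in>U. \<forall>\<^sub>F (x', y) in uniformity. x' = x \<longrightarrow> y \<in> U)"

lemma op_apply_simps [simp]:
  fixes S T :: "'a adj_op"
  shows "(0::'a adj_op) \<cdot> x = 0" "(S + T) \<cdot> x = S \<cdot> x + T \<cdot> x" "(- T) \<cdot> x = - (T \<cdot> x)"
    "(S - T) \<cdot> x = S \<cdot> x - T \<cdot> x" "(S * T) \<cdot> x = S \<cdot> T \<cdot> x" "(c *\<^sub>C T) \<cdot> x = cscale c (T \<cdot> x)"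
  by (simp_all add: op_apply_def zero_adj_op.rep_eq plus_adj_op.rep_eq uminus_adj_op.rep_eq
      minus_adj_op_def times_adj_op.rep_eq scaleC_adj_op.rep_eq cscale_blinfun.rep_eq
      blinfun.add_left blinfun.minus_left blinfun.diff_left)

lemma op_apply_linear:
  fixes T :: "'a adj_op"
  shows "T \<cdot> (x + y) = T \<cdot> x + T \<cdot> y" "T \<cdot> 0 = 0" "T \<cdot> (r *\<^sub>R x) = r *\<^sub>R (T \<cdot> x)"
    "T \<cdot> (- x) = - (T \<cdot> x)" "T \<cdot> (x - y) = T \<cdot> x - T \<cdot> y"
    "T \<cdot> (imul x) = imul (T \<cdot> x)" "T \<cdot> (cscale c x) = cscale c (T \<cdot> x)"
  using op_blinfun[of T]
  by (simp_all add: op_apply_def blinfun.bilinear_simps adjointable_def cscale_def)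

lemma inner_star_right: "inner x ((star T) \<cdot> y) = inner (T \<cdot> x) (y::'a)"
proof -
  have "is_adjoint (op_blinfun T) (op_blinfun (star T))"
    unfolding star_adj_op.rep_eq
    using op_blinfun[of T] by (intro someI_ex[of "is_adjoint (op_blinfun T)"]) (simp add: adjointable_def)
  then show ?thesis by (simp add: is_adjoint_def op_apply_def)
qed

lemma star_eqI:
  assumes "\<And>x y::'a. inner (T \<cdot> x) y = inner x (T' \<cdot> y)"
  shows "star T = T'"
  by (rule op_eqI, rule vector_eq_ldot[THEN iffD1]) (simp add: inner_star_right assms)

lemma norm_op_apply: "norm (T \<cdot> x) \<le> norm T * norm (x::'a)"
  by (simp add: op_apply_def norm_adj_op.rep_eq norm_blinfun)

lemma norm_op_le: "0 \<le> B \<Longrightarrow> (\<And>x::'a. norm (T \<cdot> x) \<le> B * norm x) \<Longrightarrow> norm T \<le> B"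
  unfolding op_apply_def norm_adj_op.rep_eq by (rule norm_blinfun_bound)

lemma norm_scaleC_le: "norm (c *\<^sub>C T) \<le> cmod c * norm T" for T :: "'a adj_op"
proof (rule norm_op_le)
  show "norm ((c *\<^sub>C T) \<cdot> x) \<le> cmod c * norm T * norm x" for x
    using mult_left_mono[OF norm_op_apply[of T x], of "cmod c"] by (simp add: norm_cscale mult.assoc)
qed (simp add: norm_adj_op.rep_eq)

lemma norm_star_le: "norm (star T) \<le> norm T" for T :: "'a adj_op"
proof (rule norm_op_le)
  show "norm (star T \<cdot> x) \<le> norm T * norm x" for x
  proof (cases "star T \<cdot> x = 0")
    case True
    then show ?thesis by (simp add: norm_adj_op.rep_eq)
  next
    case False
    \<comment> \<open>Cauchy-Schwarz bounds the square of the norm of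
      \<open>star T \<cdot> x\<close> by a product containing that norm once more; cancelling it
      requires the case split on zero.\<close>
    have "norm (star T \<cdot> x) * norm (star T \<cdot> x) = inner (T \<cdot> star T \<cdot> x) x"
      using inner_star_right[of "star T \<cdot> x" T x] by (simp add: dot_square_norm power2_eq_square)
    also have "\<dots> \<le> norm (T \<cdot> star T \<cdot> x) * norm x" by (rule norm_cauchy_schwarz)
    also have "\<dots> \<le> norm T * norm (star T \<cdot> x) * norm x"
      by (intro mult_right_mono norm_op_apply norm_ge_zero)
    also have "\<dots> = norm (star T \<cdot> x) * (norm T * norm x)" by (simp only: ac_simps)
    finally show ?thesis
      by (rule mult_left_le_imp_le) (simp add: False)
  qed
  show "0 \<le> norm T" by (simp add: norm_adj_op.rep_eq)
qed

lemma norm_scaleC_adj_op: "norm (c *\<^sub>C S) = cmod c * norm S" for S :: "'a adj_op"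
proof (cases "c = 0")
  case False
  have "inverse c *\<^sub>C c *\<^sub>C S = S"
    using False by (intro op_eqI) (simp add: cscale_simps)
  then have "norm S \<le> cmod (inverse c) * norm (c *\<^sub>C S)"
    using norm_scaleC_le[of "inverse c" "c *\<^sub>C S"] by (simp only:)
  then have "norm S * cmod c \<le> norm (c *\<^sub>C S)"
    using False by (simp only: norm_inverse) (simp add: field_simps)
  then show ?thesis using norm_scaleC_le[of c S] by (simp add: mult.commute)
next
  case True
  have "0 *\<^sub>C S = 0" by (rule op_eqI) (simp add: cscale_simps)
  with True show ?thesis by (simp add: norm_adj_op.rep_eq zero_adj_op.rep_eq)
qed

instance
proof
  fix S T U :: "'a adj_op" and c d :: complex and r s :: real
  show "S + T + U = S + (T + U)" "S + T = T + S" "0 + S = S" "- S + S = 0" "S - T = S + - T"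
    "S * T * U = S * (T * U)" "(S + T) * U = S * U + T * U" "S * (T + U) = S * T + S * U"
    "c *\<^sub>C (S + T) = c *\<^sub>C S + c *\<^sub>C T" "(c + d) *\<^sub>C S = c *\<^sub>C S + d *\<^sub>C S"
    "c *\<^sub>C d *\<^sub>C S = (c * d) *\<^sub>C S" "1 *\<^sub>C S = S" "(c *\<^sub>C S) * T = c *\<^sub>C (S * T)"
    "S * (c *\<^sub>C T) = c *\<^sub>C (S * T)"
    "r *\<^sub>R (S + T) = r *\<^sub>R S + r *\<^sub>R T" "(r + s) *\<^sub>R S = r *\<^sub>R S + s *\<^sub>R S"
    "r *\<^sub>R s *\<^sub>R S = (r * s) *\<^sub>R S" "1 *\<^sub>R S = S" "(r *\<^sub>R S) * T = r *\<^sub>R (S * T)"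
    "S * (r *\<^sub>R T) = r *\<^sub>R (S * T)"
    by (rule op_eqI; simp add: scaleR_adj_op_def cscale_simps op_apply_linear)+
  show "star (S + T) = star S + star T" "star (S * T) = star T * star S"
    by (rule star_eqI; simp add: inner_add_left inner_add_right inner_star_right)+
  show "star (c *\<^sub>C S) = cnj c *\<^sub>C star S"
    by (rule star_eqI)
      (metis inner_cscale_left inner_star_right op_apply_linear(7) op_apply_simps(6))
  show "star (star S) = S"
    by (rule star_eqI) (metis inner_commute inner_star_right)
  show "dist S T = norm (S - T)" "sgn S = inverse (norm S) *\<^sub>R S"
    "uniformity = (INF e\<in>{0<..}. principal {(x, y :: 'a adj_op). dist x y < e})"
    by (rule dist_adj_op_def sgn_adj_op_def uniformity_adj_op_def)+
  show "open V \<longleftrightarrow> (\<forall>x\<in>V. \<forall>\<^sub>F (x', y) in uniformity. x' = x \<longrightarrow> y \<in> V)" for V :: "'a adj_op set"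
    by (rule open_adj_op_def)
  show "norm S = 0 \<longleftrightarrow> S = 0" "norm (S + T) \<le> norm S + norm T" "norm (S * T) \<le> norm S * norm T"
    by (transfer, simp add: norm_triangle_ineq norm_blinfun_compose)+
  show "norm (r *\<^sub>R S) = \<bar>r\<bar> * norm S" by (simp add: scaleR_adj_op_def norm_scaleC_adj_op)
qed

end

instance adj_op :: (complex_hilbert) cstar_algebra
proof
  fix S T :: "'a adj_op" and c :: complex and r :: real
  show "r *\<^sub>R S = of_real r *\<^sub>C S" by (rule scaleR_adj_op_def)
  show "norm (c *\<^sub>C S) = cmod c * norm S" by (rule norm_scaleC_adj_op)
  show "norm (star S * S) = (norm S)\<^sup>2"
  proof (rule antisym)
    have "norm (star S * S) \<le> norm (star S) * norm S" by (rule norm_mult_ineq)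
    also have "\<dots> \<le> norm S * norm S" by (rule mult_right_mono[OF norm_star_le norm_ge_zero])
    finally show "norm (star S * S) \<le> (norm S)\<^sup>2" by (simp only: power2_eq_square)
    have nn: "0 \<le> norm (star S * S)" by (rule norm_ge_zero)
    have "norm S \<le> sqrt (norm (star S * S))"
    proof (rule norm_op_le)
      fix x
      have "(norm (S \<cdot> x))\<^sup>2 = inner x ((star S * S) \<cdot> x)"
        by (simp add: power2_norm_eq_inner inner_star_right)
      also have "\<dots> \<le> norm x * (norm (star S * S) * norm x)"
        using norm_cauchy_schwarz[of x "(star S * S) \<cdot> x"]
          mult_left_mono[OF norm_op_apply[of "star S * S" x] norm_ge_zero[of x]] by linarith
      also have "\<dots> = (sqrt (norm (star S * S)) * norm x)\<^sup>2"
        using nn by (simp add: power_mult_distrib power2_eq_square)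
      finally show "norm (S \<cdot> x) \<le> sqrt (norm (star S * S)) * norm x"
        by (rule power2_le_imp_le) (simp add: nn)
    qed (simp add: nn)
    then have "(norm S)\<^sup>2 \<le> (sqrt (norm (star S * S)))\<^sup>2" by (rule power_mono) simp
    then show "(norm S)\<^sup>2 \<le> norm (star S * S)" using nn by simp
  qed
next
  fix X :: "nat \<Rightarrow> 'a adj_op"
  assume X: "Cauchy X"
  have d: "dist S T = dist (op_blinfun S) (op_blinfun T)" for S T :: "'a adj_op"
    unfolding dist_norm norm_adj_op.rep_eq minus_adj_op_def plus_adj_op.rep_eq uminus_adj_op.rep_eq
    by (simp only: diff_conv_add_uminus)
  \<comment> \<open>Contractivity of \<open>star\<close> makes the adjoints a Cauchy sequence too;
    their limit certifies that the limit of the operators has an adjoint.\<close>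
  have d': "dist (star (X m)) (star (X n)) \<le> dist (X m) (X n)" for m n
    unfolding dist_norm star_diff[symmetric] by (rule norm_star_le)
  have "Cauchy (\<lambda>n. op_blinfun (X n))" using X by (simp add: Cauchy_def d)
  then obtain L where L: "(\<lambda>n. op_blinfun (X n)) \<longlonglongrightarrow> L" using Cauchy_convergent convergent_def by blast
  have "Cauchy (\<lambda>n. op_blinfun (star (X n)))"
    using X d' unfolding Cauchy_def d[symmetric] by (meson le_less_trans)
  then obtain L' where L': "(\<lambda>n. op_blinfun (star (X n))) \<longlonglongrightarrow> L'"
    using Cauchy_convergent convergent_def by blast
  have Lx: "(\<lambda>n. X n \<cdot> x) \<longlonglongrightarrow> L x" and L'x: "(\<lambda>n. star (X n) \<cdot> x) \<longlonglongrightarrow> L' x" for x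
    unfolding op_apply_def by (intro blinfun.tendsto L L' tendsto_const)+
  have "inner (L x) y = inner x (L' y)" for x y
  proof (rule LIMSEQ_unique)
    show "(\<lambda>n. inner (X n \<cdot> x) y) \<longlonglongrightarrow> inner (L x) y" by (rule tendsto_inner[OF Lx tendsto_const])
    show "(\<lambda>n. inner (X n \<cdot> x) y) \<longlonglongrightarrow> inner x (L' y)"
      unfolding inner_star_right[symmetric] by (rule tendsto_inner[OF tendsto_const L'x])
  qed
  moreover have "L (imul x) = imul (L x)" for x
  proof (rule LIMSEQ_unique[OF Lx])
    have "(imul :: 'a \<Rightarrow> 'a) = cscale_blinfun \<i>"
      by (simp add: fun_eq_iff cscale_blinfun.rep_eq cscale_def)
    then have "bounded_linear (imul :: 'a \<Rightarrow> 'a)"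
      using blinfun.bounded_linear_right[of "cscale_blinfun \<i> :: 'a \<Rightarrow>\<^sub>L 'a"] by metis
    then show "(\<lambda>n. X n \<cdot> imul x) \<longlonglongrightarrow> imul (L x)"
      unfolding op_apply_linear by (rule bounded_linear.tendsto) (rule Lx)
  qed
  ultimately have "adjointable L" by (auto simp: adjointable_def is_adjoint_def)
  then have L_eq: "op_blinfun (Adj_op L) = L" by (simp add: Adj_op_inverse)
  have "\<forall>e>0. \<exists>N. \<forall>n\<ge>N. dist (X n) (Adj_op L) < e"
    using L unfolding lim_sequentially d L_eq .
  then have "X \<longlonglongrightarrow> Adj_op L" unfolding lim_sequentially .
  then show "convergent X" by (auto simp: convergent_def)
qed


subsection \<open>Automatic contractivity\<close>

lemma cstar_norm_star: "norm (star a) = norm (a::'a::cstar_algebra)"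
  by (rule cstar_seminorm_star[OF cstar_seminorm_norm])

lemma star_scaleR: "star (r *\<^sub>R a) = r *\<^sub>R star (a::'a::cstar_algebra)"
  by (simp add: scaleR_scaleC star_scaleC)

text \<open>In a unital algebra, \<open>1 - c\<close> is then a self-adjoint square root of \<open>1 - k\<close>.\<close>

lemma cstar_sqrt:
  fixes k :: "'a::cstar_algebra"
  assumes k: "star k = k" "norm k < 1"
  obtains c where "star c = c" "c + c = k + c * c"
proof -
  \<comment> \<open>The equation sought is the fixed point equation of F. On the ball of radius
    \<open>norm k\<close> the map F is a contraction with factor \<open>norm k\<close>, which is
    less than 1.\<close>
  define F where "F c = (1/2) *\<^sub>R (k + c * c)" for c
  have "\<exists>!c\<in>cball 0 (norm k). F c = c"
  proof (rule Banach_fix)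
    show "complete (cball (0::'a) (norm k))" by (rule complete_closed_subset[OF closed_cball subset_UNIV complete_UNIV])
    show "cball (0::'a) (norm k) \<noteq> {}" by simp
    show "0 \<le> norm k" "norm k < 1" using k by auto
    show "F ` cball 0 (norm k) \<subseteq> cball 0 (norm k)"
    proof (rule image_subsetI)
      fix c :: 'a
      assume "c \<in> cball 0 (norm k)"
      then have c: "norm c \<le> norm k" by simp
      have "norm (c * c) \<le> norm c * norm c" by (rule norm_mult_ineq)
      also have "\<dots> \<le> norm k * 1" using c k by (intro mult_mono) auto
      finally have "norm (k + c * c) \<le> 2 * norm k"
        using norm_triangle_ineq[of k "c * c"] by simp
      then show "F c \<in> cball 0 (norm k)" by (simp add: F_def)
    qed
  next
    fix c d :: 'a
    assume cd: "c \<in> cball 0 (norm k)" "d \<in> cball 0 (norm k)"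
    have "F c - F d = (1/2) *\<^sub>R (c * (c - d) + (c - d) * d)"
      by (simp add: F_def algebra_simps)
    then have "norm (F c - F d) \<le> (norm c * norm (c - d) + norm (c - d) * norm d) / 2"
      using norm_triangle_ineq[of "c * (c - d)" "(c - d) * d"] norm_mult_ineq[of c "c - d"]
        norm_mult_ineq[of "c - d" d] by simp
    also have "\<dots> \<le> (norm k * norm (c - d) + norm (c - d) * norm k) / 2"
      using cd by (intro divide_right_mono add_mono mult_mono) auto
    finally show "dist (F c) (F d) \<le> norm k * dist c d" by (simp add: dist_norm algebra_simps)
  qed
  then obtain c where "c \<in> cball 0 (norm k) \<and> F c = c"
    and "\<forall>d. d \<in> cball 0 (norm k) \<and> F d = d \<longrightarrow> d = c" by (rule ex1E)
  then have c: "norm c \<le> norm k" "F c = c"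
    and uniq: "norm d \<le> norm k \<Longrightarrow> F d = d \<Longrightarrow> d = c" for d
    unfolding mem_cball_0 by blast+
  \<comment> \<open>\<open>star c\<close> is a fixed point in the same ball, so uniqueness makes c
    self-adjoint.\<close>
  have "F (star c) = star (F c)" using k by (simp add: F_def star_scaleR star_add star_mult)
  then have "star c = c" using c by (intro uniq) (simp_all add: cstar_norm_star)
  moreover have "2 *\<^sub>R F c = k + c * c" by (simp add: F_def)
  then have "c + c = k + c * c" by (simp add: c(2) scaleR_2)
  ultimately show ?thesis by (rule that)
qed

lemma star_hom_simps:
  assumes "star_hom h"
  shows "h (x + y) = h x + h y" "h (c *\<^sub>C x) = c *\<^sub>C h x" "h (x * y) = h x * h y"
    "h (star x) = star (h x)" "h 0 = 0" "h (- x) = - h x" "h (x - y) = h x - h y"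
    "h (sum f A) = (\<Sum>i\<in>A. h (f i))"
proof -
  show add: "h (x + y) = h x + h y" and scale: "h (c *\<^sub>C x) = c *\<^sub>C h x"
    and "h (x * y) = h x * h y" "h (star x) = star (h x)" for c x y
    using assms by (simp_all add: star_hom_def)
  show zero: "h 0 = 0" using scale[of 0 0] by simp
  show minus: "h (- x) = - h x" for x using scale[of "-1" x] by (simp only: scaleC_minus_one)
  show "h (x - y) = h x - h y" using add[of x "- y"] by (simp add: minus)
  show "h (sum f A) = (\<Sum>i\<in>A. h (f i))"
    by (induction A rule: infinite_finite_induct) (simp_all add: zero add)
qed

lemma op_apply_sum: "(sum T A :: 'h::complex_hilbert adj_op) \<cdot> x = (\<Sum>i\<in>A. T i \<cdot> x)"
  by (induction A rule: infinite_finite_induct) auto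

text \<open>If \<open>\<parallel>a\<parallel> < 1\<close> then \<open>1 - a\<^sup>*a = b\<^sup>2\<close> with \<open>b\<close> self-adjoint, whence
  \<open>\<parallel>\<xi>\<parallel>\<^sup>2 - \<parallel>h(a)\<xi>\<parallel>\<^sup>2 = \<parallel>h(b)\<xi>\<parallel>\<^sup>2 \<ge> 0\<close>.\<close>

lemma star_hom_contractive:
  fixes h :: "'a::cstar_algebra \<Rightarrow> 'h::complex_hilbert adj_op"
  assumes hom: "star_hom h" and unit: "\<And>a. u * a = a" "\<And>a. a * u = a" "star u = u"
    and hu: "\<And>x. h u \<cdot> x = x"
  shows "norm (h a) \<le> norm a"
proof -
  note h = star_hom_simps[OF hom]
  have le1: "norm (h a) \<le> 1" if a: "norm a < 1" for a
  proof (rule norm_op_le)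
    fix x
    have "star (star a * a) = star a * a" by (simp add: star_mult star_star)
    moreover have "norm (star a * a) < 1"
      using a by (simp add: norm_star_mult abs_square_less_1)
    ultimately obtain c where c: "star c = c" "c + c = star a * a + c * c"
      by (rule cstar_sqrt)
    define b where "b = u - c"
    have "b * b = u - (c + c) + c * c" by (simp add: b_def algebra_simps unit)
    then have bb: "b * b = u - star a * a" by (simp add: c(2))
    have "star (h b) = h b" by (simp add: b_def star_diff unit(3) c(1) flip: h(4))
    then have "(norm (h b \<cdot> x))\<^sup>2 = inner x ((h b * h b) \<cdot> x)"
      using inner_star_right[of x "h b" "h b \<cdot> x"] by (simp add: power2_norm_eq_inner)
    also have "h b * h b = h u - star (h a) * h a" using bb h(3)[of b b] h(3)[of "star a" a] by (simp add: h(4,7))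
    also have "inner x ((h u - star (h a) * h a) \<cdot> x) = (norm x)\<^sup>2 - (norm (h a \<cdot> x))\<^sup>2"
      by (simp add: hu inner_diff_right inner_star_right power2_norm_eq_inner)
    finally have "(norm (h a \<cdot> x))\<^sup>2 \<le> (norm x)\<^sup>2"
      using zero_le_power2[of "norm (h b \<cdot> x)"] by linarith
    then show "norm (h a \<cdot> x) \<le> 1 * norm x" by simp
  qed simp
  show ?thesis
  proof (rule dense_ge)
    fix r
    assume r: "norm a < r"
    then have "r > 0" using norm_ge_zero[of a] by linarith
    have hr: "h (s *\<^sub>R a) = s *\<^sub>R h a" for s by (simp add: scaleR_scaleC h)
    have "norm (h ((1/r) *\<^sub>R a)) \<le> 1" using r \<open>r > 0\<close> by (intro le1) simp
    then show "norm (h a) \<le> r" using \<open>r > 0\<close> by (simp add: hr field_simps)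
  qed
qed

section \<open>Representations with separating vectors are isometric\<close>

abbreviation paths :: "nat \<times> nat \<Rightarrow> 'm::two_graph_monoid set" where
  "paths n \<equiv> {\<mu>. deg \<mu> = n}"

subsection \<open>Complex spans\<close>

inductive_set cspan :: "'a::star_algebra set \<Rightarrow> 'a set" for S where
  cspan_zero: "0 \<in> cspan S"
| cspan_step: "x \<in> S \<Longrightarrow> y \<in> cspan S \<Longrightarrow> c *\<^sub>C x + y \<in> cspan S"

lemma cspan_superset: "x \<in> S \<Longrightarrow> x \<in> cspan S"
  using cspan_step[OF _ cspan_zero, of x S 1] by (simp add: scaleC_one)

lemma cspan_add: "x \<in> cspan S \<Longrightarrow> y \<in> cspan S \<Longrightarrow> x + y \<in> cspan S"
  by (induction rule: cspan.induct) (auto simp: add.assoc intro: cspan_step)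

lemma scaleC_zero_right: "c *\<^sub>C (0::'a::star_algebra) = 0"
  using scaleC_scaleC[of c 0 "0::'a"] by simp

lemma cspan_scaleC: "x \<in> cspan S \<Longrightarrow> c *\<^sub>C x \<in> cspan S"
  by (induction rule: cspan.induct)
    (auto simp: scaleC_zero_right scaleC_add_right scaleC_scaleC intro: cspan_zero cspan_step)

lemma cspan_sum: "(\<And>i. i \<in> I \<Longrightarrow> f i \<in> cspan S) \<Longrightarrow> sum f I \<in> cspan S"
  by (induction I rule: infinite_finite_induct) (auto intro: cspan_zero cspan_add)

lemma cspan_subset: "x \<in> cspan S \<Longrightarrow> (\<And>s. s \<in> S \<Longrightarrow> s \<in> cspan T) \<Longrightarrow> x \<in> cspan T"
  by (induction rule: cspan.induct) (auto intro: cspan_zero cspan_add cspan_scaleC)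

lemma cspan_mult:
  assumes "x \<in> cspan S" "y \<in> cspan T" and ST: "\<And>s t. s \<in> S \<Longrightarrow> t \<in> T \<Longrightarrow> s * t \<in> cspan U"
  shows "x * y \<in> cspan U"
  using assms(1)
proof (induction rule: cspan.induct)
  case (cspan_step s z c)
  from assms(2) have "s * y \<in> cspan U"
    by (induction rule: cspan.induct)
      (auto simp: distrib_left mult_scaleC_right intro: cspan_zero cspan_add cspan_scaleC ST cspan_step.hyps)
  with cspan_step show ?case
    by (auto simp: distrib_right mult_scaleC_left intro: cspan_add cspan_scaleC)
qed (auto intro: cspan_zero)

lemma cspan_star:
  assumes "x \<in> cspan S" and "\<And>s. s \<in> S \<Longrightarrow> star s \<in> cspan T"
  shows "star x \<in> cspan T"
  using assms
  by (induction rule: cspan.induct)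
    (auto simp: star_add star_scaleC intro: cspan_zero cspan_add cspan_scaleC)

lemma cspan_image_coeffs:
  assumes "x \<in> cspan (g ` I)" "finite I"
  obtains c where "x = (\<Sum>i\<in>I. c i *\<^sub>C g i)"
proof -
  have "\<exists>c. x = (\<Sum>i\<in>I. c i *\<^sub>C g i)"
    using assms(1)
  proof (induction rule: cspan.induct)
    case cspan_zero
    show ?case by (rule exI[of _ "\<lambda>_. 0"]) simp
  next
    case (cspan_step y z k)
    then obtain c j where c: "z = (\<Sum>i\<in>I. c i *\<^sub>C g i)" and j: "j \<in> I" "y = g j" by auto
    have "(\<Sum>i\<in>I. (if i = j then k else 0) *\<^sub>C g i) = (\<Sum>i\<in>I. if i = j then k *\<^sub>C g j else 0)"
      by (rule sum.cong) auto
    also have "\<dots> = k *\<^sub>C g j" using j assms(2) by simp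
    finally have "k *\<^sub>C y + z = (\<Sum>i\<in>I. ((if i = j then k else 0) + c i) *\<^sub>C g i)"
      by (simp add: c j(2) scaleC_add_left sum.distrib)
    then show ?case by (rule exI[of _ "\<lambda>i. (if i = j then k else 0) + c i"])
  qed
  then show ?thesis using that by blast
qed


subsection \<open>Consequences of the Cuntz-Krieger relations\<close>

lemma factorization_unique:
  fixes \<mu> :: "'m::two_graph_monoid"
  assumes "\<mu> * \<nu> = \<mu>' * \<nu>'" "deg \<mu> = deg \<mu>'" "deg \<nu> = deg \<nu>'"
  shows "\<mu> = \<mu>' \<and> \<nu> = \<nu>'"
proof -
  have "\<exists>!p. deg (fst p) = deg \<mu> \<and> deg (snd p) = deg \<nu> \<and> \<mu> * \<nu> = fst p * snd p"
    using factorization[of "\<mu> * \<nu>" "deg \<mu>" "deg \<nu>"] by (simp only: deg_mult case_prod_unfold)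
  then have "(\<mu>, \<nu>) = (\<mu>', \<nu>')"
    by (rule ex1E) (metis assms fst_conv snd_conv)
  then show ?thesis by simp
qed

lemma factorization_exists:
  fixes \<mu> :: "'m::two_graph_monoid"
  assumes "deg \<mu> = m + n"
  obtains \<nu> \<alpha> where "deg \<nu> = m" "deg \<alpha> = n" "\<mu> = \<nu> * \<alpha>"
  using factorization[OF assms] by (auto elim!: ex1E)

lemma bij_betw_factorization:
  "bij_betw (\<lambda>(\<mu>, \<nu>). \<mu> * \<nu>) ({\<mu>::'m::two_graph_monoid. deg \<mu> = m} \<times> paths n)
    (paths (m + n))"
  unfolding bij_betw_def
proof
  show "inj_on (\<lambda>(\<mu>, \<nu>). \<mu> * \<nu>) ({\<mu>::'m. deg \<mu> = m} \<times> paths n)"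
    by (clarsimp simp: inj_on_def) (metis factorization_unique)
  show "(\<lambda>(\<mu>, \<nu>). \<mu> * \<nu>) ` ({\<mu>::'m. deg \<mu> = m} \<times> paths n) = paths (m + n)"
    by (auto simp: deg_mult elim!: factorization_exists)
qed

lemma sum_factorization:
  "(\<Sum>\<kappa> | deg \<kappa> = m + n. g \<kappa>)
    = (\<Sum>\<mu> | deg \<mu> = m. \<Sum>\<nu> | deg \<nu> = n. g (\<mu> * \<nu> :: 'm::finite_two_graph_monoid))"
  unfolding sum.reindex_bij_betw[OF bij_betw_factorization, symmetric]
  by (simp add: sum.cartesian_product case_prod_unfold)

lemma ck_gen_mult: "ck_gen (\<mu> * \<nu>) = ck_gen \<mu> * ck_gen \<nu>"
  and star_ck_gen_mult: "star (ck_gen \<mu>) * ck_gen \<mu> = ck_gen 1"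
  and star_ck_gen_one: "star (ck_gen 1) = (ck_gen 1 :: 'm::finite_two_graph_monoid ck_algebra)"
  and ck_gen_sum: "(\<Sum>\<mu> | deg \<mu> = n. ck_gen \<mu> * star (ck_gen \<mu>)) = (ck_gen 1 :: 'm ck_algebra)"
  using ck_family_ck_gen unfolding ck_family_def by metis+

text \<open>Density of the *-algebra generated by the \<open>ck_gen \<mu>\<close>, in the form of an
  induction; zero and negatives are reached by scaling with 0 and -1.\<close>

lemma ck_embed_induct [case_names gen add scaleC mult star closed]:
  fixes P :: "'m::finite_two_graph_monoid ck_algebra \<Rightarrow> bool"
  assumes "\<And>\<mu>. P (ck_gen \<mu>)" "\<And>x y. P x \<Longrightarrow> P y \<Longrightarrow> P (x + y)" "\<And>c x. P x \<Longrightarrow> P (c *\<^sub>C x)"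
    "\<And>x y. P x \<Longrightarrow> P y \<Longrightarrow> P (x * y)" "\<And>x. P x \<Longrightarrow> P (star x)"
    and closed: "\<And>X a. (\<And>n::nat. P (X n)) \<Longrightarrow> X \<longlonglongrightarrow> a \<Longrightarrow> P a"
  shows "P a"
proof -
  have "P (ck_embed x)" for x
  proof (induction x rule: free_star_induct)
    case zero
    then show ?case using assms(3)[OF assms(1), of 0] by (simp add: ck_embed_simps)
  next
    case (uminus x)
    then show ?case using assms(3)[of "ck_embed x" "-1"]
      by (metis ck_embed_simps(5) scaleC_minus_one)
  qed (use assms in \<open>simp_all add: ck_embed_simps ck_gen_def\<close>)
  then show ?thesis using closed ck_embed_LIMSEQ by (metis ck_lim_cases)
qed

lemma ck_gen_one_mult: "ck_gen 1 * a = a" and mult_ck_gen_one: "a * ck_gen 1 = a"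
  for a :: "'m::finite_two_graph_monoid ck_algebra"
proof -
  have "ck_gen 1 * a = a \<and> a * ck_gen 1 = a"
  proof (induction a rule: ck_embed_induct)
    case (gen \<mu>)
    then show ?case by (metis ck_gen_mult mult_1 mult_1_right)
  next
    case (mult x y)
    then show ?case by (metis mult.assoc)
  next
    case (star x)
    then show ?case by (metis star_mult star_ck_gen_one)
  next
    case (closed X a)
    have "(\<lambda>n. ck_gen 1 * X n) \<longlonglongrightarrow> ck_gen 1 * a" "(\<lambda>n. X n * ck_gen 1) \<longlonglongrightarrow> a * ck_gen 1"
      by (intro tendsto_mult closed tendsto_const)+
    with closed show ?case by (auto intro: LIMSEQ_unique)
  qed (auto simp: distrib_left distrib_right mult_scaleC_left mult_scaleC_right)
  then show "ck_gen 1 * a = a" "a * ck_gen 1 = a" by auto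
qed

lemma norm_ck_gen: "norm (ck_gen \<mu>) \<le> 1"
proof -
  have *: "(norm (ck_gen \<nu>))\<^sup>2 = norm (ck_gen 1 :: 'a ck_algebra)" for \<nu> :: 'a
    using norm_star_mult[of "ck_gen \<nu>"] by (simp add: star_ck_gen_mult)
  have "norm (ck_gen 1 :: 'a ck_algebra) \<le> 1"
    using *[of 1] by (auto simp: power2_eq_square)
  then have "(norm (ck_gen \<mu>))\<^sup>2 \<le> 1\<^sup>2" using *[of \<mu>] by simp
  then show ?thesis by (rule power2_le_imp_le) simp
qed

section \<open>Matrix units and their spans\<close>

definition degree_box :: "nat \<Rightarrow> 'm::two_graph_monoid set" where
  "degree_box L = {\<mu>. fst (deg \<mu>) \<le> L \<and> snd (deg \<mu>) \<le> L}"

text \<open>If \<nu> and \<sigma> have the same degree, then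
  \<open>matrix_unit \<mu> \<nu> * matrix_unit \<sigma> \<tau>\<close> is
  \<open>matrix_unit \<mu> \<tau>\<close> or 0, as for matrices, once ranges are known to be
  orthogonal. For different degrees the product is a combination of several such elements.\<close>

definition matrix_unit :: "'m \<Rightarrow> 'm \<Rightarrow> 'm::finite_two_graph_monoid ck_algebra" where
  "matrix_unit \<mu> \<nu> = ck_gen \<mu> * star (ck_gen \<nu>)"

definition unit_span :: "'m set \<Rightarrow> 'm set \<Rightarrow> 'm::finite_two_graph_monoid ck_algebra set" where
  "unit_span A B = cspan {matrix_unit \<mu> \<nu> | \<mu> \<nu>. \<mu> \<in> A \<and> \<nu> \<in> B}"

lemma star_matrix_unit: "star (matrix_unit \<mu> \<nu>) = matrix_unit \<nu> \<mu>"
  by (simp add: matrix_unit_def star_mult star_star)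

lemma matrix_unit_in_span: "\<mu> \<in> A \<Longrightarrow> \<nu> \<in> B \<Longrightarrow> matrix_unit \<mu> \<nu> \<in> unit_span A B"
  unfolding unit_span_def by (rule cspan_superset) blast

lemma unit_span_subset:
  assumes "x \<in> unit_span A B"
    and "\<And>\<mu> \<nu>. \<mu> \<in> A \<Longrightarrow> \<nu> \<in> B \<Longrightarrow> matrix_unit \<mu> \<nu> \<in> unit_span A' B'"
  shows "x \<in> unit_span A' B'"
  using assms(1) unfolding unit_span_def[of A B] unfolding unit_span_def[of A' B']
  by (rule cspan_subset) (use assms(2) in \<open>auto simp: unit_span_def[of A' B']\<close>)

lemma unit_span_star: "x \<in> unit_span A B \<Longrightarrow> star x \<in> unit_span B A"
  unfolding unit_span_def[of A B] unfolding unit_span_def[of B A]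
  by (erule cspan_star)
    (auto simp: star_matrix_unit unit_span_def[of B A, symmetric] intro: matrix_unit_in_span)

lemma unit_span_mono: "x \<in> unit_span A B \<Longrightarrow> A \<subseteq> A' \<Longrightarrow> B \<subseteq> B' \<Longrightarrow> x \<in> unit_span A' B'"
  by (erule unit_span_subset) (auto intro: matrix_unit_in_span)

lemma unit_span_sum: "(\<And>i. i \<in> I \<Longrightarrow> f i \<in> unit_span A B) \<Longrightarrow> sum f I \<in> unit_span A B"
  and unit_span_scaleC: "x \<in> unit_span A B \<Longrightarrow> c *\<^sub>C x \<in> unit_span A B"
  and unit_span_zero: "0 \<in> unit_span A B"
  and unit_span_add: "x \<in> unit_span A B \<Longrightarrow> y \<in> unit_span A B \<Longrightarrow> x + y \<in> unit_span A B"
  unfolding unit_span_def by (auto intro: cspan_sum cspan_scaleC cspan_zero cspan_add)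

lemma unit_span_mult:
  assumes "x \<in> unit_span A B" "y \<in> unit_span A' B'"
    and "\<And>\<mu> \<nu> \<mu>' \<nu>'. \<mu> \<in> A \<Longrightarrow> \<nu> \<in> B \<Longrightarrow> \<mu>' \<in> A' \<Longrightarrow> \<nu>' \<in> B' \<Longrightarrow>
      matrix_unit \<mu> \<nu> * matrix_unit \<mu>' \<nu>' \<in> unit_span C D"
  shows "x * y \<in> unit_span C D"
  using assms(1,2) unfolding unit_span_def[of A B] unfolding unit_span_def[of A' B'] unit_span_def[of C D]
  by (rule cspan_mult) (use assms(3) in \<open>auto simp: unit_span_def[of C D]\<close>)

lemma unit_span_coeffs:
  assumes "x \<in> unit_span A B" "finite A" "finite B"
  obtains c where "x = (\<Sum>\<mu>\<in>A. \<Sum>\<nu>\<in>B. c \<mu> \<nu> *\<^sub>C matrix_unit \<mu> \<nu>)"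
proof -
  have *: "{matrix_unit \<mu> \<nu> | \<mu> \<nu>. \<mu> \<in> A \<and> \<nu> \<in> B} = (\<lambda>(\<mu>, \<nu>). matrix_unit \<mu> \<nu>) ` (A \<times> B)"
    by auto
  obtain k where "x = (\<Sum>i\<in>A \<times> B. k i *\<^sub>C (\<lambda>(\<mu>, \<nu>). matrix_unit \<mu> \<nu>) i)"
    using assms unfolding unit_span_def * by (elim cspan_image_coeffs) auto
  then show ?thesis
    by (intro that[of "\<lambda>\<mu> \<nu>. k (\<mu>, \<nu>)"]) (simp add: sum.cartesian_product case_prod_unfold)
qed

lemma finite_degree_box: "finite (degree_box L :: 'm::finite_two_graph_monoid set)"
proof (rule finite_subset)
  show "degree_box L \<subseteq> (\<Union>n\<in>{..L} \<times> {..L}. {\<mu>::'m. deg \<mu> = n})"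
    by (force simp: degree_box_def mem_Times_iff)
  show "finite (\<Union>n\<in>{..L} \<times> {..L}. {\<mu>::'m. deg \<mu> = n})"
    by (intro finite_UN_I finite_deg) simp
qed

text \<open>Insert the relation 1 = sum of \<open>ck_gen \<kappa> * star (ck_gen \<kappa>)\<close>
  between the two factors. This raises the degrees of both labels by the same amount n.\<close>

lemma matrix_unit_expand:
  "matrix_unit \<mu> \<nu> = (\<Sum>\<kappa> | deg \<kappa> = n. matrix_unit (\<mu> * \<kappa>) (\<nu> * \<kappa>))"
proof -
  have "matrix_unit \<mu> \<nu> = ck_gen \<mu> * ck_gen 1 * star (ck_gen \<nu>)"
    by (simp add: matrix_unit_def mult_ck_gen_one)
  also have "\<dots> = (\<Sum>\<kappa> | deg \<kappa> = n. ck_gen \<mu> * (ck_gen \<kappa> * star (ck_gen \<kappa>)) * star (ck_gen \<nu>))"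
    by (simp add: sum_distrib_left sum_distrib_right flip: ck_gen_sum[of n])
  finally show ?thesis by (simp add: matrix_unit_def ck_gen_mult star_mult mult.assoc)
qed

lemma unit_span_expand:
  assumes "x \<in> unit_span (degree_box L) (degree_box L)"
  shows "x \<in> unit_span (degree_box (2 * L)) (paths (L, L))"
  using assms
proof (rule unit_span_subset)
  fix \<mu> \<nu> :: 'a
  assume \<mu>: "\<mu> \<in> degree_box L" and \<nu>: "\<nu> \<in> degree_box L"
  \<comment> \<open>What d(\<nu>) lacks to (L, L). The left label gains the same n, hence its bound
    2L.\<close>
  define n where "n = (L - fst (deg \<nu>), L - snd (deg \<nu>))"
  show "matrix_unit \<mu> \<nu> \<in> unit_span (degree_box (2 * L)) (paths (L, L))"
    unfolding matrix_unit_expand[of \<mu> \<nu> n]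
  proof (intro unit_span_sum matrix_unit_in_span)
    fix \<kappa> :: 'a
    assume "\<kappa> \<in> paths n"
    then show "\<nu> * \<kappa> \<in> paths (L, L)" "\<mu> * \<kappa> \<in> degree_box (2 * L)"
      using \<mu> \<nu> by (auto simp: degree_box_def n_def deg_mult prod_eq_iff)
  qed
qed

text \<open>For self-adjoint elements the C*-identity says that squaring squares the norm exactly,
  and squares are again self-adjoint.\<close>

lemma norm_iterated_square:
  fixes x :: "'a::cstar_algebra"
  assumes "star x = x"
  shows "norm (((\<lambda>x. x * x) ^^ j) x) = norm x ^ (2 ^ j)"
proof (induction j)
  case (Suc j)
  have "star (((\<lambda>x. x * x) ^^ j) x) = ((\<lambda>x. x * x) ^^ j) x"
    by (induction j) (simp_all add: assms star_mult)
  then have "norm (((\<lambda>x. x * x) ^^ Suc j) x) = (norm (((\<lambda>x. x * x) ^^ j) x))\<^sup>2"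
    using norm_star_mult[of "((\<lambda>x. x * x) ^^ j) x"] by simp
  then show ?case by (simp add: Suc power_mult[symmetric] mult.commute)
qed simp

text \<open>Squaring repeatedly turns bounds with subexponential constants into sharp ones.\<close>

lemma le_of_power_bound:
  fixes a b C D :: real
  assumes "0 \<le> a" "0 \<le> b" and le: "\<And>j. a ^ (2 ^ j) \<le> C * D ^ j * b ^ (2 ^ j)"
  shows "a \<le> b"
proof (rule ccontr)
  assume ab: "\<not> a \<le> b"
  have "b \<noteq> 0" using le[of 0] ab by auto
  with assms have b: "b > 0" by simp
  define r where "r = a / b"
  have r: "r > 1" using ab b by (simp add: r_def)
  have rle: "r ^ (2 ^ j) \<le> C * D ^ j" for j
    using le[of j] b by (simp add: r_def power_divide divide_le_eq)
  \<comment> \<open>The enlarged constants are at least 1, so their logarithms make sense and are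
    nonnegative.\<close>
  have "C * D ^ j \<le> (\<bar>C\<bar> + 1) * (\<bar>D\<bar> + 1) ^ j" for j
  proof -
    have "C * D ^ j \<le> \<bar>C\<bar> * \<bar>D\<bar> ^ j" by (metis abs_ge_self abs_mult power_abs)
    also have "\<dots> \<le> (\<bar>C\<bar> + 1) * (\<bar>D\<bar> + 1) ^ j" by (intro mult_mono power_mono) auto
    finally show ?thesis .
  qed
  then have rle': "r ^ (2 ^ j) \<le> (\<bar>C\<bar> + 1) * (\<bar>D\<bar> + 1) ^ j" for j
    using rle order_trans by blast
  \<comment> \<open>The left side grows like 2^j, the right side linearly in j; dividing by 2^j
    forces ln r <= 0.\<close>
  have ln_le: "2 ^ j * ln r \<le> ln (\<bar>C\<bar> + 1) + j * ln (\<bar>D\<bar> + 1)" for j :: nat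
  proof -
    have "ln (r ^ (2 ^ j)) \<le> ln ((\<bar>C\<bar> + 1) * (\<bar>D\<bar> + 1) ^ j)"
      using r rle'[of j] by (subst ln_le_cancel_iff) (auto intro!: mult_pos_pos)
    moreover have "\<bar>C\<bar> + 1 \<noteq> 0" "\<bar>D\<bar> + 1 \<noteq> 0" by linarith+
    ultimately show ?thesis using r by (simp add: ln_realpow ln_mult)
  qed
  have "(\<lambda>j. (ln (\<bar>C\<bar> + 1) + real j * ln (\<bar>D\<bar> + 1)) / 2 ^ j) \<longlonglongrightarrow> 0"
  proof -
    have "(\<lambda>j. ln (\<bar>C\<bar> + 1) * (1/2) ^ j + ln (\<bar>D\<bar> + 1) * (real j * (1/2) ^ j)) \<longlonglongrightarrow> ln (\<bar>C\<bar> + 1) * 0 + ln (\<bar>D\<bar> + 1) * 0"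
      by (intro tendsto_intros LIMSEQ_power_zero powser_times_n_limit_0) auto
    then show ?thesis by (simp add: power_divide add_divide_distrib mult_ac)
  qed
  moreover have "ln r \<le> (ln (\<bar>C\<bar> + 1) + real j * ln (\<bar>D\<bar> + 1)) / 2 ^ j" for j
    using ln_le[of j] by (simp add: field_simps)
  ultimately have "ln r \<le> 0"
    by (intro LIMSEQ_le_const) auto
  then show False using r by simp
qed


subsection \<open>Words in the generators\<close>

lemma op_apply_sum_right: "T \<cdot> (sum f A) = (\<Sum>i\<in>A. T \<cdot> f i)"
  by (induction A rule: infinite_finite_induct) (simp_all add: op_apply_linear)

lemma mult_unit_span_star:
  fixes A B :: "'m::finite_two_graph_monoid set"
  assumes "x \<in> unit_span A B" "finite A" "finite B"
    and "\<And>\<alpha>. \<alpha> \<in> A \<Longrightarrow> \<mu> * \<alpha> \<in> A'" "\<And>\<beta>. \<beta> \<in> B \<Longrightarrow> \<nu> * \<beta> \<in> B'"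
  shows "ck_gen \<mu> * x * star (ck_gen \<nu>) \<in> unit_span A' B'"
proof -
  obtain c where x: "x = (\<Sum>\<alpha>\<in>A. \<Sum>\<beta>\<in>B. c \<alpha> \<beta> *\<^sub>C matrix_unit \<alpha> \<beta>)"
    using assms(1-3) by (rule unit_span_coeffs)
  have "ck_gen \<mu> * matrix_unit \<alpha> \<beta> * star (ck_gen \<nu>) = matrix_unit (\<mu> * \<alpha>) (\<nu> * \<beta>)" for \<alpha> \<beta>
    by (simp add: matrix_unit_def ck_gen_mult star_mult mult.assoc)
  then have "ck_gen \<mu> * x * star (ck_gen \<nu>)
      = (\<Sum>\<alpha>\<in>A. \<Sum>\<beta>\<in>B. c \<alpha> \<beta> *\<^sub>C matrix_unit (\<mu> * \<alpha>) (\<nu> * \<beta>))"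
    by (simp add: x sum_distrib_left sum_distrib_right mult_scaleC_left mult_scaleC_right)
  then show ?thesis
    using assms(4,5) by (auto intro!: unit_span_sum unit_span_scaleC matrix_unit_in_span)
qed

text \<open>The argument only carries the type of paths. Stating this as a condition keeps the norm
  estimate independent of the particular graph; \<open>orthogonal_ranges_graph\<close> verifies it
  with an algebraic argument that exploits having exactly two edges of each degree.\<close>

definition orthogonal_ranges :: "'m::finite_two_graph_monoid itself \<Rightarrow> bool" where
  "orthogonal_ranges _ \<longleftrightarrow> (\<forall>\<mu> \<nu>::'m. deg \<mu> = deg \<nu> \<longrightarrow> \<mu> \<noteq> \<nu> \<longrightarrow> star (ck_gen \<mu>) * ck_gen \<nu> = 0)"

section \<open>Level spaces and separating vectors\<close>

definition level_space ::
  "('m::finite_two_graph_monoid ck_algebra \<Rightarrow> 'h::complex_hilbert adj_op) \<Rightarrow> 'h \<Rightarrow> nat \<times> nat \<Rightarrow> 'h set"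
  where "level_space h \<zeta> p = {\<Sum>\<mu> | deg \<mu> = p. cscale (v \<mu>) (h (ck_gen \<mu>) \<cdot> \<zeta>) | v. True}"

lemma level_spaceI: "(\<Sum>\<mu> | deg \<mu> = p. cscale (v \<mu>) (h (ck_gen \<mu>) \<cdot> \<zeta>)) \<in> level_space h \<zeta> p"
  unfolding level_space_def by blast

lemma level_space_add: "x \<in> level_space h \<zeta> p \<Longrightarrow> y \<in> level_space h \<zeta> p \<Longrightarrow> x + y \<in> level_space h \<zeta> p"
  unfolding level_space_def
  by (clarsimp, rule_tac x = "\<lambda>\<mu>. v \<mu> + va \<mu>" in exI) (simp add: cscale_simps sum.distrib)

lemma level_space_cscale: "x \<in> level_space h \<zeta> p \<Longrightarrow> cscale c x \<in> level_space h \<zeta> p"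
  unfolding level_space_def
  by (clarsimp, rule_tac x = "\<lambda>\<mu>. c * v \<mu>" in exI) (simp add: cscale_simps cscale_sum)

lemma level_space_zero: "0 \<in> level_space h \<zeta> p"
  using level_spaceI[where v = "\<lambda>_. 0"] by (simp add: cscale_simps)

lemma level_space_sum: "(\<And>i. i \<in> I \<Longrightarrow> f i \<in> level_space h \<zeta> p) \<Longrightarrow> sum f I \<in> level_space h \<zeta> p"
  by (induction I rule: infinite_finite_induct) (auto intro: level_space_zero level_space_add)

lemma level_space_gen:
  assumes "deg \<mu> = p"
  shows "h (ck_gen \<mu>) \<cdot> \<zeta> \<in> level_space h \<zeta> p"
proof -
  have "h (ck_gen \<mu>) \<cdot> \<zeta>
      = (\<Sum>\<nu> | deg \<nu> = p. if \<nu> = \<mu> then h (ck_gen \<mu>) \<cdot> \<zeta> else 0)"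
    using assms by (simp add: finite_deg)
  also have "\<dots> = (\<Sum>\<nu> | deg \<nu> = p. cscale (if \<nu> = \<mu> then 1 else 0) (h (ck_gen \<nu>) \<cdot> \<zeta>))"
    by (rule sum.cong) (auto simp: cscale_simps)
  finally show ?thesis
    unfolding level_space_def by (intro CollectI exI[of _ "\<lambda>\<nu>. if \<nu> = \<mu> then 1 else 0"] conjI TrueI)
qed

text \<open>The two real equations together say that the complex inner product vanishes. Each
  \<open>ck_gen \<mu>\<close> acts isometrically (\<open>norm_h_ck_gen\<close>), so \<zeta> \<noteq>
  0 makes all the vectors nonzero.\<close>

definition separating ::
  "('m::finite_two_graph_monoid ck_algebra \<Rightarrow> 'h::complex_hilbert adj_op) \<Rightarrow> nat \<Rightarrow> 'h \<Rightarrow> bool" where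
  "separating h K \<zeta> \<longleftrightarrow> \<zeta> \<noteq> 0 \<and> (\<forall>\<mu>\<in>degree_box K. \<forall>\<nu>\<in>degree_box K. \<mu> \<noteq> \<nu> \<longrightarrow>
     inner (h (ck_gen \<mu>) \<cdot> \<zeta>) (h (ck_gen \<nu>) \<cdot> \<zeta>) = 0
     \<and> inner (h (ck_gen \<mu>) \<cdot> \<zeta>) (imul (h (ck_gen \<nu>) \<cdot> \<zeta>)) = 0)"

context
  fixes h :: "'m::finite_two_graph_monoid ck_algebra \<Rightarrow> 'h::complex_hilbert adj_op"
  assumes hom: "star_hom h" and h_one: "\<And>x. h (ck_gen 1) \<cdot> x = x"
    and ranges: "orthogonal_ranges TYPE('m)"
begin

lemma star_ck_gen_mult_ck_gen:
  "deg \<mu> = deg \<nu> \<Longrightarrow> star (ck_gen \<mu>) * ck_gen \<nu> = (if \<mu> = \<nu> then ck_gen 1 else (0 :: 'm ck_algebra))"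
  using ranges by (simp add: orthogonal_ranges_def star_ck_gen_mult)

text \<open>Expand 1 on the right over paths \<beta> of degree q. Then \<sigma>\<beta> is long
  enough to split off an initial path of degree d(\<nu>), and orthogonality of ranges keeps only the
  terms where this initial path is \<nu>.\<close>

lemma star_ck_gen_mult_in_span:
  assumes "deg (\<nu> :: 'm) + p = deg \<sigma> + q"
  shows "star (ck_gen \<nu>) * ck_gen \<sigma> \<in> unit_span (paths p) (paths q)"
proof -
  have "star (ck_gen \<nu>) * ck_gen \<sigma> = star (ck_gen \<nu>) * ck_gen \<sigma> * ck_gen 1"
    by (simp add: mult_ck_gen_one)
  also have "\<dots> = (\<Sum>\<beta> | deg \<beta> = q. star (ck_gen \<nu>) * ck_gen (\<sigma> * \<beta>) * star (ck_gen \<beta>))"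
    by (simp add: sum_distrib_left ck_gen_mult mult.assoc flip: ck_gen_sum[of q])
  also have "\<dots> \<in> unit_span (paths p) (paths q)"
  proof (rule unit_span_sum)
    fix \<beta> :: 'm
    assume \<beta>: "\<beta> \<in> paths q"
    then have "deg (\<sigma> * \<beta>) = deg \<nu> + p" using assms by (simp add: deg_mult)
    then obtain \<nu>' \<alpha> where f: "deg \<nu>' = deg \<nu>" "deg \<alpha> = p" "\<sigma> * \<beta> = \<nu>' * \<alpha>"
      by (rule factorization_exists)
    have "star (ck_gen \<nu>) * ck_gen (\<sigma> * \<beta>) * star (ck_gen \<beta>)
        = star (ck_gen \<nu>) * ck_gen \<nu>' * matrix_unit \<alpha> \<beta>"
      by (simp add: f(3) ck_gen_mult matrix_unit_def mult.assoc)
    also have "\<dots> = (if \<nu> = \<nu>' then matrix_unit \<alpha> \<beta> else 0)"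
      using f(1) by (simp add: star_ck_gen_mult_ck_gen ck_gen_one_mult)
    also have "\<dots> \<in> unit_span (paths p) (paths q)"
      using f(2) \<beta> by (auto intro: matrix_unit_in_span unit_span_zero)
    finally show "star (ck_gen \<nu>) * ck_gen (\<sigma> * \<beta>) * star (ck_gen \<beta>)
        \<in> unit_span (paths p) (paths q)" .
  qed
  finally show ?thesis .
qed

text \<open>Box sizes add under multiplication, so the power 2^j of an element lies in a box of size
  proportional to 2^j. This is what keeps the constants of the norm estimate polynomial in the
  exponent.\<close>

lemma unit_span_box_mult:
  fixes x y :: "'m ck_algebra"
  assumes "x \<in> unit_span (degree_box L) (degree_box L)" "y \<in> unit_span (degree_box M) (degree_box M)"
  shows "x * y \<in> unit_span (degree_box (L + M)) (degree_box (L + M))"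
  using assms
proof (rule unit_span_mult)
  fix \<mu> \<nu> \<sigma> \<tau> :: 'm
  assume a: "\<mu> \<in> degree_box L" "\<nu> \<in> degree_box L" "\<sigma> \<in> degree_box M" "\<tau> \<in> degree_box M"
  \<comment> \<open>Subtraction is truncated: d(\<nu>) + p and d(\<sigma>) + q both equal the
    componentwise maximum of d(\<nu>) and d(\<sigma>). Since p is at most d(\<sigma>) and q at most
    d(\<nu>), the labels stay in the box of size L + M.\<close>
  define p where "p = (fst (deg \<sigma>) - fst (deg \<nu>), snd (deg \<sigma>) - snd (deg \<nu>))"
  define q where "q = (fst (deg \<nu>) - fst (deg \<sigma>), snd (deg \<nu>) - snd (deg \<sigma>))"
  have "deg \<nu> + p = deg \<sigma> + q" by (auto simp: p_def q_def prod_eq_iff)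
  then have t: "star (ck_gen \<nu>) * ck_gen \<sigma> \<in> unit_span (paths p) (paths q)"
    by (rule star_ck_gen_mult_in_span)
  have "matrix_unit \<mu> \<nu> * matrix_unit \<sigma> \<tau> = ck_gen \<mu> * (star (ck_gen \<nu>) * ck_gen \<sigma>) * star (ck_gen \<tau>)"
    by (simp add: matrix_unit_def mult.assoc)
  also have "\<dots> \<in> unit_span (degree_box (L + M)) (degree_box (L + M))"
    by (rule mult_unit_span_star[OF t finite_deg finite_deg])
      (use a in \<open>auto simp: degree_box_def deg_mult p_def q_def\<close>)
  finally show "matrix_unit \<mu> \<nu> * matrix_unit \<sigma> \<tau> \<in> unit_span (degree_box (L + M)) (degree_box (L + M))" .
qed

lemma unit_span_level_mult:
  fixes x y :: "'m ck_algebra"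
  assumes "x \<in> unit_span (paths p) (paths n)" "y \<in> unit_span (paths n) (paths q)"
  shows "x * y \<in> unit_span (paths p) (paths q)"
  using assms
proof (rule unit_span_mult)
  fix \<mu> \<nu> \<sigma> \<tau> :: 'm
  assume a: "\<mu> \<in> paths p" "\<nu> \<in> paths n" "\<sigma> \<in> paths n" "\<tau> \<in> paths q"
  have "matrix_unit \<mu> \<nu> * matrix_unit \<sigma> \<tau> = ck_gen \<mu> * (star (ck_gen \<nu>) * ck_gen \<sigma>) * star (ck_gen \<tau>)"
    by (simp add: matrix_unit_def mult.assoc)
  also have "\<dots> = (if \<nu> = \<sigma> then matrix_unit \<mu> \<tau> else 0)"
    using a by (simp add: star_ck_gen_mult_ck_gen mult_ck_gen_one matrix_unit_def)
  also have "\<dots> \<in> unit_span (paths p) (paths q)"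
    using a by (auto intro: matrix_unit_in_span unit_span_zero)
  finally show "matrix_unit \<mu> \<nu> * matrix_unit \<sigma> \<tau> \<in> unit_span (paths p) (paths q)" .
qed

lemma ck_embed_in_box: "\<exists>L. ck_embed x \<in> unit_span (degree_box L) (degree_box L :: 'm set)"
proof -
  have mono: "y \<in> unit_span (degree_box M) (degree_box M)"
    if "y \<in> unit_span (degree_box L) (degree_box L)" "L \<le> M" for y :: "'m ck_algebra" and L M
    using that by (elim unit_span_mono) (auto simp: degree_box_def)
  show ?thesis
  proof (induction x rule: free_star_induct)
    case (gen \<mu>)
    have "matrix_unit \<mu> 1 \<in> unit_span (degree_box L) (degree_box L)" if "L = max (fst (deg \<mu>)) (snd (deg \<mu>))" for L
      using that by (intro matrix_unit_in_span) (auto simp: degree_box_def deg_one)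
    then show ?case by (auto simp: matrix_unit_def star_ck_gen_one mult_ck_gen_one simp flip: ck_gen_def)
  next
    case zero
    then show ?case by (simp add: ck_embed_simps unit_span_zero)
  next
    case (add x y)
    then obtain L M where "ck_embed x \<in> unit_span (degree_box L) (degree_box L :: 'm set)"
      "ck_embed y \<in> unit_span (degree_box M) (degree_box M :: 'm set)" by blast
    then have "ck_embed (x + y) \<in> unit_span (degree_box (L + M)) (degree_box (L + M))"
      unfolding ck_embed_simps by (intro unit_span_add; elim mono) auto
    then show ?case by blast
  next
    case (uminus x)
    then obtain L where "ck_embed x \<in> unit_span (degree_box L) (degree_box L :: 'm set)" by blast
    then have "ck_embed ((-1) *\<^sub>C x) \<in> unit_span (degree_box L) (degree_box L)"
      unfolding ck_embed_simps by (rule unit_span_scaleC)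
    then show ?case by (auto simp: scaleC_minus_one)
  next
    case (mult x y)
    then show ?case unfolding ck_embed_simps by (blast intro: unit_span_box_mult)
  next
    case (scaleC c x)
    then show ?case unfolding ck_embed_simps by (blast intro: unit_span_scaleC)
  next
    case (star x)
    then show ?case unfolding ck_embed_simps by (blast intro: unit_span_star)
  qed
qed


subsection \<open>The norm estimate\<close>

lemmas h_simps = star_hom_simps[OF hom]

lemma norm_h_le: "norm (h a) \<le> norm a"
  by (rule star_hom_contractive[OF hom ck_gen_one_mult mult_ck_gen_one star_ck_gen_one h_one])

lemma norm_h_ck_gen: "norm (h (ck_gen \<mu>) \<cdot> x) = norm x"
proof -
  have "(norm (h (ck_gen \<mu>) \<cdot> x))\<^sup>2 = inner x (h (star (ck_gen \<mu>) * ck_gen \<mu>) \<cdot> x)"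
    by (simp add: power2_norm_eq_inner h_simps(3,4) inner_star_right)
  then have "(norm (h (ck_gen \<mu>) \<cdot> x))\<^sup>2 = (norm x)\<^sup>2"
    by (simp add: star_ck_gen_mult h_one power2_norm_eq_inner)
  then show ?thesis by simp
qed

lemma h_matrix_unit_apply:
  assumes "deg \<sigma> = deg \<nu>"
  shows "h (matrix_unit \<mu> \<nu>) \<cdot> h (ck_gen \<sigma>) \<cdot> \<zeta> = (if \<sigma> = \<nu> then h (ck_gen \<mu>) \<cdot> \<zeta> else 0)"
proof -
  have "h (matrix_unit \<mu> \<nu>) \<cdot> h (ck_gen \<sigma>) \<cdot> \<zeta> = h (ck_gen \<mu> * (star (ck_gen \<nu>) * ck_gen \<sigma>)) \<cdot> \<zeta>"
    by (simp add: matrix_unit_def h_simps(3))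
  then show ?thesis
    using assms by (auto simp: star_ck_gen_mult_ck_gen mult_ck_gen_one h_simps(5))
qed

lemma level_space_apply:
  assumes x: "x \<in> unit_span (paths p) (paths n)" and \<xi>: "\<xi> \<in> level_space h \<zeta> n"
  shows "h x \<cdot> \<xi> \<in> level_space h \<zeta> p"
proof -
  obtain c where c: "x = (\<Sum>\<mu>\<in>paths p. \<Sum>\<nu>\<in>paths n. c \<mu> \<nu> *\<^sub>C matrix_unit \<mu> \<nu>)"
    using x finite_deg finite_deg by (rule unit_span_coeffs)
  obtain v where v: "\<xi> = (\<Sum>\<sigma> | deg \<sigma> = n. cscale (v \<sigma>) (h (ck_gen \<sigma>) \<cdot> \<zeta>))"
    using \<xi> unfolding level_space_def by blast
  have "h (matrix_unit \<mu> \<nu>) \<cdot> \<xi> \<in> level_space h \<zeta> p" if "deg \<mu> = p" "deg \<nu> = n" for \<mu> \<nu>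
  proof -
    have "h (matrix_unit \<mu> \<nu>) \<cdot> \<xi>
        = (\<Sum>\<sigma> | deg \<sigma> = n. cscale (v \<sigma>) (h (matrix_unit \<mu> \<nu>) \<cdot> h (ck_gen \<sigma>) \<cdot> \<zeta>))"
      by (simp add: v op_apply_sum_right op_apply_linear)
    also have "\<dots> \<in> level_space h \<zeta> p"
      using that by (intro level_space_sum level_space_cscale)
        (auto simp: h_matrix_unit_apply intro: level_space_gen level_space_zero)
    finally show ?thesis .
  qed
  then show ?thesis
    unfolding c by (auto simp: h_simps op_apply_sum intro!: level_space_sum level_space_cscale)
qed


context
  fixes K :: nat and \<zeta> :: 'h
  assumes sep: "separating h K \<zeta>"
begin

lemma separating_orthogonal:
  assumes "\<mu> \<in> degree_box K" "\<nu> \<in> degree_box K" "\<mu> \<noteq> \<nu>"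
  shows "inner (cscale a (h (ck_gen \<mu>) \<cdot> \<zeta>)) (cscale b (h (ck_gen \<nu>) \<cdot> \<zeta>)) = 0"
proof -
  have "inner (h (ck_gen \<mu>) \<cdot> \<zeta>) (h (ck_gen \<nu>) \<cdot> \<zeta>) = 0"
    "inner (h (ck_gen \<mu>) \<cdot> \<zeta>) (imul (h (ck_gen \<nu>) \<cdot> \<zeta>)) = 0"
    using assms sep by (auto simp: separating_def)
  then show ?thesis
    by (simp add: cscale_def inner_add_left inner_add_right inner_imul_left inner_imul_imul)
qed

lemma level_space_orthogonal:
  assumes "\<xi> \<in> level_space h \<zeta> p" "\<xi>' \<in> level_space h \<zeta> q" "p \<noteq> q"
    and "p \<in> {..K} \<times> {..K}" "q \<in> {..K} \<times> {..K}"
  shows "inner \<xi> \<xi>' = 0"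
proof -
  obtain v w where "\<xi> = (\<Sum>\<mu> | deg \<mu> = p. cscale (v \<mu>) (h (ck_gen \<mu>) \<cdot> \<zeta>))"
    "\<xi>' = (\<Sum>\<mu> | deg \<mu> = q. cscale (w \<mu>) (h (ck_gen \<mu>) \<cdot> \<zeta>))"
    using assms(1,2) unfolding level_space_def by blast
  then show ?thesis
    using assms(3-5)
    by (auto simp: inner_sum_left inner_sum_right degree_box_def intro!: sum.neutral separating_orthogonal)
qed

lemma norm_level_space:
  assumes "n \<in> {..K} \<times> {..K}"
  shows "(norm (\<Sum>\<mu> | deg \<mu> = n. cscale (v \<mu>) (h (ck_gen \<mu>) \<cdot> \<zeta>)))\<^sup>2
    = (\<Sum>\<mu> | deg \<mu> = n. (cmod (v \<mu>) * norm \<zeta>)\<^sup>2)"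
proof -
  have "pairwise (\<lambda>\<mu> \<nu>. orthogonal (cscale (v \<mu>) (h (ck_gen \<mu>) \<cdot> \<zeta>)) (cscale (v \<nu>) (h (ck_gen \<nu>) \<cdot> \<zeta>))) (paths n)"
    using assms by (auto simp: pairwise_def orthogonal_def degree_box_def intro!: separating_orthogonal)
  from norm_sum_Pythagorean[OF finite_deg this] show ?thesis
    by (simp add: norm_cscale norm_h_ck_gen)
qed

text \<open>A crude bound: every coefficient of x is at most B, and the triangle inequality then
  counts matrix units. The factor is exponential in n but the same for all x in the span, and
  \<open>norm_level_le\<close> removes it by taking powers.\<close>

lemma norm_le_card_level:
  assumes x: "x \<in> unit_span (paths n) (paths n)" and n: "n \<in> {..K} \<times> {..K}"
    and B: "\<And>\<xi>. \<xi> \<in> level_space h \<zeta> n \<Longrightarrow> norm (h x \<cdot> \<xi>) \<le> B * norm \<xi>"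
  shows "norm x \<le> (real (card {\<mu>::'m. deg \<mu> = n}))\<^sup>2 * B"
proof -
  define A where "A = {\<mu>::'m. deg \<mu> = n}"
  have fin: "finite A" unfolding A_def by (rule finite_deg)
  obtain c where c: "x = (\<Sum>\<mu>\<in>A. \<Sum>\<nu>\<in>A. c \<mu> \<nu> *\<^sub>C matrix_unit \<mu> \<nu>)"
    using x fin fin unfolding A_def[symmetric] by (rule unit_span_coeffs)
  have "norm \<zeta> > 0" using sep by (simp add: separating_def)
  have le: "cmod (c \<mu> \<nu>) \<le> B" if \<mu>: "\<mu> \<in> A" and \<nu>: "\<nu> \<in> A" for \<mu> \<nu>
  proof -
    \<comment> \<open>The vector belonging to \<nu> picks out column \<nu> of the coefficient
      matrix; by orthogonality each entry is bounded by the norm of the column.\<close>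
    have "h x \<cdot> h (ck_gen \<nu>) \<cdot> \<zeta>
        = (\<Sum>\<mu>\<in>A. \<Sum>\<nu>'\<in>A. cscale (c \<mu> \<nu>') (if \<nu> = \<nu>' then h (ck_gen \<mu>) \<cdot> \<zeta> else 0))"
      using \<nu> by (simp add: c h_simps op_apply_sum h_matrix_unit_apply A_def)
    also have "\<dots> = (\<Sum>\<mu>\<in>A. \<Sum>\<nu>'\<in>A. if \<nu> = \<nu>' then cscale (c \<mu> \<nu>') (h (ck_gen \<mu>) \<cdot> \<zeta>) else 0)"
      by (intro sum.cong) (auto simp: cscale_simps)
    also have "\<dots> = (\<Sum>\<mu>\<in>A. cscale (c \<mu> \<nu>) (h (ck_gen \<mu>) \<cdot> \<zeta>))"
      using \<nu> fin by simp
    finally have "(norm (h x \<cdot> h (ck_gen \<nu>) \<cdot> \<zeta>))\<^sup>2 = (\<Sum>\<mu>\<in>A. (cmod (c \<mu> \<nu>) * norm \<zeta>)\<^sup>2)"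
      using norm_level_space[OF n, of "\<lambda>\<mu>. c \<mu> \<nu>"] by (simp add: A_def)
    moreover have "(cmod (c \<mu> \<nu>) * norm \<zeta>)\<^sup>2 \<le> (\<Sum>\<mu>\<in>A. (cmod (c \<mu> \<nu>) * norm \<zeta>)\<^sup>2)"
      using \<mu> fin by (intro member_le_sum) auto
    ultimately have "cmod (c \<mu> \<nu>) * norm \<zeta> \<le> norm (h x \<cdot> h (ck_gen \<nu>) \<cdot> \<zeta>)"
      by (intro power2_le_imp_le[of "cmod (c \<mu> \<nu>) * norm \<zeta>"]) auto
    also have "\<dots> \<le> B * norm \<zeta>"
      using B[OF level_space_gen] \<nu> by (simp add: A_def norm_h_ck_gen)
    finally show ?thesis using \<open>norm \<zeta> > 0\<close> by simp
  qed
  have "norm (matrix_unit \<mu> \<nu>) \<le> 1" for \<mu> \<nu> :: 'm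
  proof -
    have "norm (matrix_unit \<mu> \<nu>) \<le> norm (ck_gen \<mu>) * norm (star (ck_gen \<nu>))"
      unfolding matrix_unit_def by (rule norm_mult_ineq)
    also have "\<dots> \<le> 1 * 1"
      by (intro mult_mono) (auto simp: cstar_norm_star norm_ck_gen)
    finally show ?thesis by simp
  qed
  then have "norm (c \<mu> \<nu> *\<^sub>C matrix_unit \<mu> \<nu>) \<le> B" if "\<mu> \<in> A" "\<nu> \<in> A" for \<mu> \<nu>
    using le[OF that] mult_left_le[of "norm (matrix_unit \<mu> \<nu>)" "cmod (c \<mu> \<nu>)"]
    by (simp add: norm_scaleC)
  note unit_le = this
  have "norm (\<Sum>\<nu>\<in>A. c \<mu> \<nu> *\<^sub>C matrix_unit \<mu> \<nu>) \<le> (\<Sum>\<nu>\<in>A. B)" if "\<mu> \<in> A" for \<mu>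
    using unit_le[OF that] by (rule sum_norm_le)
  then have "norm x \<le> (\<Sum>\<mu>\<in>A. \<Sum>\<nu>\<in>A. B)"
    unfolding c by (rule sum_norm_le)
  then show ?thesis by (simp add: A_def power2_eq_square)
qed

text \<open>\<open>star z * z\<close> lies in the span with both labels of degree n, which is closed
  under multiplication. Its iterated squares therefore all obey the crude bound with one and the
  same constant, which disappears in the limit.\<close>

lemma norm_level_le:
  assumes z: "z \<in> unit_span (paths p) (paths n)" and n: "n \<in> {..K} \<times> {..K}"
    and M: "0 \<le> M" "\<And>\<xi>. \<xi> \<in> level_space h \<zeta> n \<Longrightarrow> norm (h z \<cdot> \<xi>) \<le> M * norm \<xi>"
  shows "norm z \<le> M"
proof -
  define A where "A = {\<mu>::'m. deg \<mu> = n}"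
  define c where "c j = ((\<lambda>x. x * x) ^^ j) (star z * z)" for j
  have c_Suc: "c (Suc j) = c j * c j" for j by (simp add: c_def)
  have cA: "c j \<in> unit_span A A" for j
  proof (induction j)
    case 0
    then show ?case using z unfolding c_def A_def
      by (auto intro: unit_span_level_mult unit_span_star)
  next
    case (Suc j)
    show ?case
      unfolding c_Suc A_def by (rule unit_span_level_mult[OF Suc[unfolded A_def] Suc[unfolded A_def]])
  qed
  have c_norm: "norm (c j) = norm (star z * z) ^ (2 ^ j)" for j
    unfolding c_def by (rule norm_iterated_square) (simp add: star_mult star_star)
  have c_le: "norm (h (c j) \<cdot> \<xi>) \<le> (M\<^sup>2) ^ (2 ^ j) * norm \<xi>" if "\<xi> \<in> level_space h \<zeta> n" for j \<xi>
    using that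
  proof (induction j arbitrary: \<xi>)
    case 0
    \<comment> \<open>The bound M is known only on the level space, so it cannot be passed to the
      adjoint of \<open>h z\<close>. Since \<xi>' stays in the level space, M may be applied to
      \<xi> and \<xi>' in <\<xi>', \<xi>'> = <z \<xi>', z \<xi>>.\<close>
    define \<xi>' where "\<xi>' = h (c 0) \<cdot> \<xi>"
    have "\<xi>' \<in> level_space h \<zeta> n"
      unfolding \<xi>'_def using cA 0 by (intro level_space_apply) (auto simp: A_def)
    then have le: "norm (h z \<cdot> \<xi>) \<le> M * norm \<xi>" "norm (h z \<cdot> \<xi>') \<le> M * norm \<xi>'"
      using M(2) 0 by auto
    have "norm \<xi>' * norm \<xi>' = inner (h z \<cdot> \<xi>') (h z \<cdot> \<xi>)"
      by (simp add: c_def \<xi>'_def[unfolded c_def] h_simps inner_star_right flip: power2_eq_square power2_norm_eq_inner)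
        (simp add: power2_norm_eq_inner inner_star_right)
    also have "\<dots> \<le> norm (h z \<cdot> \<xi>') * norm (h z \<cdot> \<xi>)" by (rule norm_cauchy_schwarz)
    also have "\<dots> \<le> (M * norm \<xi>') * (M * norm \<xi>)"
      using M(1) by (intro mult_mono le) auto
    also have "\<dots> = norm \<xi>' * (M\<^sup>2 * norm \<xi>)" by (simp add: power2_eq_square)
    finally have "norm \<xi>' \<le> M\<^sup>2 * norm \<xi>"
      using M(1) by (cases "\<xi>' = 0") auto
    then show ?case by (simp add: \<xi>'_def)
  next
    case (Suc j)
    have "h (c j) \<cdot> \<xi> \<in> level_space h \<zeta> n"
      using cA Suc.prems by (intro level_space_apply) (auto simp: A_def)
    then have "norm (h (c j) \<cdot> h (c j) \<cdot> \<xi>) \<le> (M\<^sup>2) ^ (2 ^ j) * norm (h (c j) \<cdot> \<xi>)"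
      by (rule Suc.IH)
    also have "\<dots> \<le> (M\<^sup>2) ^ (2 ^ j) * ((M\<^sup>2) ^ (2 ^ j) * norm \<xi>)"
      using Suc.IH[OF Suc.prems] by (intro mult_left_mono) auto
    also have "\<dots> = (M\<^sup>2) ^ (2 ^ Suc j) * norm \<xi>"
      by (simp add: mult_2 power_add mult.assoc)
    finally show ?case by (simp add: c_Suc h_simps)
  qed
  have "norm (star z * z) \<le> M\<^sup>2"
  proof (rule le_of_power_bound)
    \<comment> \<open>Here D = 1: all \<open>c j\<close> lie in the same span, so the constant does
      not grow with j.\<close>
    show "norm (star z * z) ^ (2 ^ j) \<le> (real (card A))\<^sup>2 * 1 ^ j * (M\<^sup>2) ^ (2 ^ j)" for j
      using norm_le_card_level[OF cA[of j, unfolded A_def] n c_le[of _ j]]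
      by (simp add: c_norm A_def)
  qed auto
  then show ?thesis
    unfolding norm_star_mult using M(1) by (rule power2_le_imp_le)
qed

end

lemma norm_box_le:
  fixes y :: "'m ck_algebra"
  assumes y: "y \<in> unit_span (degree_box L) (degree_box L)" and sep: "separating h (2 * L) \<zeta>"
  shows "norm y \<le> (2 * real L + 1)\<^sup>2 * norm (h y)"
proof -
  define B where "B = {\<nu>::'m. deg \<nu> = (L, L)}"
  define P where "P = {..2 * L} \<times> {..2 * L}"
  obtain c where c: "y = (\<Sum>\<mu>\<in>degree_box (2 * L). \<Sum>\<nu>\<in>B. c \<mu> \<nu> *\<^sub>C matrix_unit \<mu> \<nu>)"
    using unit_span_expand[OF y] finite_degree_box finite_deg unfolding B_def by (rule unit_span_coeffs)
  define z where "z p = (\<Sum>\<mu> | deg \<mu> = p. \<Sum>\<nu>\<in>B. c \<mu> \<nu> *\<^sub>C matrix_unit \<mu> \<nu>)" for p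
  have zp: "z p \<in> unit_span (paths p) (paths (L, L))" for p
    unfolding z_def by (intro unit_span_sum unit_span_scaleC matrix_unit_in_span) (auto simp: B_def)
  have y_eq: "y = (\<Sum>p\<in>P. z p)"
  proof -
    have "(\<Sum>p\<in>P. z p) = (\<Sum>p\<in>P. \<Sum>\<mu> | \<mu> \<in> degree_box (2 * L) \<and> deg \<mu> = p. \<Sum>\<nu>\<in>B. c \<mu> \<nu> *\<^sub>C matrix_unit \<mu> \<nu>)"
      unfolding z_def by (intro sum.cong) (auto simp: P_def degree_box_def)
    also have "\<dots> = y"
      unfolding c 
    proof (rule sum.group)
      show "deg ` (degree_box (2 * L) :: 'm set) \<subseteq> P"
        by (rule image_subsetI) (simp add: degree_box_def P_def mem_Times_iff)
    qed (simp_all add: finite_degree_box P_def)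
    finally show ?thesis by simp
  qed
  have LP: "(L, L) \<in> {..2 * L} \<times> {..2 * L}" by simp
  have "norm (z q) \<le> norm (h y)" if q: "q \<in> P" for q
  proof (rule norm_level_le[OF sep zp LP])
    fix \<xi>
    assume \<xi>: "\<xi> \<in> level_space h \<zeta> (L, L)"
    \<comment> \<open>Different parts send \<xi> into level spaces of different degree, which are
      orthogonal; Pythagoras then bounds each part by the whole. Left labels reach degree (2L, 2L),
      hence a vector separating up to 2L.\<close>
    have "pairwise (\<lambda>p q. orthogonal (h (z p) \<cdot> \<xi>) (h (z q) \<cdot> \<xi>)) P"
      using level_space_orthogonal[OF sep level_space_apply[OF zp \<xi>] level_space_apply[OF zp \<xi>]]
      by (simp add: pairwise_def orthogonal_def P_def)
    then have "(norm (h y \<cdot> \<xi>))\<^sup>2 = (\<Sum>p\<in>P. (norm (h (z p) \<cdot> \<xi>))\<^sup>2)"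
      unfolding y_eq h_simps op_apply_sum by (intro norm_sum_Pythagorean) (auto simp: P_def)
    moreover have "(norm (h (z q) \<cdot> \<xi>))\<^sup>2 \<le> (\<Sum>p\<in>P. (norm (h (z p) \<cdot> \<xi>))\<^sup>2)"
      using q by (intro member_le_sum) (auto simp: P_def)
    ultimately have "norm (h (z q) \<cdot> \<xi>) \<le> norm (h y \<cdot> \<xi>)"
      by (intro power2_le_imp_le[of "norm (h (z q) \<cdot> \<xi>)"]) auto
    then show "norm (h (z q) \<cdot> \<xi>) \<le> norm (h y) * norm \<xi>"
      using norm_op_apply[of "h y" \<xi>] by linarith
  qed simp
  then have "norm y \<le> (\<Sum>p\<in>P. norm (h y))"
    unfolding y_eq by (rule sum_norm_le)
  then show ?thesis by (simp add: P_def power2_eq_square algebra_simps)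
qed

theorem separating_isometric:
  assumes sep: "\<And>K. \<exists>\<zeta>. separating h K \<zeta>"
  shows "norm (h a) = norm a"
proof -
  have dense: "norm (ck_embed x) \<le> norm (h (ck_embed x))" for x
  proof -
    obtain L where L: "ck_embed x \<in> unit_span (degree_box L) (degree_box L :: 'm set)"
      using ck_embed_in_box by blast
    define y where "y = star (ck_embed x) * ck_embed x"
    define c where "c j = ((\<lambda>x. x * x) ^^ j) y" for j
    have c_Suc: "c (Suc j) = c j * c j" for j by (simp add: c_def)
    \<comment> \<open>y is a product of two elements of the box of size L, and each squaring doubles
      the size.\<close>
    have cL: "c j \<in> unit_span (degree_box (2 * 2 ^ j * L)) (degree_box (2 * 2 ^ j * L))" for j
    proof (induction j)
      case 0
      then show ?case
        using unit_span_box_mult[OF unit_span_star[OF L] L] by (simp add: c_def y_def mult_2)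
    next
      case (Suc j)
      then show ?case
        using unit_span_box_mult[OF Suc Suc] unfolding c_Suc by (simp add: mult_2 add_mult_distrib)
    qed
    have c_norm: "norm (c j) = norm y ^ (2 ^ j)" for j
      unfolding c_def by (rule norm_iterated_square) (simp add: y_def star_mult star_star)
    have hc_norm: "norm (h (c j)) \<le> norm (h y) ^ (2 ^ j)" for j
    proof (induction j)
      case (Suc j)
      have "norm (h (c (Suc j))) \<le> norm (h (c j)) * norm (h (c j))"
        unfolding c_Suc h_simps by (rule norm_mult_ineq)
      also have "\<dots> \<le> norm (h y) ^ (2 ^ j) * norm (h y) ^ (2 ^ j)"
        by (intro mult_mono Suc) auto
      finally show ?case by (simp add: mult_2 power_add)
    qed (simp add: c_def)
    have "norm y \<le> norm (h y)"
    proof (rule le_of_power_bound)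
      fix j :: nat
      obtain \<zeta> where \<zeta>: "separating h (2 * (2 * 2 ^ j * L)) \<zeta>" using sep by blast
      have "norm y ^ (2 ^ j) \<le> (2 * real (2 * 2 ^ j * L) + 1)\<^sup>2 * norm (h (c j))"
        using norm_box_le[OF cL \<zeta>] by (simp only: c_norm)
      \<comment> \<open>4 * 2^j * L + 1 is at most (4L + 1) * 2^j. Its square provides C = (4L +
        1)^2 and D = 4 for \<open>le_of_power_bound\<close>.\<close>
      also have "\<dots> \<le> ((4 * real L + 1) * 2 ^ j)\<^sup>2 * norm (h y) ^ (2 ^ j)"
        by (intro mult_mono power_mono hc_norm) (auto simp: algebra_simps)
      also have "\<dots> = (4 * real L + 1)\<^sup>2 * 4 ^ j * norm (h y) ^ (2 ^ j)"
        by (simp add: power_mult_distrib power_mult[symmetric] mult.commute[of j]) (simp add: power_mult)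
      finally show "norm y ^ (2 ^ j) \<le> (4 * real L + 1)\<^sup>2 * 4 ^ j * norm (h y) ^ (2 ^ j)" .
    qed auto
    then have "(norm (ck_embed x))\<^sup>2 \<le> (norm (h (ck_embed x)))\<^sup>2"
      by (simp add: y_def h_simps norm_star_mult)
    then show ?thesis by simp
  qed
  obtain X where X: "ck_Cauchy X" "a = ck_lim X" by (rule ck_lim_cases)
  have lim: "(\<lambda>n. ck_embed (X n)) \<longlonglongrightarrow> a" unfolding X(2) by (rule ck_embed_LIMSEQ[OF X(1)])
  have "(\<lambda>n. norm (h (ck_embed (X n)))) \<longlonglongrightarrow> norm (h a)"
  proof (rule tendsto_norm, rule Lim_null_comparison[THEN LIM_zero_cancel])
    show "\<forall>\<^sub>F n in sequentially. norm (h (ck_embed (X n)) - h a) \<le> norm (ck_embed (X n) - a)"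
      unfolding h_simps(7)[symmetric] using norm_h_le by simp
    show "(\<lambda>n. norm (ck_embed (X n) - a)) \<longlonglongrightarrow> 0"
      using lim by (intro tendsto_norm_zero LIM_zero)
  qed
  from LIMSEQ_le[OF tendsto_norm[OF lim] this] have "norm a \<le> norm (h a)" using dense by blast
  with norm_h_le[of a] show ?thesis by linarith
qed

theorem separating_inj:
  assumes sep: "\<And>K. \<exists>\<zeta>. separating h K \<zeta>"
  shows "inj h"
proof (rule injI)
  fix a b
  assume "h a = h b"
  then have "norm (h (a - b)) = 0" by (simp add: h_simps)
  then show "a = b" using separating_isometric[OF sep, of "a - b"] by simp
qed

end

section \<open>Square-integrable functions\<close>

lemma l2_funD:
  assumes "\<phi> \<in> l2_fun M"
  shows "\<phi> \<in> borel_measurable M" "integrable M (\<lambda>x. (cmod (\<phi> x))\<^sup>2)"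
  using assms by (auto simp: l2_fun_def)

lemma cmod_add_power2_le: "(cmod (a + b))\<^sup>2 \<le> 2 * (cmod a)\<^sup>2 + 2 * (cmod b)\<^sup>2"
proof -
  have "(cmod (a + b))\<^sup>2 \<le> (cmod a + cmod b)\<^sup>2" by (intro power_mono norm_triangle_ineq) simp
  also have "\<dots> \<le> 2 * (cmod a)\<^sup>2 + 2 * (cmod b)\<^sup>2"
    using sum_squares_bound[of "cmod a" "cmod b"] by (simp add: power2_sum)
  finally show ?thesis .
qed

lemma l2_fun_add:
  assumes "\<phi> \<in> l2_fun M" "\<psi> \<in> l2_fun M"
  shows "(\<lambda>x. \<phi> x + \<psi> x) \<in> l2_fun M"
proof -
  note [measurable] = assms[THEN l2_funD(1)]
  have "integrable M (\<lambda>x. (cmod (\<phi> x + \<psi> x))\<^sup>2)"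
  proof (rule Bochner_Integration.integrable_bound)
    show "integrable M (\<lambda>x. 2 * (cmod (\<phi> x))\<^sup>2 + 2 * (cmod (\<psi> x))\<^sup>2)"
      using assms[THEN l2_funD(2)] by simp
    show "AE x in M. norm ((cmod (\<phi> x + \<psi> x))\<^sup>2) \<le> norm (2 * (cmod (\<phi> x))\<^sup>2 + 2 * (cmod (\<psi> x))\<^sup>2)"
      using cmod_add_power2_le by (intro AE_I2) simp
  qed measurable
  then show ?thesis by (simp add: l2_fun_def)
qed

lemma l2_fun_scale: "\<phi> \<in> l2_fun M \<Longrightarrow> (\<lambda>x. c * \<phi> x) \<in> l2_fun M"
  by (auto simp: l2_fun_def norm_mult power_mult_distrib)

lemma l2_fun_minus: "\<phi> \<in> l2_fun M \<Longrightarrow> (\<lambda>x. - \<phi> x) \<in> l2_fun M"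
  using l2_fun_scale[of \<phi> M "-1"] by simp

lemma l2_fun_diff: "\<phi> \<in> l2_fun M \<Longrightarrow> \<psi> \<in> l2_fun M \<Longrightarrow> (\<lambda>x. \<phi> x - \<psi> x) \<in> l2_fun M"
  using l2_fun_add[OF _ l2_fun_minus, of \<phi> M \<psi>] by simp

lemma l2_fun_zero: "(\<lambda>x. 0) \<in> l2_fun M"
  by (simp add: l2_fun_def)

lemma borel_measurable_cnj [measurable]: "\<phi> \<in> borel_measurable M \<Longrightarrow> (\<lambda>x. cnj (\<phi> x)) \<in> borel_measurable M"
  by (rule measurable_compose[OF _ borel_measurable_continuous_onI[OF continuous_on_cnj[OF continuous_on_id]]])

lemma l2_fun_integrable_product:
  assumes "\<phi> \<in> l2_fun M" "\<psi> \<in> l2_fun M"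
  shows "integrable M (\<lambda>x. \<phi> x * cnj (\<psi> x))"
proof (rule Bochner_Integration.integrable_bound)
  note [measurable] = assms[THEN l2_funD(1)]
  show "integrable M (\<lambda>x. (cmod (\<phi> x))\<^sup>2 + (cmod (\<psi> x))\<^sup>2)"
    using assms[THEN l2_funD(2)] by simp
  show "(\<lambda>x. \<phi> x * cnj (\<psi> x)) \<in> borel_measurable M" by measurable
  have "cmod (\<phi> x) * cmod (\<psi> x) \<le> (cmod (\<phi> x))\<^sup>2 + (cmod (\<psi> x))\<^sup>2" for x
    using sum_squares_bound[of "cmod (\<phi> x)" "cmod (\<psi> x)"]
      mult_nonneg_nonneg[OF norm_ge_zero[of "\<phi> x"] norm_ge_zero[of "\<psi> x"]] by linarith
  then show "AE x in M. norm (\<phi> x * cnj (\<psi> x)) \<le> norm ((cmod (\<phi> x))\<^sup>2 + (cmod (\<psi> x))\<^sup>2)"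
    by (simp add: norm_mult)
qed

text \<open>A subsequence with increments below \<open>2\<^sup>-\<^sup>k\<close> in norm converges
  almost everywhere, and Fatou's lemma identifies its limit.\<close>

lemma AE_convergent_of_increments:
  fixes \<phi> :: "nat \<Rightarrow> 'x \<Rightarrow> complex"
  assumes \<phi>: "\<And>k. \<phi> k \<in> l2_fun M"
    and le: "\<And>k. (\<integral>x. (cmod (\<phi> (Suc k) x - \<phi> k x))\<^sup>2 \<partial>M) \<le> (1/4) ^ k"
  shows "AE x in M. convergent (\<lambda>k. \<phi> k x)"
proof -
  \<comment> \<open>Weighted by 2^k, the integrals of the d k are still summable, being at most 2^k
    / 4^k. So almost everywhere d k x <= C / 2^k, and the increments are dominated by a geometric
    series with ratio 1 / sqrt 2.\<close>
  define d where "d k x = (cmod (\<phi> (Suc k) x - \<phi> k x))\<^sup>2" for k x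
  note [measurable] = l2_funD(1)[OF \<phi>]
  have int: "integrable M (d k)" for k
    unfolding d_def by (intro l2_funD(2) l2_fun_diff \<phi>)
  have "(\<integral>\<^sup>+x. (\<Sum>k. ennreal (2 ^ k * d k x)) \<partial>M) = (\<Sum>k. \<integral>\<^sup>+x. ennreal (2 ^ k * d k x) \<partial>M)"
    unfolding d_def by (rule nn_integral_suminf) measurable
  also have "\<dots> = (\<Sum>k. ennreal (2 ^ k * (\<integral>x. d k x \<partial>M)))"
  proof (intro suminf_cong)
    fix k
    have "(\<integral>\<^sup>+x. ennreal (2 ^ k * d k x) \<partial>M) = ennreal (\<integral>x. 2 ^ k * d k x \<partial>M)"
      by (intro nn_integral_eq_integral integrable_mult_right int) (simp add: d_def)
    then show "(\<integral>\<^sup>+x. ennreal (2 ^ k * d k x) \<partial>M) = ennreal (2 ^ k * (\<integral>x. d k x \<partial>M))" by simp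
  qed
  also have "\<dots> \<le> (\<Sum>k. ennreal ((1/2) ^ k))"
  proof (intro suminf_le allI ennreal_leI)
    fix k :: nat
    have "2 ^ k * (\<integral>x. d k x \<partial>M) \<le> 2 ^ k * (1/4) ^ k"
      using le[of k] by (intro mult_left_mono) (auto simp: d_def)
    also have "\<dots> = (1/2) ^ k" by (simp flip: power_mult_distrib)
    finally show "2 ^ k * (\<integral>x. d k x \<partial>M) \<le> (1/2) ^ k" .
  qed auto
  also have "\<dots> = ennreal (\<Sum>k. (1/2) ^ k)"
    by (intro suminf_ennreal2) (auto intro: summable_geometric)
  also have "\<dots> < \<infinity>" by simp
  finally have fin: "(\<integral>\<^sup>+x. (\<Sum>k. ennreal (2 ^ k * d k x)) \<partial>M) \<noteq> \<infinity>" by simp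
  have "AE x in M. (\<Sum>k. ennreal (2 ^ k * d k x)) \<noteq> \<infinity>"
    by (rule nn_integral_PInf_AE[OF _ fin]) (unfold d_def, measurable)
  then show ?thesis
  proof eventually_elim
    case (elim x)
    define C where "C = enn2real (\<Sum>k. ennreal (2 ^ k * d k x))"
    have C: "2 ^ k * d k x \<le> C" for k
    proof -
      have "ennreal (2 ^ k * d k x) \<le> (\<Sum>k. ennreal (2 ^ k * d k x))"
        using sum_le_suminf[of "\<lambda>k. ennreal (2 ^ k * d k x)" "{k}"] by simp
      also have "\<dots> = ennreal C" using elim by (simp add: C_def less_top[symmetric])
      finally show ?thesis by (subst (asm) ennreal_le_iff) (auto simp: C_def)
    qed
    have "summable (\<lambda>k. \<phi> (Suc k) x - \<phi> k x)"
    proof (rule summable_comparison_test)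
      show "summable (\<lambda>k. sqrt C * (1 / sqrt 2) ^ k)"
        by (intro summable_mult summable_geometric) auto
      have "cmod (\<phi> (Suc k) x - \<phi> k x) \<le> sqrt C * (1 / sqrt 2) ^ k" for k
      proof (rule power2_le_imp_le)
        have "C \<ge> 0" by (simp add: C_def)
        then show "0 \<le> sqrt C * (1 / sqrt 2) ^ k" by simp
        have "(sqrt C * (1 / sqrt 2) ^ k)\<^sup>2 = C * ((1 / sqrt 2)\<^sup>2) ^ k"
          using \<open>C \<ge> 0\<close> by (simp only: power_mult_distrib real_sqrt_pow2 flip: power_mult)
            (simp only: mult.commute)
        also have "\<dots> = C / 2 ^ k" by (simp add: power_divide)
        finally have eq: "(sqrt C * (1 / sqrt 2) ^ k)\<^sup>2 = C / 2 ^ k" .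
        show "(cmod (\<phi> (Suc k) x - \<phi> k x))\<^sup>2 \<le> (sqrt C * (1 / sqrt 2) ^ k)\<^sup>2"
          unfolding eq using C[of k] by (simp add: d_def field_simps)
      qed
      then show "\<exists>N. \<forall>n\<ge>N. norm (\<phi> (Suc n) x - \<phi> n x) \<le> sqrt C * (1 / sqrt 2) ^ n" by blast
    qed
    then have "convergent (\<lambda>n. \<Sum>k<n. \<phi> (Suc k) x - \<phi> k x)"
      by (simp add: summable_iff_convergent)
    then have "convergent (\<lambda>n. \<phi> n x - \<phi> 0 x)" by (simp only: sum_lessThan_telescope[of "\<lambda>k. \<phi> k x"])
    from convergent_add[OF this convergent_const[of "\<phi> 0 x"]] show ?case by simp
  qed
qed

text \<open>Fatou along the subsequence is applied to the distance from each fixed \<phi> n. This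
  shows at once that \<psi> is square-integrable and that the whole sequence converges to
  it.\<close>

lemma l2_complete:
  fixes \<phi> :: "nat \<Rightarrow> 'x \<Rightarrow> complex"
  assumes \<phi>: "\<And>n. \<phi> n \<in> l2_fun M"
    and Cauchy: "\<And>e. e > 0 \<Longrightarrow> \<exists>N. \<forall>m\<ge>N. \<forall>n\<ge>N. (\<integral>x. (cmod (\<phi> m x - \<phi> n x))\<^sup>2 \<partial>M) < e"
  obtains \<psi> where "\<psi> \<in> l2_fun M" "(\<lambda>n. \<integral>x. (cmod (\<phi> n x - \<psi> x))\<^sup>2 \<partial>M) \<longlonglongrightarrow> 0"
proof -
  note [measurable] = l2_funD(1)[OF \<phi>]
  have "\<exists>N. \<forall>m\<ge>N. \<forall>n\<ge>N. (\<integral>x. (cmod (\<phi> m x - \<phi> n x))\<^sup>2 \<partial>M) < (1/4) ^ k" for k :: nat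
    by (rule Cauchy) simp
  then obtain N where N: "\<And>k m n. m \<ge> N k \<Longrightarrow> n \<ge> N k \<Longrightarrow>
      (\<integral>x. (cmod (\<phi> m x - \<phi> n x))\<^sup>2 \<partial>M) < (1/4) ^ k" by metis
  \<comment> \<open>The partial sums dominate each N k and increase with k; the summand k makes r k
    tend to infinity.\<close>
  define r where "r k = (\<Sum>j\<le>k. N j) + k" for k
  have r: "r k \<ge> N k" "r (Suc k) \<ge> r k" "r k \<ge> k" for k
    by (auto simp: r_def intro: trans_le_add1 member_le_sum)
  have "AE x in M. convergent (\<lambda>k. \<phi> (r k) x)"
  proof (rule AE_convergent_of_increments[OF \<phi>])
    show "(\<integral>x. (cmod (\<phi> (r (Suc k)) x - \<phi> (r k) x))\<^sup>2 \<partial>M) \<le> (1/4) ^ k" for k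
      using r[of k] by (intro less_imp_le[OF N]) auto
  qed
  define \<psi> where "\<psi> x = lim (\<lambda>k. \<phi> (r k) x)" for x
  have [measurable]: "\<psi> \<in> borel_measurable M"
    unfolding \<psi>_def by (intro borel_measurable_lim_metric) measurable
  have \<psi>: "AE x in M. (\<lambda>k. \<phi> (r k) x) \<longlonglongrightarrow> \<psi> x"
    using \<open>AE x in M. convergent (\<lambda>k. \<phi> (r k) x)\<close> by eventually_elim (simp add: \<psi>_def convergent_LIMSEQ_iff)
  \<comment> \<open>A bound on the distances from \<phi> n to all later terms survives in the limit
    \<psi>.\<close>
  have bound: "integrable M (\<lambda>x. (cmod (\<phi> n x - \<psi> x))\<^sup>2) \<and> (\<integral>x. (cmod (\<phi> n x - \<psi> x))\<^sup>2 \<partial>M) \<le> e"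
    if e: "e > 0" and n: "\<And>m. m \<ge> n \<Longrightarrow> (\<integral>x. (cmod (\<phi> n x - \<phi> m x))\<^sup>2 \<partial>M) \<le> e" for n e
  proof -
    have "(\<integral>\<^sup>+x. ennreal ((cmod (\<phi> n x - \<psi> x))\<^sup>2) \<partial>M)
        = (\<integral>\<^sup>+x. liminf (\<lambda>k. ennreal ((cmod (\<phi> n x - \<phi> (r k) x))\<^sup>2)) \<partial>M)"
    proof (rule nn_integral_cong_AE)
      show "AE x in M. ennreal ((cmod (\<phi> n x - \<psi> x))\<^sup>2)
          = liminf (\<lambda>k. ennreal ((cmod (\<phi> n x - \<phi> (r k) x))\<^sup>2))"
        using \<psi>
      proof eventually_elim
        case (elim x)
        have "(\<lambda>k. ennreal ((cmod (\<phi> n x - \<phi> (r k) x))\<^sup>2)) \<longlonglongrightarrow> ennreal ((cmod (\<phi> n x - \<psi> x))\<^sup>2)"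
          by (intro tendsto_ennrealI tendsto_intros elim)
        then show ?case by (intro lim_imp_Liminf[symmetric]) auto
      qed
    qed
    also have "\<dots> \<le> liminf (\<lambda>k. \<integral>\<^sup>+x. ennreal ((cmod (\<phi> n x - \<phi> (r k) x))\<^sup>2) \<partial>M)"
      by (rule nn_integral_liminf) measurable
    also have "\<dots> \<le> ennreal e"
    proof (rule Liminf_le)
      have "(\<integral>\<^sup>+x. ennreal ((cmod (\<phi> n x - \<phi> (r k) x))\<^sup>2) \<partial>M) \<le> ennreal e" if "k \<ge> n" for k
      proof -
        have "(\<integral>\<^sup>+x. ennreal ((cmod (\<phi> n x - \<phi> (r k) x))\<^sup>2) \<partial>M)
            = ennreal (\<integral>x. (cmod (\<phi> n x - \<phi> (r k) x))\<^sup>2 \<partial>M)"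
          by (intro nn_integral_eq_integral l2_funD(2) l2_fun_diff \<phi>) auto
        then show ?thesis using n[of "r k"] that r(3)[of k] by (simp add: ennreal_leI)
      qed
      then show "\<forall>\<^sub>F k in sequentially. (\<integral>\<^sup>+x. ennreal ((cmod (\<phi> n x - \<phi> (r k) x))\<^sup>2) \<partial>M) \<le> ennreal e"
        by (auto intro: eventually_sequentiallyI[of n])
    qed simp
    finally have le: "(\<integral>\<^sup>+x. ennreal ((cmod (\<phi> n x - \<psi> x))\<^sup>2) \<partial>M) \<le> ennreal e" .
    also have "\<dots> < \<infinity>" by simp
    finally have int: "integrable M (\<lambda>x. (cmod (\<phi> n x - \<psi> x))\<^sup>2)"
      by (intro integrableI_nonneg) auto
    then have "ennreal (\<integral>x. (cmod (\<phi> n x - \<psi> x))\<^sup>2 \<partial>M) \<le> ennreal e"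
      using le by (subst (asm) nn_integral_eq_integral) auto
    then show ?thesis using int e by simp
  qed
  have ev: "\<exists>N. \<forall>n\<ge>N. integrable M (\<lambda>x. (cmod (\<phi> n x - \<psi> x))\<^sup>2) \<and> (\<integral>x. (cmod (\<phi> n x - \<psi> x))\<^sup>2 \<partial>M) \<le> e"
    if e: "e > 0" for e
  proof -
    obtain K where "\<And>m n. m \<ge> K \<Longrightarrow> n \<ge> K \<Longrightarrow> (\<integral>x. (cmod (\<phi> m x - \<phi> n x))\<^sup>2 \<partial>M) < e"
      using Cauchy[OF e] by blast
    then show ?thesis by (intro exI[of _ K] allI impI bound[OF e]) (meson less_imp_le order_trans)
  qed
  show ?thesis
  proof (rule that)
    obtain n where "integrable M (\<lambda>x. (cmod (\<phi> n x - \<psi> x))\<^sup>2)" using ev[of 1] by auto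
    then have "(\<lambda>x. \<phi> n x - \<psi> x) \<in> l2_fun M" by (simp add: l2_fun_def)
    from l2_fun_diff[OF \<phi>[of n] this] show "\<psi> \<in> l2_fun M" by simp
    show "(\<lambda>n. \<integral>x. (cmod (\<phi> n x - \<psi> x))\<^sup>2 \<partial>M) \<longlonglongrightarrow> 0"
    proof (rule LIMSEQ_I)
      fix e :: real
      assume "e > 0"
      then obtain N where "\<forall>n\<ge>N. (\<integral>x. (cmod (\<phi> n x - \<psi> x))\<^sup>2 \<partial>M) \<le> e / 2"
        using ev[of "e / 2"] by auto
      then show "\<exists>N. \<forall>n\<ge>N. norm ((\<integral>x. (cmod (\<phi> n x - \<psi> x))\<^sup>2 \<partial>M) - 0) < e"
        using \<open>e > 0\<close> by (intro exI[of _ N]) force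
    qed
  qed
qed


section \<open>The Hilbert space of the square\<close>

abbreviation (input) square :: "(real \<times> real) measure" where
  "square \<equiv> lebesgue_on ({0..1} \<times> {-1..1})"

definition l2_rel :: "'x measure \<Rightarrow> ('x \<Rightarrow> complex) \<Rightarrow> ('x \<Rightarrow> complex) \<Rightarrow> bool" where
  "l2_rel M \<phi> \<psi> \<longleftrightarrow> \<phi> \<in> l2_fun M \<and> \<psi> \<in> l2_fun M \<and> (AE x in M. \<phi> x = \<psi> x)"

lemma l2_rel_part_equivp: "part_equivp (l2_rel M)"
proof (rule part_equivpI)
  show "\<exists>\<phi>. l2_rel M \<phi> \<phi>" by (auto simp: l2_rel_def intro: l2_fun_zero)
  show "symp (l2_rel M)" by (rule sympI) (auto simp: l2_rel_def elim: AE_mp)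
  show "transp (l2_rel M)"
    by (rule transpI) (auto simp: l2_rel_def elim!: eventually_elim2)
qed

\<comment> \<open>A copy of the set \<open>l2 square\<close> as a type, so that it can be an
  instance of \<open>complex_hilbert\<close>; \<open>class_of\<close> is the isometric bijection
  back to classes of functions. The relation is partial because only square-integrable functions
  take part.\<close>
quotient_type square_l2 = "real \<times> real \<Rightarrow> complex" / partial: "l2_rel square"
  morphisms rep_square_l2 l2vec
  by (rule l2_rel_part_equivp)

lemma l2_rel_refl: "l2_rel M \<phi> \<phi> \<longleftrightarrow> \<phi> \<in> l2_fun M"
  by (simp add: l2_rel_def)

lemma l2vec_cases: obtains \<phi> where "\<phi> \<in> l2_fun square" "a = l2vec \<phi>"
proof -
  have "l2_rel square (rep_square_l2 a) (rep_square_l2 a)" "l2vec (rep_square_l2 a) = a"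
    using Quotient_rep_reflp[OF Quotient_square_l2] Quotient_abs_rep[OF Quotient_square_l2] by auto
  then show ?thesis using that by (metis l2_rel_refl)
qed

lemma l2vec_eq_iff:
  assumes "\<phi> \<in> l2_fun square" "\<psi> \<in> l2_fun square"
  shows "l2vec \<phi> = l2vec \<psi> \<longleftrightarrow> (AE x in square. \<phi> x = \<psi> x)"
  using Quotient_rel[OF Quotient_square_l2, of \<phi> \<psi>] assms by (simp add: l2_rel_def)

lemma l2_integral_inner_cong:
  assumes "l2_rel M \<phi> \<phi>'" "l2_rel M \<psi> \<psi>'"
  shows "(\<integral>x. inner (\<phi> x) (\<psi> x) \<partial>M) = (\<integral>x. inner (\<phi>' x) (\<psi>' x) \<partial>M)"
proof (rule integral_cong_AE)
  have [measurable]: "\<phi> \<in> borel_measurable M" "\<phi>' \<in> borel_measurable M"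
    "\<psi> \<in> borel_measurable M" "\<psi>' \<in> borel_measurable M"
    using assms by (auto simp: l2_rel_def l2_fun_def)
  show "(\<lambda>x. inner (\<phi> x) (\<psi> x)) \<in> borel_measurable M" "(\<lambda>x. inner (\<phi>' x) (\<psi>' x)) \<in> borel_measurable M"
    by measurable
  show "AE x in M. inner (\<phi> x) (\<psi> x) = inner (\<phi>' x) (\<psi>' x)"
    using assms by (auto simp: l2_rel_def elim!: eventually_elim2)
qed

lemma l2_fun_integrable_inner:
  "\<phi> \<in> l2_fun M \<Longrightarrow> \<psi> \<in> l2_fun M \<Longrightarrow> integrable M (\<lambda>x. inner (\<phi> x) (\<psi> x))"
  using integrable_Re[OF l2_fun_integrable_product, of \<phi> M \<psi>] by (simp add: inner_complex_def)

instantiation square_l2 :: real_inner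
begin
lift_definition zero_square_l2 :: square_l2 is "\<lambda>_. 0"
  by (simp add: l2_rel_refl l2_fun_zero)
lift_definition plus_square_l2 :: "square_l2 \<Rightarrow> square_l2 \<Rightarrow> square_l2" is "\<lambda>\<phi> \<psi> x. \<phi> x + \<psi> x"
  by (auto simp: l2_rel_def intro: l2_fun_add elim!: eventually_elim2)
lift_definition uminus_square_l2 :: "square_l2 \<Rightarrow> square_l2" is "\<lambda>\<phi> x. - \<phi> x"
  by (auto simp: l2_rel_def intro: l2_fun_minus)
lift_definition minus_square_l2 :: "square_l2 \<Rightarrow> square_l2 \<Rightarrow> square_l2" is "\<lambda>\<phi> \<psi> x. \<phi> x - \<psi> x"
  by (auto simp: l2_rel_def intro: l2_fun_diff elim!: eventually_elim2)
lift_definition scaleR_square_l2 :: "real \<Rightarrow> square_l2 \<Rightarrow> square_l2" is "\<lambda>r \<phi> x. of_real r * \<phi> x"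
  by (auto simp: l2_rel_def intro: l2_fun_scale elim: AE_mp)
lift_definition inner_square_l2 :: "square_l2 \<Rightarrow> square_l2 \<Rightarrow> real"
  is "\<lambda>\<phi> \<psi>. \<integral>x. inner (\<phi> x) (\<psi> x) \<partial>square"
  by (rule l2_integral_inner_cong)
definition norm_square_l2 :: "square_l2 \<Rightarrow> real" where
  "norm_square_l2 x = sqrt (inner x x)"
definition sgn_square_l2 :: "square_l2 \<Rightarrow> square_l2" where
  "sgn_square_l2 x = inverse (norm x) *\<^sub>R x"
definition dist_square_l2 :: "square_l2 \<Rightarrow> square_l2 \<Rightarrow> real" where
  "dist_square_l2 x y = norm (x - y)"
definition uniformity_square_l2 :: "(square_l2 \<times> square_l2) filter" where
  "uniformity_square_l2 = (INF e\<in>{0<..}. principal {(x, y). dist x y < e})"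
definition open_square_l2 :: "square_l2 set \<Rightarrow> bool" where
  "open_square_l2 U \<longleftrightarrow> (\<forall>x\<in>U. \<forall>\<^sub>F (x', y) in uniformity. x' = x \<longrightarrow> y \<in> U)"

lemma l2vec_simps:
  "\<phi> \<in> l2_fun square \<Longrightarrow> \<psi> \<in> l2_fun square \<Longrightarrow> l2vec \<phi> + l2vec \<psi> = l2vec (\<lambda>x. \<phi> x + \<psi> x)"
  "\<phi> \<in> l2_fun square \<Longrightarrow> - l2vec \<phi> = l2vec (\<lambda>x. - \<phi> x)"
  "\<phi> \<in> l2_fun square \<Longrightarrow> \<psi> \<in> l2_fun square \<Longrightarrow> l2vec \<phi> - l2vec \<psi> = l2vec (\<lambda>x. \<phi> x - \<psi> x)"
  "\<phi> \<in> l2_fun square \<Longrightarrow> r *\<^sub>R l2vec \<phi> = l2vec (\<lambda>x. of_real r * \<phi> x)"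
  "\<phi> \<in> l2_fun square \<Longrightarrow> \<psi> \<in> l2_fun square \<Longrightarrow>
    inner (l2vec \<phi>) (l2vec \<psi>) = (\<integral>x. inner (\<phi> x) (\<psi> x) \<partial>square)"
  by (simp_all add: plus_square_l2.abs_eq uminus_square_l2.abs_eq minus_square_l2.abs_eq
      scaleR_square_l2.abs_eq inner_square_l2.abs_eq l2_rel_refl)

instance
proof
  fix a b c :: square_l2 and r s :: real
  obtain \<phi> where \<phi>: "\<phi> \<in> l2_fun square" "a = l2vec \<phi>" by (rule l2vec_cases)
  obtain \<psi> where \<psi>: "\<psi> \<in> l2_fun square" "b = l2vec \<psi>" by (rule l2vec_cases)
  obtain \<theta> where \<theta>: "\<theta> \<in> l2_fun square" "c = l2vec \<theta>" by (rule l2vec_cases)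
  note simps = \<phi> \<psi> \<theta> l2vec_simps l2_fun_add l2_fun_scale l2_fun_minus l2_fun_diff l2_fun_zero zero_square_l2_def
  show "a + b + c = a + (b + c)" "a + b = b + a" "0 + a = a" "- a + a = 0" "a - b = a + - b"
    "r *\<^sub>R (a + b) = r *\<^sub>R a + r *\<^sub>R b" "(r + s) *\<^sub>R a = r *\<^sub>R a + s *\<^sub>R a"
    "r *\<^sub>R s *\<^sub>R a = (r * s) *\<^sub>R a" "1 *\<^sub>R a = a"
    by (simp_all add: simps algebra_simps)
  show "dist a b = norm (a - b)" "sgn a = inverse (norm a) *\<^sub>R a" "norm a = sqrt (inner a a)"
    "uniformity = (INF e\<in>{0<..}. principal {(x, y :: square_l2). dist x y < e})"
    by (rule dist_square_l2_def sgn_square_l2_def uniformity_square_l2_def norm_square_l2_def)+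
  show "open U \<longleftrightarrow> (\<forall>x\<in>U. \<forall>\<^sub>F (x', y) in uniformity. x' = x \<longrightarrow> y \<in> U)" for U :: "square_l2 set"
    by (rule open_square_l2_def)
  show "inner a b = inner b a" by (simp add: simps inner_commute)
  show "inner (a + b) c = inner a c + inner b c"
    by (simp add: simps inner_add_left l2_fun_integrable_inner)
  have "inner (of_real r * z) w = r * inner z w" for z w :: complex
    by (simp flip: scaleR_conv_of_real)
  then show "inner (r *\<^sub>R a) b = r * inner a b" by (simp add: simps)
  show "0 \<le> inner a a" by (simp add: simps)
  have "inner a a = 0 \<longleftrightarrow> (AE x in square. inner (\<phi> x) (\<phi> x) = 0)"
    using \<phi>(1) by (simp only: \<phi>(2) l2vec_simps, intro integral_nonneg_eq_0_iff_AE)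
      (auto intro: l2_fun_integrable_inner)
  then show "inner a a = 0 \<longleftrightarrow> a = 0"
    by (simp add: \<phi> zero_square_l2_def l2vec_eq_iff l2_fun_zero)
qed
end

lemma norm_l2vec_diff:
  assumes "\<phi> \<in> l2_fun square" "\<psi> \<in> l2_fun square"
  shows "(norm (l2vec \<phi> - l2vec \<psi>))\<^sup>2 = (\<integral>x. (cmod (\<phi> x - \<psi> x))\<^sup>2 \<partial>square)"
  using assms by (simp add: power2_norm_eq_inner l2vec_simps l2_fun_diff)

instantiation square_l2 :: complex_hilbert
begin
lift_definition imul_square_l2 :: "square_l2 \<Rightarrow> square_l2" is "\<lambda>\<phi> x. \<i> * \<phi> x"
  by (auto simp: l2_rel_def intro: l2_fun_scale elim: AE_mp)

lemma imul_l2vec: "\<phi> \<in> l2_fun square \<Longrightarrow> imul (l2vec \<phi>) = l2vec (\<lambda>x. \<i> * \<phi> x)"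
  by (simp add: imul_square_l2.abs_eq l2_rel_refl)

instance
proof
  fix a b :: square_l2 and r :: real
  obtain \<phi> where \<phi>: "\<phi> \<in> l2_fun square" "a = l2vec \<phi>" by (rule l2vec_cases)
  obtain \<psi> where \<psi>: "\<psi> \<in> l2_fun square" "b = l2vec \<psi>" by (rule l2vec_cases)
  note simps = \<phi> \<psi> l2vec_simps l2_fun_add l2_fun_scale l2_fun_minus imul_l2vec
  show "imul (a + b) = imul a + imul b" "imul (r *\<^sub>R a) = r *\<^sub>R imul a" "imul (imul a) = - a"
    by (simp_all add: simps algebra_simps)
  show "inner (imul a) (imul b) = inner a b"
    by (simp add: simps) (simp add: inner_complex_def add.commute)
next
  fix X :: "nat \<Rightarrow> square_l2"
  assume X: "Cauchy X"
  have "\<exists>\<phi>. \<phi> \<in> l2_fun square \<and> X n = l2vec \<phi>" for n by (metis l2vec_cases)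
  then obtain \<phi> where \<phi>: "\<And>n. \<phi> n \<in> l2_fun square" "\<And>n. X n = l2vec (\<phi> n)" by metis
  have "\<exists>N. \<forall>m\<ge>N. \<forall>n\<ge>N. (\<integral>x. (cmod (\<phi> m x - \<phi> n x))\<^sup>2 \<partial>square) < e" if "e > 0" for e
  proof -
    have "sqrt e > 0" using that by simp
    then obtain N where N: "\<And>m n. m \<ge> N \<Longrightarrow> n \<ge> N \<Longrightarrow> dist (X m) (X n) < sqrt e"
      using metric_CauchyD[OF X] by blast
    have "(norm (X m - X n))\<^sup>2 < e" if "m \<ge> N" "n \<ge> N" for m n
      using power_strict_mono[OF N[OF that], of 2] \<open>e > 0\<close> by (simp add: dist_norm)
    then show ?thesis unfolding \<phi>(2) norm_l2vec_diff[OF \<phi>(1) \<phi>(1)] by blast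
  qed
  from this obtain \<psi> where \<psi>: "\<psi> \<in> l2_fun square" "(\<lambda>n. \<integral>x. (cmod (\<phi> n x - \<psi> x))\<^sup>2 \<partial>square) \<longlonglongrightarrow> 0"
    by (rule l2_complete[of \<phi> square, OF \<phi>(1)])
  have "(\<lambda>n. (norm (X n - l2vec \<psi>))\<^sup>2) \<longlonglongrightarrow> 0"
    using \<psi> by (simp only: \<phi> norm_l2vec_diff)
  then have "(\<lambda>n. sqrt ((norm (X n - l2vec \<psi>))\<^sup>2)) \<longlonglongrightarrow> sqrt 0" by (rule tendsto_real_sqrt)
  then have "(\<lambda>n. X n - l2vec \<psi>) \<longlonglongrightarrow> 0" by (simp add: tendsto_norm_zero_iff)
  then have "X \<longlonglongrightarrow> l2vec \<psi>" by (rule LIM_zero_cancel)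
  then show "convergent X" by (auto simp: convergent_def)
qed
end

subsection \<open>Classes of functions\<close>

lift_definition class_of :: "square_l2 \<Rightarrow> (real \<times> real \<Rightarrow> complex) set" is "l2_class square"
  by (rule l2_class_cong) (simp add: l2_rel_def)

lemma class_of_l2vec: "\<phi> \<in> l2_fun square \<Longrightarrow> class_of (l2vec \<phi>) = l2_class square \<phi>"
  by (simp add: class_of.abs_eq l2_rel_refl)

lemma bij_class_of: "bij_betw class_of UNIV (l2 square)"
  unfolding bij_betw_def
proof
  show "inj class_of"
  proof (rule injI)
    fix a b
    assume "class_of a = class_of b"
    then show "a = b"
      by (cases a rule: l2vec_cases; cases b rule: l2vec_cases)
        (simp add: class_of_l2vec l2_class_eq_iff l2vec_eq_iff)
  qed
  have "class_of a \<in> l2 square" for a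
    by (cases a rule: l2vec_cases) (auto simp: class_of_l2vec l2_def)
  moreover have "A \<in> range class_of" if "A \<in> l2 square" for A
    using that unfolding l2_def by (auto simp: class_of_l2vec[symmetric])
  ultimately show "range class_of = l2 square" by blast
qed

lemma l2_add_class_of: "l2_add square (class_of a) (class_of b) = class_of (a + b)"
  by (cases a rule: l2vec_cases; cases b rule: l2vec_cases)
    (simp add: class_of_l2vec l2_add_class l2vec_simps l2_fun_add)

lemma cscale_l2vec: "\<phi> \<in> l2_fun square \<Longrightarrow> cscale c (l2vec \<phi>) = l2vec (\<lambda>x. c * \<phi> x)"
proof -
  assume \<phi>: "\<phi> \<in> l2_fun square"
  have "of_real (Re c) * \<phi> x + of_real (Im c) * (\<i> * \<phi> x) = c * \<phi> x" for x
    by (simp add: complex_eq_iff)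
  then show ?thesis
    using \<phi> by (simp add: cscale_def imul_l2vec l2vec_simps l2_fun_scale l2_fun_add)
qed

lemma l2_scale_class_of: "l2_scale square c (class_of a) = class_of (cscale c a)"
  by (cases a rule: l2vec_cases) (simp add: class_of_l2vec l2_scale_class cscale_l2vec l2_fun_scale)

text \<open>The complex inner product is recovered from the real one: its imaginary part is the real
  inner product with \<open>imul b\<close>.\<close>

lemma l2_inner_class_of:
  "l2_inner square (class_of a) (class_of b) = Complex (inner a b) (inner a (imul b))"
proof -
  obtain \<phi> where \<phi>: "\<phi> \<in> l2_fun square" "a = l2vec \<phi>" by (rule l2vec_cases)
  obtain \<psi> where \<psi>: "\<psi> \<in> l2_fun square" "b = l2vec \<psi>" by (rule l2vec_cases)
  have "integrable square (\<lambda>x. \<phi> x * cnj (\<psi> x))"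
    using \<phi> \<psi> by (intro l2_fun_integrable_product)
  then have "(\<integral>x. \<phi> x * cnj (\<psi> x) \<partial>square)
      = Complex (\<integral>x. Re (\<phi> x * cnj (\<psi> x)) \<partial>square) (\<integral>x. Im (\<phi> x * cnj (\<psi> x)) \<partial>square)"
    by (simp only: complex_eq_iff complex.sel integral_Re integral_Im)
  then show ?thesis
    using \<phi> \<psi> by (simp add: class_of_l2vec l2_inner_class imul_l2vec l2vec_simps l2_fun_scale inner_complex_def)
qed

lemma l2_norm_class_of: "l2_norm square (class_of a) = norm a"
proof -
  have l2: "class_of a \<in> l2 square" using bij_class_of by (auto simp: bij_betw_def)
  obtain \<phi> where \<phi>: "\<phi> \<in> l2_fun square" "a = l2vec \<phi>" by (rule l2vec_cases)
  define \<psi> where "\<psi> = l2_rep (class_of a)"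
  have \<psi>: "\<psi> \<in> l2_fun square" "AE x in square. \<psi> x = \<phi> x"
    using l2_rep_AE[OF \<phi>(1)] by (simp_all add: \<psi>_def \<phi> class_of_l2vec)
  then have "a = l2vec \<psi>" using \<phi> by (simp add: l2vec_eq_iff) (auto elim: AE_mp)
  then have "norm a = sqrt (\<integral>x. inner (\<psi> x) (\<psi> x) \<partial>square)"
    using \<psi>(1) by (simp add: norm_eq_sqrt_inner l2vec_simps)
  then show ?thesis by (simp add: l2_norm_def \<psi>_def[symmetric] power2_norm_eq_inner)
qed

section \<open>Changes of variables for Lebesgue measure\<close>

lemma complete_measure_lebesgue_on:
  assumes "X \<in> sets lebesgue"
  shows "complete_measure (lebesgue_on X)"
proof
  fix A B
  assume "B \<subseteq> A" "A \<in> null_sets (lebesgue_on X)"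
  then have "A \<in> null_sets lebesgue" "A \<subseteq> X"
    using assms by (auto simp: null_sets_restrict_space)
  then have "B \<in> sets lebesgue" using completion.complete[OF \<open>B \<subseteq> A\<close>] by simp
  then show "B \<in> sets (lebesgue_on X)"
    using assms \<open>B \<subseteq> A\<close> \<open>A \<subseteq> X\<close> by (simp add: sets_restrict_space_iff)
qed

text \<open>A formula on Borel sets suffices. It shows that preimages of null Borel sets are null,
  and completeness of the domain then handles every Lebesgue set, which is Borel up to a null
  set.\<close>

lemma distr_lebesgue_on_lebesgue:
  fixes f :: "'a::euclidean_space \<Rightarrow> 'b::euclidean_space"
  assumes f: "f \<in> borel_measurable borel" and X: "X \<in> sets borel" and d: "d \<in> borel_measurable borel"
    and eq: "\<And>A. A \<in> sets borel \<Longrightarrow> emeasure lborel (f -` A \<inter> X) = (\<integral>\<^sup>+q. d q * indicator A q \<partial>lborel)"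
  shows "f \<in> lebesgue_on X \<rightarrow>\<^sub>M lebesgue" "distr (lebesgue_on X) lebesgue f = density lebesgue d"
proof -
  have XL: "X \<in> sets lebesgue" using X by simp
  interpret complete_measure "lebesgue_on X" by (rule complete_measure_lebesgue_on[OF XL])
  have em: "emeasure (lebesgue_on X) (f -` A \<inter> X) = (\<integral>\<^sup>+q. d q * indicator A q \<partial>lborel)"
    if "A \<in> sets borel" for A
  proof -
    have "f -` A \<inter> X \<in> sets borel"
      using that X measurable_sets[OF f that] by auto
    then show ?thesis using eq[OF that] XL
      by (simp add: emeasure_restrict_space emeasure_completion)
  qed
  have fm: "f \<in> lebesgue_on X \<rightarrow>\<^sub>M lborel"
    using f by (intro measurable_restrict_space1 measurable_completion) simp
  have null: "null_sets lborel \<subseteq> null_sets (distr (lebesgue_on X) lborel f)"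
  proof
    fix N :: "'b set"
    assume N: "N \<in> null_sets lborel"
    then have "AE q in lborel. q \<notin> N" by (rule AE_not_in)
    then have "(\<integral>\<^sup>+q. d q * indicator N q \<partial>lborel) = (\<integral>\<^sup>+q. 0 \<partial>(lborel :: 'b measure))"
      by (intro nn_integral_cong_AE) (auto elim!: eventually_mono)
    then have "emeasure (distr (lebesgue_on X) lborel f) N = 0"
      using N fm em[of N] by (simp add: emeasure_distr null_sets_def)
    then show "N \<in> null_sets (distr (lebesgue_on X) lborel f)"
      using N by (auto simp: null_sets_def)
  qed
  show fL: "f \<in> lebesgue_on X \<rightarrow>\<^sub>M lebesgue"
    using fm null by (rule measurable_completion2)
  show "distr (lebesgue_on X) lebesgue f = density lebesgue d"
  proof (rule measure_eqI)
    fix A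
    assume "A \<in> sets (distr (lebesgue_on X) lebesgue f)"
    then have A: "A \<in> sets lebesgue" by simp
    \<comment> \<open>Borel part and negligible part of A; only the first contributes to the measure
      of the preimage.\<close>
    have B: "main_part lborel A \<in> sets borel" using main_part_sets[OF A] by simp
    have "emeasure (distr (lebesgue_on X) lebesgue f) A = emeasure (lebesgue_on X) (f -` A \<inter> X)"
      using A fL by (simp add: emeasure_distr)
    also have "f -` A \<inter> X = (f -` main_part lborel A \<inter> X) \<union> (f -` null_part lborel A \<inter> X)"
      using main_part_null_part_Un[OF A] by auto
    also have "emeasure (lebesgue_on X) \<dots> = emeasure (lebesgue_on X) (f -` main_part lborel A \<inter> X)"
      using vimage_null_part_null_sets[OF fm null A] measurable_sets[OF fm, of "main_part lborel A"] B
      by (intro emeasure_Un_null_set) simp_all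
    also have "\<dots> = (\<integral>\<^sup>+q. d q * indicator (main_part lborel A) q \<partial>lborel)" by (rule em[OF B])
    also have "\<dots> = (\<integral>\<^sup>+q. d q * indicator A q \<partial>lborel)"
      using AE_in_main_part[OF A] by (intro nn_integral_cong_AE) (auto elim!: eventually_mono split: split_indicator)
    also have "\<dots> = emeasure (density lebesgue d) A"
      using A d by (simp add: emeasure_density measurable_completion nn_integral_completion)
    finally show "emeasure (distr (lebesgue_on X) lebesgue f) A = emeasure (density lebesgue d) A" .
  qed simp
qed

lemma distr_lebesgue_on:
  fixes f :: "'a::euclidean_space \<Rightarrow> 'b::euclidean_space"
  assumes f: "f \<in> borel_measurable borel" and X: "X \<in> sets borel" and Y: "Y \<in> sets borel"
    and d: "d \<in> borel_measurable borel" and fXY: "f \<in> X \<rightarrow> Y"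
    and eq: "\<And>A. A \<in> sets borel \<Longrightarrow>
      emeasure lborel (f -` A \<inter> X) = (\<integral>\<^sup>+q. d q * indicator Y q * indicator A q \<partial>lborel)"
  shows "f \<in> lebesgue_on X \<rightarrow>\<^sub>M lebesgue_on Y" "distr (lebesgue_on X) (lebesgue_on Y) f = density (lebesgue_on Y) d"
proof -
  have dY: "(\<lambda>q. d q * indicator Y q) \<in> borel_measurable borel" using d Y by measurable
  note * = distr_lebesgue_on_lebesgue[OF f X dY eq]
  show m: "f \<in> lebesgue_on X \<rightarrow>\<^sub>M lebesgue_on Y"
    using *(1) fXY by (intro measurable_restrict_space2) simp_all
  have YL: "Y \<in> sets lebesgue" using Y by simp
  have dL: "d \<in> borel_measurable lebesgue" using d by (intro measurable_completion) simp
  show "distr (lebesgue_on X) (lebesgue_on Y) f = density (lebesgue_on Y) d"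
  proof (rule measure_eqI)
    fix A
    assume "A \<in> sets (distr (lebesgue_on X) (lebesgue_on Y) f)"
    then have AY: "A \<in> sets (lebesgue_on Y)" by simp
    then have A: "A \<in> sets lebesgue" "A \<subseteq> Y" using YL by (auto simp: sets_restrict_space_iff)
    have "emeasure (distr (lebesgue_on X) (lebesgue_on Y) f) A = emeasure (distr (lebesgue_on X) lebesgue f) A"
      using A AY m *(1) by (simp add: emeasure_distr)
    also have "\<dots> = (\<integral>\<^sup>+q. d q * indicator Y q * indicator A q \<partial>lebesgue)"
      using A dY by (subst *(2)) (auto intro!: emeasure_density measurable_completion)
    also have "\<dots> = (\<integral>\<^sup>+q. d q * indicator A q \<partial>lebesgue_on Y)"
      using YL by (subst nn_integral_restrict_space) (auto intro!: nn_integral_cong split: split_indicator)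
    also have "\<dots> = emeasure (density (lebesgue_on Y) d) A"
      using AY dL by (intro emeasure_density[symmetric] measurable_restrict_space1)
    finally show "emeasure (distr (lebesgue_on X) (lebesgue_on Y) f) A = emeasure (density (lebesgue_on Y) d) A" .
  qed simp
qed

text \<open>\<phi> is the density of the image under a of Lebesgue measure on I. The formula is
  stated for integrals of arbitrary k because k will be an inner integral when two coordinates are
  combined.\<close>

definition subst_density :: "(real \<Rightarrow> real) \<Rightarrow> real set \<Rightarrow> (real \<Rightarrow> ennreal) \<Rightarrow> bool" where
  "subst_density a I \<phi> \<longleftrightarrow> a \<in> borel_measurable borel \<and> I \<in> sets borel \<and> \<phi> \<in> borel_measurable borel \<and>
     (\<forall>k\<in>borel_measurable borel. (\<integral>\<^sup>+x. k (a x) * indicator I x \<partial>lborel) = (\<integral>\<^sup>+u. k u * \<phi> u \<partial>lborel))"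

lemma subst_densityD:
  "subst_density a I \<phi> \<Longrightarrow> k \<in> borel_measurable borel \<Longrightarrow>
    (\<integral>\<^sup>+x. k (a x) * indicator I x \<partial>lborel) = (\<integral>\<^sup>+u. k u * \<phi> u \<partial>lborel)"
  unfolding subst_density_def by blast

lemma subst_densityI:
  assumes [measurable]: "a \<in> borel_measurable borel" "I \<in> sets borel" "\<phi> \<in> borel_measurable borel"
    and eq: "\<And>A. A \<in> sets borel \<Longrightarrow>
      (\<integral>\<^sup>+x. indicator A (a x) * indicator I x \<partial>lborel) = (\<integral>\<^sup>+u. indicator A u * \<phi> u \<partial>lborel)"
  shows "subst_density a I \<phi>"
  unfolding subst_density_def
proof (intro conjI ballI assms(1-3))
  fix k :: "real \<Rightarrow> ennreal"
  assume [measurable]: "k \<in> borel_measurable borel"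
  have "distr (density lborel (indicator I)) borel a = density lborel \<phi>"
  proof (rule measure_eqI)
    fix A :: "real set"
    assume "A \<in> sets (distr (density lborel (indicator I)) borel a)"
    then have [measurable]: "A \<in> sets borel" by simp
    have "emeasure (distr (density lborel (indicator I)) borel a) A
        = (\<integral>\<^sup>+x. indicator I x * indicator (a -` A) x \<partial>lborel)"
      using measurable_sets[OF assms(1), of A] by (simp add: emeasure_distr emeasure_density)
    also have "\<dots> = (\<integral>\<^sup>+x. indicator A (a x) * indicator I x \<partial>lborel)"
      by (intro nn_integral_cong) (auto split: split_indicator)
    also have "\<dots> = (\<integral>\<^sup>+u. indicator A u * \<phi> u \<partial>lborel)" by (rule eq) measurable
    also have "\<dots> = emeasure (density lborel \<phi>) A"
      by (simp add: emeasure_density mult.commute)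
    finally show "emeasure (distr (density lborel (indicator I)) borel a) A = emeasure (density lborel \<phi>) A" .
  qed simp
  then have "(\<integral>\<^sup>+u. k u \<partial>distr (density lborel (indicator I)) borel a) = (\<integral>\<^sup>+u. k u \<partial>density lborel \<phi>)" by simp
  then show "(\<integral>\<^sup>+x. k (a x) * indicator I x \<partial>lborel) = (\<integral>\<^sup>+u. k u * \<phi> u \<partial>lborel)"
    by (simp add: nn_integral_distr nn_integral_density mult.commute)
qed

section \<open>Densities of the coordinate maps and of their products\<close>

lemma subst_density_square: "subst_density (\<lambda>x. x\<^sup>2) {0..1} (\<lambda>u. ennreal (1 / (2 * sqrt u)) * indicator {0..1} u)"
proof (rule subst_densityI)
  fix A :: "real set"
  assume [measurable]: "A \<in> sets borel"
  have "(\<integral>\<^sup>+u. indicator A u * (ennreal (1 / (2 * sqrt u)) * indicator {0..1} u) \<partial>lborel)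
      = (\<integral>\<^sup>+u. ennreal (indicator A u / (2 * sqrt u) * indicator {0\<^sup>2..1\<^sup>2} u) \<partial>lborel)"
    by (intro nn_integral_cong) (auto split: split_indicator)
  also have "\<dots> = (\<integral>\<^sup>+x. ennreal (indicator A (x\<^sup>2) / (2 * sqrt (x\<^sup>2)) * (2 * x) * indicator {0..1} x) \<partial>lborel)"
  proof (rule nn_integral_substitution)
    show "set_borel_measurable borel {0\<^sup>2..1\<^sup>2} (\<lambda>u::real. indicator A u / (2 * sqrt u))"
      unfolding set_borel_measurable_def by measurable
  qed (auto intro!: derivative_eq_intros continuous_intros)
  also have "\<dots> = (\<integral>\<^sup>+x. indicator A (x\<^sup>2) * indicator {0..1} x \<partial>lborel)"
  proof (rule nn_integral_cong_AE)
    show "AE x in lborel. ennreal (indicator A (x\<^sup>2) / (2 * sqrt (x\<^sup>2)) * (2 * x) * indicator {0..1} x)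
        = indicator A (x\<^sup>2) * (indicator {0..1} x :: ennreal)"
      \<comment> \<open>At x = 0 the quotient is 0 by the convention for division, not 1, so this
        point is discarded.\<close>
      using AE_lborel_singleton[of "0::real"]
      by eventually_elim (auto split: split_indicator)
  qed
  finally show "(\<integral>\<^sup>+x. indicator A (x\<^sup>2) * indicator {0..1} x \<partial>lborel)
      = (\<integral>\<^sup>+u. indicator A u * (ennreal (1 / (2 * sqrt u)) * indicator {0..1} u) \<partial>lborel)" by simp
qed measurable

lemma subst_density_sqrt: "subst_density sqrt {0..1} (\<lambda>u. ennreal (2 * u) * indicator {0..1} u)"
proof (rule subst_densityI)
  fix A :: "real set"
  assume [measurable]: "A \<in> sets borel"
  have "(\<integral>\<^sup>+x. indicator A (sqrt x) * indicator {0..1} x \<partial>lborel)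
      = (\<integral>\<^sup>+x. ennreal (indicator A (sqrt x) * indicator {0\<^sup>2..1\<^sup>2} x) \<partial>lborel)"
    by (intro nn_integral_cong) (auto split: split_indicator)
  also have "\<dots> = (\<integral>\<^sup>+x. ennreal (indicator A (sqrt (x\<^sup>2)) * (2 * x) * indicator {0..1} x) \<partial>lborel)"
  proof (rule nn_integral_substitution)
    show "set_borel_measurable borel {0\<^sup>2..1\<^sup>2} (\<lambda>u. indicator A (sqrt u) :: real)"
      unfolding set_borel_measurable_def by measurable
  qed (auto intro!: derivative_eq_intros continuous_intros)
  also have "\<dots> = (\<integral>\<^sup>+x. indicator A x * (ennreal (2 * x) * indicator {0..1} x) \<partial>lborel)"
    by (intro nn_integral_cong) (auto split: split_indicator)
  finally show "(\<integral>\<^sup>+x. indicator A (sqrt x) * indicator {0..1} x \<partial>lborel)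
      = (\<integral>\<^sup>+x. indicator A x * (ennreal (2 * x) * indicator {0..1} x) \<partial>lborel)" .
qed measurable

lemma subst_density_affine:
  assumes c: "c > 0"
  shows "subst_density (\<lambda>x. t + c * x) {l..u} (\<lambda>v. ennreal (1 / c) * indicator {t + c * l..t + c * u} v)"
proof (rule subst_densityI)
  fix A :: "real set"
  assume [measurable]: "A \<in> sets borel"
  have "(\<integral>\<^sup>+v. indicator A v * (ennreal (1 / c) * indicator {t + c * l..t + c * u} v) \<partial>lborel)
     = \<bar>c\<bar> * (\<integral>\<^sup>+x. indicator A (t + c * x) * (ennreal (1 / c) * indicator {t + c * l..t + c * u} (t + c * x)) \<partial>lborel)"
    using c by (intro nn_integral_real_affine) auto
  also have "\<dots> = (\<integral>\<^sup>+x. ennreal c * (indicator A (t + c * x) * (ennreal (1 / c) * indicator {t + c * l..t + c * u} (t + c * x))) \<partial>lborel)"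
    using c by (simp add: nn_integral_cmult)
  also have "\<dots> = (\<integral>\<^sup>+x. indicator A (t + c * x) * indicator {l..u} x \<partial>lborel)"
  proof (intro nn_integral_cong)
    have "ennreal c * ennreal (1 / c) = 1" using c by (simp flip: ennreal_mult)
    then show "ennreal c * (indicator A (t + c * x) * (ennreal (1 / c) * indicator {t + c * l..t + c * u} (t + c * x)))
        = indicator A (t + c * x) * indicator {l..u} x" for x
      using c by (auto split: split_indicator)
  qed
  finally show "(\<integral>\<^sup>+x. indicator A (t + c * x) * indicator {l..u} x \<partial>lborel)
      = (\<integral>\<^sup>+v. indicator A v * (ennreal (1 / c) * indicator {t + c * l..t + c * u} v) \<partial>lborel)" by simp
qed measurable

text \<open>Tonelli reduces to one coordinate at a time: substitute in the inner integral for fixed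
  x, then treat the result as a function of a x and substitute again.\<close>

lemma subst_density_prod:
  assumes a: "subst_density a I \<phi>" and b: "subst_density b J \<psi>" and [measurable]: "A \<in> sets borel"
  shows "emeasure lborel ((\<lambda>p. (a (fst p), b (snd p))) -` A \<inter> I \<times> J)
    = (\<integral>\<^sup>+q. \<phi> (fst q) * \<psi> (snd q) * indicator A q \<partial>lborel)"
proof -
  have [measurable]: "a \<in> borel_measurable borel" "I \<in> sets borel" "\<phi> \<in> borel_measurable borel"
    "b \<in> borel_measurable borel" "J \<in> sets borel" "\<psi> \<in> borel_measurable borel"
    using a b by (auto simp: subst_density_def)
  have A': "A \<in> sets (borel \<Otimes>\<^sub>M borel)" using assms(3) unfolding borel_prod .
  have [measurable]: "(\<lambda>v. indicator A (u, v) :: ennreal) \<in> borel_measurable borel" for u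
    using A' by measurable
  let ?f = "\<lambda>p. (a (fst p), b (snd p))"
  have f: "?f \<in> borel \<rightarrow>\<^sub>M borel" unfolding borel_prod[symmetric] by measurable
  have IJ: "I \<times> J \<in> sets borel" unfolding borel_prod[symmetric] by measurable
  have "emeasure lborel (?f -` A \<inter> I \<times> J) = (\<integral>\<^sup>+p. indicator (?f -` A \<inter> I \<times> J) p \<partial>lborel)"
    using measurable_sets[OF f, of A] IJ by (subst nn_integral_indicator) auto
  also have "\<dots> = (\<integral>\<^sup>+p. indicator A (?f p) * indicator I (fst p) * indicator J (snd p) \<partial>(lborel \<Otimes>\<^sub>M lborel))"
    unfolding lborel_prod by (intro nn_integral_cong) (auto split: split_indicator)
  also have "\<dots> = (\<integral>\<^sup>+x. \<integral>\<^sup>+y. indicator A (a x, b y) * indicator I x * indicator J y \<partial>lborel \<partial>lborel)"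
  proof -
    have "(\<lambda>p. indicator A (?f p) * indicator I (fst p) * indicator J (snd p) :: ennreal)
        \<in> borel_measurable (lborel \<Otimes>\<^sub>M lborel)"
      using A' by measurable
    from lborel.nn_integral_fst[OF this] show ?thesis by simp
  qed
  also have "\<dots> = (\<integral>\<^sup>+x. (\<integral>\<^sup>+v. indicator A (a x, v) * \<psi> v \<partial>lborel) * indicator I x \<partial>lborel)"
  proof (rule nn_integral_cong)
    fix x :: real
    have "(\<integral>\<^sup>+y. indicator A (a x, b y) * indicator I x * indicator J y \<partial>lborel)
        = (\<integral>\<^sup>+y. indicator A (a x, b y) * indicator J y * indicator I x \<partial>lborel)"
      by (simp add: mult_ac)
    also have "\<dots> = (\<integral>\<^sup>+y. indicator A (a x, b y) * indicator J y \<partial>lborel) * indicator I x"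
      by (rule nn_integral_multc) measurable
    also have "(\<integral>\<^sup>+y. indicator A (a x, b y) * indicator J y \<partial>lborel) = (\<integral>\<^sup>+v. indicator A (a x, v) * \<psi> v \<partial>lborel)"
      by (rule subst_densityD[OF b, of "\<lambda>v. indicator A (a x, v)"]) measurable
    finally show "(\<integral>\<^sup>+y. indicator A (a x, b y) * indicator I x * indicator J y \<partial>lborel)
        = (\<integral>\<^sup>+v. indicator A (a x, v) * \<psi> v \<partial>lborel) * indicator I x" .
  qed
  also have "\<dots> = (\<integral>\<^sup>+u. (\<integral>\<^sup>+v. indicator A (u, v) * \<psi> v \<partial>lborel) * \<phi> u \<partial>lborel)"
  proof -
    have "(\<lambda>u. \<integral>\<^sup>+v. indicator A (u, v) * \<psi> v \<partial>lborel) \<in> borel_measurable borel"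
      using A' by measurable
    then show ?thesis by (rule subst_densityD[OF a])
  qed
  also have "\<dots> = (\<integral>\<^sup>+u. \<integral>\<^sup>+v. \<phi> u * \<psi> v * indicator A (u, v) \<partial>lborel \<partial>lborel)"
    by (subst nn_integral_multc[symmetric]) (auto simp: mult_ac)
  also have "\<dots> = (\<integral>\<^sup>+q. \<phi> (fst q) * \<psi> (snd q) * indicator A q \<partial>(lborel \<Otimes>\<^sub>M lborel))"
  proof -
    have "(\<lambda>q. \<phi> (fst q) * \<psi> (snd q) * indicator A q) \<in> borel_measurable (lborel \<Otimes>\<^sub>M lborel)"
      using A' by measurable
    from lborel.nn_integral_fst[OF this] show ?thesis by simp
  qed
  finally show ?thesis by (simp add: lborel_prod)
qed

section \<open>Weighted composition operators\<close>

text \<open>f is a bijection of the space onto R with inverse g and d is the Jacobian of g.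
  \<open>push\<close> is then an isometry of L^2 onto the functions supported in R, and
  \<open>pull\<close> is its adjoint.\<close>

locale weighted_map =
  fixes M :: "'x measure" and R :: "'x set" and f g :: "'x \<Rightarrow> 'x" and d :: "'x \<Rightarrow> real"
  assumes R: "R \<in> sets M"
    and f: "f \<in> M \<rightarrow>\<^sub>M restrict_space M R"
    and g: "g \<in> restrict_space M R \<rightarrow>\<^sub>M M"
    and gf: "p \<in> space M \<Longrightarrow> g (f p) = p"
    and fg: "q \<in> R \<Longrightarrow> f (g q) = q"
    and d: "d \<in> borel_measurable M" and d_nonneg: "q \<in> R \<Longrightarrow> 0 \<le> d q"
    and d_pos: "AE q in M. q \<in> R \<longrightarrow> 0 < d q"
    and distr_f: "distr M (restrict_space M R) f = density (restrict_space M R) (\<lambda>q. ennreal (d q))"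
begin

definition push :: "('x \<Rightarrow> complex) \<Rightarrow> 'x \<Rightarrow> complex" where
  "push \<phi> q = (if q \<in> R then of_real (sqrt (d q)) * \<phi> (g q) else 0)"

definition pull :: "('x \<Rightarrow> complex) \<Rightarrow> 'x \<Rightarrow> complex" where
  "pull \<phi> p = \<phi> (f p) / of_real (sqrt (d (f p)))"

lemma space_R: "space (restrict_space M R) = R"
  using sets.sets_into_space[OF R] by (auto simp: space_restrict_space)

lemma R_Int: "R \<inter> space M \<in> sets M" "R \<inter> space M = R"
  using sets.sets_into_space[OF R] R by (auto simp: Int_absorb2)

lemma f_in_R: "p \<in> space M \<Longrightarrow> f p \<in> R"
  using measurable_space[OF f] by (simp add: space_R)

lemma d_restrict [measurable]: "d \<in> borel_measurable (restrict_space M R)"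
  using d by (rule measurable_restrict_space1)

lemma f_measurable: "f \<in> M \<rightarrow>\<^sub>M M"
  using f by (simp add: measurable_restrict_space2_iff)

lemma nn_integral_map:
  assumes [measurable]: "h \<in> borel_measurable (restrict_space M R)"
  shows "(\<integral>\<^sup>+p. h (f p) \<partial>M) = (\<integral>\<^sup>+q. ennreal (d q) * h q \<partial>restrict_space M R)"
  using arg_cong[OF distr_f, of "\<lambda>N. nn_integral N h"] f
  by (simp add: nn_integral_distr nn_integral_density)

text \<open>The density d is positive almost everywhere on R, so null sets correspond in both
  directions. This makes \<open>push\<close> and \<open>pull\<close> well defined on
  classes.\<close>

lemma AE_map_iff:
  assumes "Measurable.pred (restrict_space M R) P"
  shows "(AE p in M. P (f p)) \<longleftrightarrow> (AE q in restrict_space M R. P q)"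
proof -
  have "(AE p in M. P (f p)) \<longleftrightarrow> (AE q in density (restrict_space M R) (\<lambda>q. ennreal (d q)). P q)"
    unfolding distr_f[symmetric] using AE_distr_iff[OF f, of P] assms by (simp add: pred_def)
  also have "\<dots> \<longleftrightarrow> (AE q in restrict_space M R. 0 < ennreal (d q) \<longrightarrow> P q)"
    by (rule AE_density) measurable
  also have "\<dots> \<longleftrightarrow> (AE q in restrict_space M R. P q)"
  proof -
    have "AE q in restrict_space M R. 0 < d q"
      using d_pos by (simp add: AE_restrict_space_iff[OF R_Int(1)])
    then show ?thesis by (intro iffI; elim AE_mp) (auto intro!: AE_I2)
  qed
  finally show ?thesis .
qed

lemma AE_d_pos: "AE p in M. 0 < d (f p)"
proof -
  have "AE q in restrict_space M R. 0 < d q"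
    using d_pos by (simp add: AE_restrict_space_iff[OF R_Int(1)])
  then show ?thesis by (subst AE_map_iff[of "\<lambda>q. 0 < d q"]) auto
qed

lemma push_measurable:
  assumes [measurable]: "\<phi> \<in> borel_measurable M"
  shows "push \<phi> \<in> borel_measurable M"
proof -
  note [measurable] = g
  have "(\<lambda>q. of_real (sqrt (d q)) * \<phi> (g q)) \<in> borel_measurable (restrict_space M R)"
    by measurable
  then have "(\<lambda>q. of_real (sqrt (d q)) * \<phi> (g q)) \<in> borel_measurable (restrict_space M {q. q \<in> R})"
    by simp
  moreover have "{q \<in> space M. q \<in> R} \<in> sets M"
    using R_Int by (simp add: Int_def conj_commute)
  ultimately show ?thesis
    unfolding push_def[abs_def] by (subst measurable_If_restrict_space_iff) auto
qed

lemma pull_measurable: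
  assumes [measurable]: "\<phi> \<in> borel_measurable M"
  shows "pull \<phi> \<in> borel_measurable M"
  using f_measurable d unfolding pull_def[abs_def] by measurable

lemma push_cong:
  assumes "l2_rel M \<phi> \<psi>"
  shows "AE q in M. push \<phi> q = push \<psi> q"
proof -
  have [measurable]: "\<phi> \<in> borel_measurable M" "\<psi> \<in> borel_measurable M" and ae: "AE p in M. \<phi> p = \<psi> p"
    using assms by (auto simp: l2_rel_def l2_fun_def)
  note [measurable] = g
  have "AE p in M. \<phi> (g (f p)) = \<psi> (g (f p))"
    using ae by (rule AE_mp) (auto intro!: AE_I2 simp: gf)
  then have "AE q in restrict_space M R. \<phi> (g q) = \<psi> (g q)"
    by (subst (asm) AE_map_iff[of "\<lambda>q. \<phi> (g q) = \<psi> (g q)"]) measurable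
  then show ?thesis
    unfolding AE_restrict_space_iff[OF R_Int(1)] by (rule AE_mp) (auto intro!: AE_I2 simp: push_def)
qed

lemma pull_cong:
  assumes "l2_rel M \<phi> \<psi>"
  shows "AE p in M. pull \<phi> p = pull \<psi> p"
proof -
  have "AE q in M. \<phi> q = \<psi> q" and [measurable]: "\<phi> \<in> borel_measurable M" "\<psi> \<in> borel_measurable M"
    using assms by (auto simp: l2_rel_def l2_fun_def)
  then have "AE q in restrict_space M R. \<phi> q = \<psi> q"
    unfolding AE_restrict_space_iff[OF R_Int(1)] by (auto elim: AE_mp)
  moreover have [measurable]: "\<phi> \<in> borel_measurable (restrict_space M R)"
    "\<psi> \<in> borel_measurable (restrict_space M R)"
    by (auto intro: measurable_restrict_space1)
  have "Measurable.pred (restrict_space M R) (\<lambda>q. \<phi> q = \<psi> q)" by measurable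
  from AE_map_iff[OF this] calculation have "AE p in M. \<phi> (f p) = \<psi> (f p)" by simp
  then show ?thesis by (rule AE_mp) (auto intro!: AE_I2 simp: pull_def)
qed

lemma nn_integral_push:
  assumes [measurable]: "\<phi> \<in> borel_measurable M"
  shows "(\<integral>\<^sup>+q. ennreal ((cmod (push \<phi> q))\<^sup>2) \<partial>M) = (\<integral>\<^sup>+p. ennreal ((cmod (\<phi> p))\<^sup>2) \<partial>M)"
proof -
  note [measurable] = g
  have "(\<integral>\<^sup>+q. ennreal ((cmod (push \<phi> q))\<^sup>2) \<partial>M)
      = (\<integral>\<^sup>+q. ennreal (d q) * ennreal ((cmod (\<phi> (g q)))\<^sup>2) \<partial>restrict_space M R)"
    unfolding nn_integral_restrict_space[OF R_Int(1)]
    by (intro nn_integral_cong)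
      (auto simp: push_def norm_mult power_mult_distrib d_nonneg ennreal_mult split: split_indicator)
  also have "\<dots> = (\<integral>\<^sup>+p. ennreal ((cmod (\<phi> (g (f p))))\<^sup>2) \<partial>M)"
    by (rule nn_integral_map[symmetric]) measurable
  also have "\<dots> = (\<integral>\<^sup>+p. ennreal ((cmod (\<phi> p))\<^sup>2) \<partial>M)"
    by (intro nn_integral_cong) (simp add: gf)
  finally show ?thesis .
qed

text \<open>Only an inequality, since the part of \<phi> outside R is lost.\<close>

lemma nn_integral_pull:
  assumes [measurable]: "\<phi> \<in> borel_measurable M"
  shows "(\<integral>\<^sup>+p. ennreal ((cmod (pull \<phi> p))\<^sup>2) \<partial>M) \<le> (\<integral>\<^sup>+p. ennreal ((cmod (\<phi> p))\<^sup>2) \<partial>M)"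
proof -
  have [measurable]: "\<phi> \<in> borel_measurable (restrict_space M R)"
    by (auto intro: measurable_restrict_space1)
  have "(\<integral>\<^sup>+p. ennreal ((cmod (pull \<phi> p))\<^sup>2) \<partial>M)
      = (\<integral>\<^sup>+q. ennreal (d q) * ennreal ((cmod (\<phi> q / of_real (sqrt (d q))))\<^sup>2) \<partial>restrict_space M R)"
    unfolding pull_def by (rule nn_integral_map) measurable
  also have "\<dots> \<le> (\<integral>\<^sup>+q. ennreal ((cmod (\<phi> q))\<^sup>2) \<partial>restrict_space M R)"
  proof (rule nn_integral_mono)
    fix q
    assume "q \<in> space (restrict_space M R)"
    then have "0 \<le> d q" by (simp add: space_R d_nonneg)
    then have "d q * (cmod (\<phi> q / of_real (sqrt (d q))))\<^sup>2 \<le> (cmod (\<phi> q))\<^sup>2"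
      by (cases "d q = 0") (simp_all add: norm_divide power_divide)
    then show "ennreal (d q) * ennreal ((cmod (\<phi> q / of_real (sqrt (d q))))\<^sup>2) \<le> ennreal ((cmod (\<phi> q))\<^sup>2)"
      using \<open>0 \<le> d q\<close> by (simp flip: ennreal_mult add: ennreal_leI)
  qed
  also have "\<dots> \<le> (\<integral>\<^sup>+p. ennreal ((cmod (\<phi> p))\<^sup>2) \<partial>M)"
    unfolding nn_integral_restrict_space[OF R_Int(1)]
    by (intro nn_integral_mono) (auto split: split_indicator)
  finally show ?thesis .
qed

lemma l2_fun_iff: "\<phi> \<in> l2_fun M \<longleftrightarrow> \<phi> \<in> borel_measurable M \<and> (\<integral>\<^sup>+p. ennreal ((cmod (\<phi> p))\<^sup>2) \<partial>M) < \<infinity>"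
  unfolding l2_fun_def by (auto simp: integrable_iff_bounded)

lemma push_l2: "\<phi> \<in> l2_fun M \<Longrightarrow> push \<phi> \<in> l2_fun M"
  unfolding l2_fun_iff by (simp add: push_measurable nn_integral_push)

lemma pull_l2: "\<phi> \<in> l2_fun M \<Longrightarrow> pull \<phi> \<in> l2_fun M"
  unfolding l2_fun_iff using nn_integral_pull by (auto simp: pull_measurable intro: le_less_trans)

lemma integral_push:
  assumes "\<phi> \<in> l2_fun M"
  shows "(\<integral>q. (cmod (push \<phi> q))\<^sup>2 \<partial>M) = (\<integral>p. (cmod (\<phi> p))\<^sup>2 \<partial>M)"
proof -
  note [measurable] = l2_funD(1)[OF assms] push_measurable
  show ?thesis by (subst (1 2) integral_eq_nn_integral) (simp_all add: nn_integral_push)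
qed

text \<open>Change of variables brings in the factor d; divided by the sqrt d of \<open>pull\<close>
  it leaves the sqrt d of \<open>push\<close>.\<close>

lemma integral_inner_push:
  assumes "\<phi> \<in> l2_fun M" "\<psi> \<in> l2_fun M"
  shows "(\<integral>q. inner (push \<phi> q) (\<psi> q) \<partial>M) = (\<integral>p. inner (\<phi> p) (pull \<psi> p) \<partial>M)"
proof -
  note [measurable] = assms[THEN l2_funD(1)] g
  have [measurable]: "\<psi> \<in> borel_measurable (restrict_space M R)"
    by (auto intro: measurable_restrict_space1)
  define h where "h q = inner (\<phi> (g q)) (\<psi> q / of_real (sqrt (d q)))" for q
  have [measurable]: "h \<in> borel_measurable (restrict_space M R)" unfolding h_def by measurable
  have sc: "inner a (b / of_real r) = inner a b / r" for a b :: complex and r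
  proof -
    have "b / of_real r = inverse r *\<^sub>R b"
      by (simp add: scaleR_conv_of_real divide_inverse mult.commute)
    then show ?thesis by (simp add: divide_inverse mult.commute)
  qed
  have sc': "inner (of_real r * a) b = r * inner a b" for a b :: complex and r
    by (simp flip: scaleR_conv_of_real)
  have "(\<integral>p. inner (\<phi> p) (pull \<psi> p) \<partial>M) = (\<integral>p. h (f p) \<partial>M)"
    by (intro Bochner_Integration.integral_cong) (simp_all add: h_def pull_def gf)
  also have "\<dots> = (\<integral>q. h q \<partial>density (restrict_space M R) (\<lambda>q. ennreal (d q)))"
    unfolding distr_f[symmetric] by (rule integral_distr[symmetric, OF f]) measurable
  also have "\<dots> = (\<integral>q. d q *\<^sub>R h q \<partial>restrict_space M R)"
    by (rule integral_density) (auto intro!: AE_I2 simp: space_R d_nonneg)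
  also have "\<dots> = (\<integral>q. inner (push \<phi> q) (\<psi> q) \<partial>restrict_space M R)"
  proof (intro Bochner_Integration.integral_cong refl)
    fix q
    assume "q \<in> space (restrict_space M R)"
    then have "q \<in> R" "0 \<le> d q" by (simp_all add: space_R d_nonneg)
    then show "d q *\<^sub>R h q = inner (push \<phi> q) (\<psi> q)"
      by (simp add: h_def push_def sc sc' real_div_sqrt flip: times_divide_eq_left)
  qed
  also have "\<dots> = (\<integral>q. inner (push \<phi> q) (\<psi> q) \<partial>M)"
    unfolding integral_restrict_space[OF R_Int(1)]
    by (intro Bochner_Integration.integral_cong) (auto simp: push_def split: split_indicator)
  finally show ?thesis by simp
qed

lemma pull_push: "AE p in M. pull (push \<phi>) p = \<phi> p"
  using AE_d_pos by (rule AE_mp) (auto intro!: AE_I2 simp: pull_def push_def f_in_R gf)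

lemma push_pull: "AE q in M. push (pull \<phi>) q = (if q \<in> R then \<phi> q else 0)"
  using d_pos by (rule AE_mp) (auto intro!: AE_I2 simp: pull_def push_def fg)

end

text \<open>The adjoint relation by itself forces both maps to be linear, and testing with s (t y)
  gives t the bound C of s.\<close>

lemma adj_op_exists:
  fixes s t :: "'h::complex_hilbert \<Rightarrow> 'h"
  assumes adj: "\<And>x y. inner (s x) y = inner x (t y)"
    and bound: "\<And>x. norm (s x) \<le> C * norm x"
    and imul: "\<And>x. s (imul x) = imul (s x)"
  obtains T where "\<And>x. T \<cdot> x = s x" "\<And>x. star T \<cdot> x = t x"
proof -
  have lin: "s (x + y) = s x + s y" "s (r *\<^sub>R x) = r *\<^sub>R s x" for x y r
    by (rule vector_eq_rdot[THEN iffD1]; simp add: adj inner_add_left)+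
  have lin': "t (x + y) = t x + t y" "t (r *\<^sub>R x) = r *\<^sub>R t x" for x y r
    by (rule vector_eq_ldot[THEN iffD1]; simp add: inner_add_right flip: adj)+
  have bs: "bounded_linear s"
    by (rule bounded_linear_intro[where K = C]) (use bound in \<open>auto simp: lin mult.commute\<close>)
  have "norm (t y) \<le> norm y * C" for y
  proof (cases "t y = 0")
    case True
    then show ?thesis
      using order_trans[OF norm_ge_zero bound[of y]] by (simp add: mult.commute)
  next
    case False
    have "norm (t y) * norm (t y) = inner (s (t y)) y"
      by (simp add: adj dot_square_norm power2_eq_square)
    also have "\<dots> \<le> norm (s (t y)) * norm y" by (rule norm_cauchy_schwarz)
    also have "\<dots> \<le> C * norm (t y) * norm y" by (intro mult_right_mono bound) simp
    also have "\<dots> = norm (t y) * (norm y * C)" by (simp only: ac_simps)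
    finally show ?thesis by (rule mult_left_le_imp_le) (simp add: False)
  qed
  then have bt: "bounded_linear t"
    by (intro bounded_linear_intro[where K = C]) (auto simp: lin')
  have "adjointable (Blinfun s)"
    unfolding adjointable_def is_adjoint_def
    using bs bt by (auto simp: bounded_linear_Blinfun_apply imul adj intro!: exI[of _ "Blinfun t"])
  then have app: "Adj_op (Blinfun s) \<cdot> x = s x" for x
    using bs by (simp add: op_apply_def Adj_op_inverse bounded_linear_Blinfun_apply)
  have "star (Adj_op (Blinfun s)) \<cdot> y = t y" for y
    by (rule vector_eq_ldot[THEN iffD1]) (simp add: inner_star_right app adj)
  with app show ?thesis by (rule that)
qed

lemma weighted_map_op:
  assumes "weighted_map square R f g d"
  obtains T where "\<And>\<phi>. \<phi> \<in> l2_fun square \<Longrightarrow> T \<cdot> l2vec \<phi> = l2vec (weighted_map.push R g d \<phi>)"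
    "\<And>\<phi>. \<phi> \<in> l2_fun square \<Longrightarrow> star T \<cdot> l2vec \<phi> = l2vec (weighted_map.pull f d \<phi>)"
proof -
  interpret weighted_map square R f g d by (rule assms)
  define s where "s a = l2vec (push (rep_square_l2 a))" for a
  define t where "t a = l2vec (pull (rep_square_l2 a))" for a
  have rep: "l2_rel square (rep_square_l2 (l2vec \<phi>)) \<phi>" if "\<phi> \<in> l2_fun square" for \<phi>
    using rep_abs_rsp_left[OF Quotient3_square_l2, of \<phi> \<phi>] that by (simp add: l2_rel_refl)
  have s: "s (l2vec \<phi>) = l2vec (push \<phi>)" and t: "t (l2vec \<phi>) = l2vec (pull \<phi>)"
    if "\<phi> \<in> l2_fun square" for \<phi>
    using push_cong[OF rep[OF that]] pull_cong[OF rep[OF that]] rep[OF that] that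
    by (auto simp: s_def t_def l2vec_eq_iff l2_rel_def push_l2 pull_l2)
  have "inner (s a) b = inner a (t b)" for a b
    by (cases a rule: l2vec_cases; cases b rule: l2vec_cases)
      (simp add: s t l2vec_simps push_l2 pull_l2 integral_inner_push)
  moreover have "norm (s a) \<le> 1 * norm a" for a
  proof (cases a rule: l2vec_cases)
    case (1 \<phi>)
    have "(norm (s a))\<^sup>2 = (norm a)\<^sup>2"
      using integral_push[OF 1(1)] 1 by (simp add: power2_norm_eq_inner s l2vec_simps push_l2)
    then show ?thesis by simp
  qed
  moreover have "s (imul a) = imul (s a)" for a
  proof (cases a rule: l2vec_cases)
    case (1 \<phi>)
    have "push (\<lambda>x. \<i> * \<phi> x) = (\<lambda>x. \<i> * push \<phi> x)" by (auto simp: push_def)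
    then show ?thesis using 1 by (simp add: imul_l2vec s push_l2 l2_fun_scale)
  qed
  ultimately obtain T where "\<And>x. T \<cdot> x = s x" "\<And>x. star T \<cdot> x = t x" by (rule adj_op_exists) blast
  then show ?thesis using s t by (intro that[of T]) simp_all
qed


section \<open>The branching system on the square\<close>

subsection \<open>The maps of the edges\<close>

text \<open>Midpoint of the interval of second coordinates onto which an edge with this index
  maps.\<close>

fun side :: "idx \<Rightarrow> real" where
  "side I1 = 1 / 2" | "side I2 = - 1 / 2"

definition half :: "idx \<Rightarrow> (real \<times> real) set" where
  "half i = {0..1} \<times> {side i - 1 / 2..side i + 1 / 2}"

fun letter_map :: "letter \<Rightarrow> real \<times> real \<Rightarrow> real \<times> real" where
  "letter_map (E i) p = ((fst p)\<^sup>2, side i + 1 / 2 * snd p)"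
| "letter_map (F i) p = (sqrt (fst p), side i + 1 / 2 * snd p)"

fun letter_inv :: "letter \<Rightarrow> real \<times> real \<Rightarrow> real \<times> real" where
  "letter_inv (E i) q = (sqrt (fst q), - (2 * side i) + 2 * snd q)"
| "letter_inv (F i) q = ((fst q)\<^sup>2, - (2 * side i) + 2 * snd q)"

text \<open>The Jacobians of the inverse maps: 1 / (2 sqrt u) or 2u from the first coordinate, times
  2 from the second.\<close>

fun letter_density :: "letter \<Rightarrow> real \<times> real \<Rightarrow> real" where
  "letter_density (E i) q = 1 / sqrt (fst q)"
| "letter_density (F i) q = 4 * fst q"

abbreviation letter_half :: "letter \<Rightarrow> (real \<times> real) set" where
  "letter_half l \<equiv> half (letter_idx l)"

abbreviation (input) Q :: "(real \<times> real) set" where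
  "Q \<equiv> {0..1} \<times> {-1..1}"

lemma side_cases: "side i = 1 / 2 \<or> side i = - 1 / 2"
  by (cases i) auto

lemma half_subset: "half i \<subseteq> Q"
  using side_cases[of i] by (auto simp: half_def)

lemma half_sets: "half i \<in> sets borel"
  unfolding half_def borel_prod[symmetric] by measurable

lemma Q_sets: "Q \<in> sets borel"
  unfolding borel_prod[symmetric] by measurable

lemma letter_map_eq:
  "letter_map (E i) = (\<lambda>p. ((fst p)\<^sup>2, side i + 1 / 2 * snd p))"
  "letter_map (F i) = (\<lambda>p. (sqrt (fst p), side i + 1 / 2 * snd p))"
  "letter_inv (E i) = (\<lambda>q. (sqrt (fst q), - (2 * side i) + 2 * snd q))"
  "letter_inv (F i) = (\<lambda>q. ((fst q)\<^sup>2, - (2 * side i) + 2 * snd q))"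
  "letter_density (E i) = (\<lambda>q. 1 / sqrt (fst q))"
  "letter_density (F i) = (\<lambda>q. 4 * fst q)"
  by (auto simp: fun_eq_iff)

lemma letter_borel [measurable]:
  "letter_map l \<in> borel_measurable borel" "letter_inv l \<in> borel_measurable borel"
  "letter_density l \<in> borel_measurable borel"
proof -
  show "letter_map l \<in> borel_measurable borel"
    by (cases l; simp only: letter_map_eq; intro borel_measurable_continuous_onI continuous_intros)
  show "letter_inv l \<in> borel_measurable borel"
    by (cases l; simp only: letter_map_eq; intro borel_measurable_continuous_onI continuous_intros)
  have [measurable]: "(fst :: real \<times> real \<Rightarrow> real) \<in> borel_measurable borel"
    by (intro borel_measurable_continuous_onI continuous_intros)
  show "letter_density l \<in> borel_measurable borel"
    by (cases l; simp only: letter_map_eq; measurable)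
qed

lemma letter_map_in_half: "p \<in> Q \<Longrightarrow> letter_map l p \<in> letter_half l"
  by (cases l) (auto simp: half_def power_le_one)

lemma letter_inv_in_Q: "q \<in> letter_half l \<Longrightarrow> letter_inv l q \<in> Q"
  by (cases l) (auto simp: half_def power_le_one)

lemma letter_inv_map: "p \<in> Q \<Longrightarrow> letter_inv l (letter_map l p) = p"
  by (cases l) (auto simp: prod_eq_iff)

lemma letter_map_inv: "q \<in> letter_half l \<Longrightarrow> letter_map l (letter_inv l q) = q"
  by (cases l) (auto simp: prod_eq_iff half_def field_simps)

lemma letter_map_distr:
  "letter_map l \<in> square \<rightarrow>\<^sub>M lebesgue_on (letter_half l)"
  "distr square (lebesgue_on (letter_half l)) (letter_map l)
    = density (lebesgue_on (letter_half l)) (\<lambda>q. ennreal (letter_density l q))"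
proof -
  have eq: "emeasure lborel (letter_map l -` A \<inter> Q)
      = (\<integral>\<^sup>+q. ennreal (letter_density l q) * indicator (letter_half l) q * indicator A q \<partial>lborel)"
    if A: "A \<in> sets borel" for A
  proof -
    define s where "s = side (letter_idx l)"
    have aff: "subst_density (\<lambda>y. s + 1 / 2 * y) {-1..1} (\<lambda>v. 2 * indicator {s - 1 / 2..s + 1 / 2} v)"
      using subst_density_affine[of "1/2" s "-1" 1] by simp
    \<comment> \<open>Both kinds of edge share the second coordinate; a and \<phi> abstract the
      first coordinate map and its density, so one product formula covers both.\<close>
    obtain a \<phi> where a: "subst_density a {0..1} (\<lambda>u. ennreal (\<phi> u) * indicator {0..1} u)"
      and l: "letter_map l = (\<lambda>p. (a (fst p), s + 1 / 2 * snd p))"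
        "\<And>q. 0 \<le> fst q \<Longrightarrow> ennreal (letter_density l q) = ennreal (\<phi> (fst q)) * 2"
    proof (cases l)
      case (E i)
      have "ennreal (1 / sqrt x) = ennreal (1 / (2 * sqrt x)) * 2" if "0 \<le> x" for x
        using that ennreal_mult[of "1 / (2 * sqrt x)" 2] by simp
      then show thesis
        using subst_density_square by (intro that[of "\<lambda>x. x\<^sup>2" "\<lambda>u. 1 / (2 * sqrt u)"]) (simp_all add: E s_def letter_map_eq)
    next
      case (F i)
      have "ennreal (4 * x) = ennreal (2 * x) * 2" if "0 \<le> x" for x
        using that ennreal_mult[of "2 * x" 2] by simp
      then show thesis
        using subst_density_sqrt by (intro that[of sqrt "\<lambda>u. 2 * u"]) (simp_all add: F s_def letter_map_eq)
    qed
    show ?thesis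
      unfolding l(1) subst_density_prod[OF a aff A]
      by (intro nn_integral_cong) (auto simp: l(2) half_def s_def mem_Times_iff indicator_def)
  qed
  have d: "(\<lambda>q. ennreal (letter_density l q)) \<in> borel_measurable borel" by measurable
  have "letter_map l \<in> Q \<rightarrow> letter_half l" using letter_map_in_half by blast
  note * = distr_lebesgue_on[OF letter_borel(1) Q_sets half_sets d this eq]
  show "letter_map l \<in> square \<rightarrow>\<^sub>M lebesgue_on (letter_half l)" by (rule *(1))
  show "distr square (lebesgue_on (letter_half l)) (letter_map l)
      = density (lebesgue_on (letter_half l)) (\<lambda>q. ennreal (letter_density l q))" by (rule *(2))
qed

text \<open>The first coordinate maps of E and F are inverse to each other, so the two densities
  change places; stretching y by 2 contributes 1/2.\<close>

lemma letter_inv_distr: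
  "letter_inv l \<in> lebesgue_on (letter_half l) \<rightarrow>\<^sub>M square"
  "absolutely_continuous square (distr (lebesgue_on (letter_half l)) square (letter_inv l))"
proof -
  let ?J = "{side (letter_idx l) - 1 / 2..side (letter_idx l) + 1 / 2}"
  have aff: "subst_density (\<lambda>y. - (2 * side i) + 2 * y) {side i - 1/2..side i + 1/2}
      (\<lambda>v. ennreal (1 / 2) * indicator {-1..1} v)" for i
    using subst_density_affine[of 2 "- (2 * side i)" "side i - 1/2" "side i + 1/2"] by simp
  obtain \<phi> where \<phi>: "\<phi> \<in> borel_measurable borel" and
    eq: "\<And>A. A \<in> sets borel \<Longrightarrow> emeasure lborel (letter_inv l -` A \<inter> letter_half l)
      = (\<integral>\<^sup>+q. \<phi> (fst q) * indicator Q q * indicator A q \<partial>lborel)"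
  proof (cases l)
    case (E i)
    show thesis
    proof (rule that)
      show "(\<lambda>u. ennreal (2 * u) * ennreal (1/2)) \<in> borel_measurable borel" by measurable
      fix A :: "(real \<times> real) set"
      assume A: "A \<in> sets borel"
      show "emeasure lborel (letter_inv l -` A \<inter> letter_half l)
          = (\<integral>\<^sup>+q. ennreal (2 * fst q) * ennreal (1/2) * indicator Q q * indicator A q \<partial>lborel)"
        using subst_density_prod[OF subst_density_sqrt aff[of i] A]
        by (simp add: E letter_map_eq half_def indicator_times mult_ac)
    qed
  next
    case (F i)
    show thesis
    proof (rule that)
      show "(\<lambda>u. ennreal (1 / (2 * sqrt u)) * ennreal (1/2)) \<in> borel_measurable borel" by measurable
      fix A :: "(real \<times> real) set"
      assume A: "A \<in> sets borel"
      show "emeasure lborel (letter_inv l -` A \<inter> letter_half l)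
          = (\<integral>\<^sup>+q. ennreal (1 / (2 * sqrt (fst q))) * ennreal (1/2) * indicator Q q * indicator A q \<partial>lborel)"
        using subst_density_prod[OF subst_density_square aff[of i] A]
        by (simp add: F letter_map_eq half_def indicator_times mult_ac)
    qed
  qed
  have d: "(\<lambda>q::real \<times> real. \<phi> (fst q)) \<in> borel_measurable borel"
    using \<phi> unfolding borel_prod[symmetric] by measurable
  have "letter_inv l \<in> letter_half l \<rightarrow> Q" using letter_inv_in_Q by blast
  note * = distr_lebesgue_on[OF letter_borel(2) half_sets Q_sets d this eq]
  show "letter_inv l \<in> lebesgue_on (letter_half l) \<rightarrow>\<^sub>M square" by (rule *(1))
  have "(\<lambda>q. \<phi> (fst q)) \<in> borel_measurable square"
    using d by (intro measurable_restrict_space1 measurable_completion) simp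
  then have "absolutely_continuous square (density square (\<lambda>q. \<phi> (fst q)))"
    by (rule absolutely_continuousI_density)
  with *(2) show "absolutely_continuous square (distr (lebesgue_on (letter_half l)) square (letter_inv l))"
    by (rule back_subst[OF _ sym, rotated])
qed

lemma restrict_square: "A \<in> sets borel \<Longrightarrow> A \<subseteq> Q \<Longrightarrow> restrict_space square A = lebesgue_on A"
  using Q_sets by (subst restrict_restrict_space) (auto simp: Int_absorb1)

lemma half_in_square: "half i \<in> sets square"
  using half_sets half_subset[of i] Q_sets by (simp add: sets_restrict_space_iff)

lemma AE_square_hyperplane:
  assumes "k \<in> Basis"
  shows "AE p in square. p \<bullet> k \<noteq> c"
proof -
  have "{p. p \<bullet> k = c} \<in> null_sets (lebesgue :: (real \<times> real) measure)"
    using negligible_standard_hyperplane[OF assms] by (simp add: negligible_iff_null_sets)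
  then have "AE p in lebesgue. p \<bullet> k \<noteq> c" using AE_not_in by fastforce
  then show ?thesis using Q_sets by (subst AE_restrict_space_iff) (auto elim: AE_mp)
qed

lemma AE_square_fst: "AE p in square. 0 < fst p \<and> fst p < 1"
proof -
  have "(1, 0) \<in> (Basis :: (real \<times> real) set)" by (simp add: Basis_prod_def)
  from AE_square_hyperplane[OF this, of 0] AE_square_hyperplane[OF this, of 1] AE_space
  show ?thesis by eventually_elim (auto simp: space_restrict_space inner_prod_def less_le)
qed

lemma AE_square_snd: "AE p in square. snd p \<noteq> c"
proof -
  have "(0, 1) \<in> (Basis :: (real \<times> real) set)" by (simp add: Basis_prod_def)
  from AE_square_hyperplane[OF this, of c] show ?thesis by (simp add: inner_prod_def)
qed

lemma weighted_map_letter: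
  "weighted_map square (letter_half l) (letter_map l) (letter_inv l) (letter_density l)"
proof
  show "letter_half l \<in> sets square" by (rule half_in_square)
  show "letter_map l \<in> square \<rightarrow>\<^sub>M restrict_space square (letter_half l)"
    "distr square (restrict_space square (letter_half l)) (letter_map l)
      = density (restrict_space square (letter_half l)) (\<lambda>q. ennreal (letter_density l q))"
    "letter_inv l \<in> restrict_space square (letter_half l) \<rightarrow>\<^sub>M square"
    unfolding restrict_square[OF half_sets half_subset] by (rule letter_map_distr letter_inv_distr)+
  show "letter_inv l (letter_map l p) = p" if "p \<in> space square" for p
    using that by (simp add: letter_inv_map space_restrict_space)
  show "letter_map l (letter_inv l q) = q" if "q \<in> letter_half l" for q
    using that by (rule letter_map_inv)
  show "letter_density l \<in> borel_measurable square"
    by (intro measurable_restrict_space1 measurable_completion) simp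
  show "0 \<le> letter_density l q" if "q \<in> letter_half l" for q
    using that by (cases l) (auto simp: half_def)
  show "AE q in square. q \<in> letter_half l \<longrightarrow> 0 < letter_density l q"
    using AE_square_fst by (rule AE_mp) (intro AE_I2, cases l, auto)
qed

subsection \<open>The operators of the edges\<close>

interpretation letter: weighted_map square "letter_half l" "letter_map l" "letter_inv l" "letter_density l" for l
  by (rule weighted_map_letter)

definition letter_op :: "letter \<Rightarrow> square_l2 adj_op" where
  "letter_op l = (SOME T. \<forall>\<phi>\<in>l2_fun square.
     T \<cdot> l2vec \<phi> = l2vec (letter.push l \<phi>) \<and> star T \<cdot> l2vec \<phi> = l2vec (letter.pull l \<phi>))"

lemma letter_op_apply:
  assumes "\<phi> \<in> l2_fun square"
  shows "letter_op l \<cdot> l2vec \<phi> = l2vec (letter.push l \<phi>)"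
    "star (letter_op l) \<cdot> l2vec \<phi> = l2vec (letter.pull l \<phi>)"
proof -
  have "\<exists>T. \<forall>\<phi>\<in>l2_fun square.
      T \<cdot> l2vec \<phi> = l2vec (letter.push l \<phi>) \<and> star T \<cdot> l2vec \<phi> = l2vec (letter.pull l \<phi>)"
    using weighted_map_op[OF weighted_map_letter[of l]] by metis
  then have "\<forall>\<phi>\<in>l2_fun square. letter_op l \<cdot> l2vec \<phi> = l2vec (letter.push l \<phi>)
      \<and> star (letter_op l) \<cdot> l2vec \<phi> = l2vec (letter.pull l \<phi>)"
    unfolding letter_op_def by (rule someI_ex)
  with assms show "letter_op l \<cdot> l2vec \<phi> = l2vec (letter.push l \<phi>)"
    "star (letter_op l) \<cdot> l2vec \<phi> = l2vec (letter.pull l \<phi>)" by auto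
qed

definition op_id :: "'h::complex_hilbert adj_op" where
  "op_id = Adj_op id_blinfun"

lemma op_id_apply [simp]: "op_id \<cdot> x = x"
  by (simp add: op_id_def op_apply_def Adj_op_inverse adjointable_intros)

lemma op_id_simps [simp]: "op_id * T = T" "T * op_id = T" "star op_id = op_id"
  by (rule op_eqI star_eqI; simp)+

lemma op_l2vec_eqI:
  assumes "\<And>\<phi>. \<phi> \<in> l2_fun square \<Longrightarrow> S \<cdot> l2vec \<phi> = T \<cdot> l2vec \<phi>"
  shows "S = T"
  by (rule op_eqI) (metis assms l2vec_cases)

lemma star_letter_op_mult: "star (letter_op l) * letter_op l = op_id"
  by (rule op_l2vec_eqI)
    (simp add: letter_op_apply letter.push_l2 letter.pull_l2 l2vec_eq_iff letter.pull_push)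

lemma letter_push_simps:
  "weighted_map.push (half i) (letter_inv (E i)) (letter_density (E i)) \<phi> (x, y) = (if (x, y) \<in> half i
     then of_real (sqrt (1 / sqrt x)) * \<phi> (sqrt x, 2 * y - 2 * side i) else 0)"
  "weighted_map.push (half i) (letter_inv (F i)) (letter_density (F i)) \<phi> (x, y) = (if (x, y) \<in> half i
     then of_real (sqrt (4 * x)) * \<phi> (x\<^sup>2, 2 * y - 2 * side i) else 0)"
  using letter.push_def[of "E i" \<phi> "(x, y)"] letter.push_def[of "F i" \<phi> "(x, y)"] by simp_all

text \<open>In either order the first coordinate returns to x, the weights multiply to 2, and the
  second coordinate depends only on the indices i and j.\<close>

lemma letter_op_swap: "letter_op (E i) * letter_op (F j) = letter_op (F i) * letter_op (E j)"
proof (rule op_l2vec_eqI)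
  fix \<phi> :: "real \<times> real \<Rightarrow> complex"
  assume \<phi>: "\<phi> \<in> l2_fun square"
  have "letter.push (E i) (letter.push (F j) \<phi>) q = letter.push (F i) (letter.push (E j) \<phi>) q" for q
  proof -
    obtain x y where q: "q = (x, y)" by fastforce
    show ?thesis
    proof (cases "q \<in> half i \<and> 0 < x")
      case True
      then have x: "0 < x" "x \<le> 1" by (auto simp: q half_def)
      have "sqrt (1 / sqrt x) * sqrt (4 * sqrt x) = 2"
        using x by (simp flip: real_sqrt_mult)
      moreover have "sqrt (4 * x) * sqrt (1 / x) = 2"
        using x by (simp flip: real_sqrt_mult)
      moreover have "(sqrt x, 2 * y - 2 * side i) \<in> half j \<longleftrightarrow> (x\<^sup>2, 2 * y - 2 * side i) \<in> half j"
        using x by (auto simp: half_def power_le_one)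
      ultimately show ?thesis
        using True x
        by (simp add: q letter_push_simps mult.assoc[symmetric] del: of_real_divide of_real_mult flip: of_real_mult)
    next
      case False
      \<comment> \<open>At x = 0 both sides vanish: sqrt (4x) is 0, and so is sqrt (1 / sqrt x) by
        the convention for division.\<close>
      then have "q \<notin> half i \<or> x = 0" by (auto simp: q half_def)
      then show ?thesis by (auto simp: q letter_push_simps)
    qed
  qed
  then have "letter.push (E i) (letter.push (F j) \<phi>) = letter.push (F i) (letter.push (E j) \<phi>)" by (rule ext)
  then show "(letter_op (E i) * letter_op (F j)) \<cdot> l2vec \<phi> = (letter_op (F i) * letter_op (E j)) \<cdot> l2vec \<phi>"
    by (simp only: op_apply_simps letter_op_apply(1)[OF \<phi>] letter_op_apply(1)[OF letter.push_l2[OF \<phi>]])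
qed

lemma letter_op_sum:
  assumes "letter_idx l = I1" "letter_idx l' = I2"
  shows "letter_op l * star (letter_op l) + letter_op l' * star (letter_op l') = op_id"
proof (rule op_l2vec_eqI)
  fix \<phi> :: "real \<times> real \<Rightarrow> complex"
  assume \<phi>: "\<phi> \<in> l2_fun square"
  have "AE q in square. letter.push l (letter.pull l \<phi>) q + letter.push l' (letter.pull l' \<phi>) q = \<phi> q"
    \<comment> \<open>The two halves overlap in the segment y = 0, where both terms would count; it
      is a null set.\<close>
    using letter.push_pull[of l \<phi>] letter.push_pull[of l' \<phi>] AE_square_snd[of 0] AE_space
  proof eventually_elim
    case (elim q)
    then show ?case using assms by (auto simp: half_def space_restrict_space)
  qed
  then show "(letter_op l * star (letter_op l) + letter_op l' * star (letter_op l')) \<cdot> l2vec \<phi> = op_id \<cdot> l2vec \<phi>"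
    using \<phi> by (simp add: letter_op_apply letter.push_l2 letter.pull_l2 l2vec_simps l2vec_eq_iff l2_fun_add)
qed

section \<open>The Cuntz-Krieger family of all paths\<close>

primrec word_op :: "letter list \<Rightarrow> square_l2 adj_op" where
  "word_op [] = op_id"
| "word_op (l # w) = letter_op l * word_op w"

lemma word_op_append: "word_op (u @ w) = word_op u * word_op w"
  by (induction u) (simp_all add: mult.assoc)

lemma word_op_cong: "equivclp swap u w \<Longrightarrow> word_op u = word_op w"
proof (induction rule: equivclp_induct)
  case (step y z)
  have "word_op a = word_op b" if "swap a b" for a b
    using that
  proof cases
    case (1 u i j w)
    have "word_op ([E i, F j]) = word_op ([F i, E j])" by (simp add: letter_op_swap)
    then show ?thesis by (simp only: 1 word_op_append)
  qed
  with step show ?case by metis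
qed simp

lift_definition graph_op :: "graph \<Rightarrow> square_l2 adj_op" is word_op
  by (rule word_op_cong)

lemma graph_op_one: "graph_op 1 = op_id"
  by transfer simp

lemma graph_op_mult: "graph_op (\<mu> * \<nu>) = graph_op \<mu> * graph_op \<nu>"
  by transfer (rule word_op_append)

lemma graph_op_word: "graph_op (graph_of_word w) = word_op w"
  by transfer simp

lemma graph_of_word_cases: obtains w where "\<mu> = graph_of_word w"
  by (metis Quotient3_abs_rep Quotient3_graph)

lemma star_graph_op_mult: "star (graph_op \<mu>) * graph_op \<mu> = op_id"
proof -
  have "star (word_op w) * word_op w = op_id" for w
  proof (induction w)
    case (Cons l w)
    have "star (word_op (l # w)) * word_op (l # w) = star (word_op w) * (star (letter_op l) * letter_op l) * word_op w"
      by (simp add: star_mult mult.assoc)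
    then show ?case by (simp add: star_letter_op_mult Cons)
  qed simp
  then show ?thesis by (cases \<mu> rule: graph_of_word_cases) (simp add: graph_op_word)
qed

lemma deg_eq_0_iff: "deg \<mu> = 0 \<longleftrightarrow> \<mu> = (1 :: 'm::two_graph_monoid)"
proof
  assume "deg \<mu> = 0"
  then show "\<mu> = 1" using factorization_unique[of \<mu> 1 1 \<mu>] by (simp add: deg_one)
qed (simp add: deg_one)

lemma degree_induct [case_names zero E F]:
  fixes n :: "nat \<times> nat"
  assumes "P 0" "\<And>n. P n \<Longrightarrow> P ((1, 0) + n)" "\<And>n. P n \<Longrightarrow> P ((0, 1) + n)"
  shows "P n"
proof -
  have *: "P (0, b)" for b
  proof (induction b)
    case (Suc b)
    then show ?case using assms(3)[OF Suc] by simp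
  qed (use assms(1) in \<open>simp add: zero_prod_def\<close>)
  have "P (a, b)" for a b
  proof (induction a)
    case (Suc a)
    then show ?case using assms(2)[OF Suc] by simp
  qed (rule *)
  then show ?thesis by (cases n) simp
qed

text \<open>By unique factorization the sum for m + n is the sum for n nested inside the sum for m,
  so the two edge degrees imply all others.\<close>

lemma graph_op_sum: "(\<Sum>\<mu> | deg \<mu> = n. graph_op \<mu> * star (graph_op \<mu>)) = op_id"
proof -
  have add: "(\<Sum>\<mu> | deg \<mu> = m + n. graph_op \<mu> * star (graph_op \<mu>)) = op_id"
    if m: "(\<Sum>\<mu> | deg \<mu> = m. graph_op \<mu> * star (graph_op \<mu>)) = op_id"
      and n: "(\<Sum>\<mu> | deg \<mu> = n. graph_op \<mu> * star (graph_op \<mu>)) = op_id" for m n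
  proof -
    have "(\<Sum>\<mu> | deg \<mu> = m + n. graph_op \<mu> * star (graph_op \<mu>))
        = (\<Sum>\<mu> | deg \<mu> = m. graph_op \<mu> * (\<Sum>\<nu> | deg \<nu> = n. graph_op \<nu> * star (graph_op \<nu>)) * star (graph_op \<mu>))"
      unfolding sum_factorization
      by (simp add: graph_op_mult star_mult mult.assoc sum_distrib_left sum_distrib_right)
    then show ?thesis by (simp add: m n)
  qed
  have "(\<Sum>\<mu> | deg \<mu> = (1, 0). graph_op \<mu> * star (graph_op \<mu>)) = op_id"
    "(\<Sum>\<mu> | deg \<mu> = (0, 1). graph_op \<mu> * star (graph_op \<mu>)) = op_id"
    unfolding graph_deg_eq_1 using graph_distinct by (simp_all add: graph_op_word letter_op_sum)
  note one = this
  show ?thesis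
  proof (induction n rule: degree_induct)
    case zero
    then show ?case by (simp add: deg_eq_0_iff graph_op_one)
  next
    case (E n)
    then show ?case by (rule add[OF one(1)])
  next
    case (F n)
    then show ?case by (rule add[OF one(2)])
  qed
qed

lemma ck_family_graph_op: "ck_family graph_op"
  unfolding ck_family_def
  by (auto simp: graph_op_one graph_op_mult star_graph_op_mult graph_op_sum mult.assoc)

text \<open>Two projections with sum \<open>1\<close> are orthogonal; longer paths reduce to edges by factorization.\<close>

lemma orthogonal_ranges_graph: "orthogonal_ranges TYPE(graph)"
proof -
  have pair: "star (ck_gen a) * ck_gen b = (0 :: graph ck_algebra)"
    if n: "{\<mu>::graph. deg \<mu> = n} = {a, b}" and "a \<noteq> b" for n a b
  proof -
    have "ck_gen a * star (ck_gen a) + ck_gen b * star (ck_gen b) = (ck_gen 1 :: graph ck_algebra)"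
    proof -
      have "(\<Sum>\<mu> | deg \<mu> = n. ck_gen \<mu> * star (ck_gen \<mu>)) = (ck_gen 1 :: graph ck_algebra)" by (rule ck_gen_sum)
      then show ?thesis unfolding n using \<open>a \<noteq> b\<close> by simp
    qed
    \<comment> \<open>Multiplying the relation by \<open>star (ck_gen a)\<close> on the left and
      \<open>ck_gen b\<close> on the right makes twice \<open>star (ck_gen a) * ck_gen b\<close>
      equal to itself once.\<close>
    then have "star (ck_gen a) * (ck_gen a * star (ck_gen a) + ck_gen b * star (ck_gen b)) * ck_gen b
        = star (ck_gen a) * (ck_gen 1 :: graph ck_algebra) * ck_gen b" by simp
    moreover have "star (ck_gen a) * (ck_gen a * star (ck_gen a) + ck_gen b * star (ck_gen b)) * ck_gen b
        = (star (ck_gen a) * ck_gen a) * (star (ck_gen a) * ck_gen b)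
          + (star (ck_gen a) * ck_gen b) * (star (ck_gen b) * (ck_gen b :: graph ck_algebra))"
      by (simp add: distrib_left distrib_right mult.assoc)
    ultimately show ?thesis
      by (simp add: star_ck_gen_mult ck_gen_one_mult mult_ck_gen_one)
  qed
  have edge: "star (ck_gen a) * ck_gen b = (0 :: graph ck_algebra)"
    if "deg a = n" "deg b = n" "a \<noteq> b" "n = (1, 0) \<or> n = (0, 1)" for a b n
    using that(4)
  proof
    assume "n = (1, 0)"
    then have "a \<in> {e1, e2}" "b \<in> {e1, e2}" using that(1,2) graph_deg_eq_1(1) by blast+
    then have "{\<mu>::graph. deg \<mu> = (1, 0)} = {a, b}" using that(3) graph_deg_eq_1(1) by auto
    then show ?thesis by (rule pair) fact
  next
    assume "n = (0, 1)"
    then have "a \<in> {f1, f2}" "b \<in> {f1, f2}" using that(1,2) graph_deg_eq_1(2) by blast+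
    then have "{\<mu>::graph. deg \<mu> = (0, 1)} = {a, b}" using that(3) graph_deg_eq_1(2) by auto
    then show ?thesis by (rule pair) fact
  qed
  have "\<forall>\<mu> \<nu>::graph. deg \<mu> = n \<longrightarrow> deg \<nu> = n \<longrightarrow> \<mu> \<noteq> \<nu> \<longrightarrow> star (ck_gen \<mu>) * ck_gen \<nu> = 0" for n
  proof -
    have step: "star (ck_gen \<mu>) * ck_gen \<nu> = 0"
      if IH: "\<forall>\<mu> \<nu>::graph. deg \<mu> = n \<longrightarrow> deg \<nu> = n \<longrightarrow> \<mu> \<noteq> \<nu> \<longrightarrow> star (ck_gen \<mu>) * ck_gen \<nu> = 0"
        and d: "deg \<mu> = m + n" "deg \<nu> = m + n" "\<mu> \<noteq> \<nu>" "m = (1, 0) \<or> m = (0, 1)" for m n and \<mu> \<nu> :: graph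
    proof -
      obtain a \<mu>' where a: "deg a = m" "deg \<mu>' = n" "\<mu> = a * \<mu>'" using d(1) by (rule factorization_exists)
      obtain b \<nu>' where b: "deg b = m" "deg \<nu>' = n" "\<nu> = b * \<nu>'" using d(2) by (rule factorization_exists)
      have eq: "star (ck_gen \<mu>) * ck_gen \<nu> = star (ck_gen \<mu>') * (star (ck_gen a) * ck_gen b) * ck_gen \<nu>'"
        by (simp add: a(3) b(3) ck_gen_mult star_mult mult.assoc)
      show ?thesis
      proof (cases "a = b")
        case True
        then have "\<mu>' \<noteq> \<nu>'" using a(3) b(3) d(3) by auto
        then have "star (ck_gen \<mu>') * ck_gen \<nu>' = 0" using IH a(2) b(2) by blast
        then show ?thesis unfolding eq True by (simp add: star_ck_gen_mult mult_ck_gen_one)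
      next
        case False
        then show ?thesis using edge[OF a(1) b(1) _ d(4)] by (simp add: eq)
      qed
    qed
    show ?thesis
    proof (induction n rule: degree_induct)
      case zero
      then show ?case by (simp add: deg_eq_0_iff)
    next
      case (E n)
      then show ?case using step[OF E] by blast
    next
      case (F n)
      then show ?case using step[OF F] by blast
    qed
  qed
  then show ?thesis unfolding orthogonal_ranges_def by blast
qed


subsection \<open>Separating vectors\<close>

text \<open>The squaring map and the square root shift the level by one, and an edge with index \<open>i\<close>
  prepends \<open>i\<close> to the binary expansion of the second coordinate.\<close>

definition level :: "real \<Rightarrow> int" where
  "level x = \<lfloor>log 2 (- ln x)\<rfloor>"

definition digit :: "real \<Rightarrow> idx" where
  "digit y = (if 0 \<le> y then I1 else I2)"

primrec digits :: "nat \<Rightarrow> real \<Rightarrow> idx" where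
  "digits 0 y = digit y"
| "digits (Suc k) y = digits k (2 * y - 2 * side (digit y))"

definition begins :: "idx list \<Rightarrow> real \<Rightarrow> bool" where
  "begins w y \<longleftrightarrow> (\<forall>k<length w. w ! k = digits k y)"

text \<open>The open bounds keep the logarithms in \<open>level\<close> meaningful and exclude the
  endpoints -1 and 1, whose images under the edge maps have an ambiguous first digit.\<close>

definition cylinder :: "int \<Rightarrow> idx list \<Rightarrow> (real \<times> real) set" where
  "cylinder d w = {p. 0 < fst p \<and> fst p < 1 \<and> -1 < snd p \<and> snd p < 1 \<and> level (fst p) = d \<and> begins w (snd p)}"

fun letter_shift :: "letter \<Rightarrow> int" where
  "letter_shift (E i) = 1" | "letter_shift (F i) = - 1"

lemma level_square:
  assumes "0 < x" "x < 1"
  shows "level (x\<^sup>2) = level x + 1"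
proof -
  have "- ln (x\<^sup>2) = 2 * (- ln x)" using assms by (simp add: ln_realpow)
  moreover have "log 2 (2 * (- ln x)) = 1 + log 2 (- ln x)"
    using assms by (subst log_mult) auto
  ultimately show ?thesis unfolding level_def by (simp only:) linarith
qed

lemma level_sqrt: "0 < x \<Longrightarrow> x < 1 \<Longrightarrow> level (sqrt x) = level x - 1"
  using level_square[of "sqrt x"] by simp

lemma digit_side:
  assumes "-1 < 2 * y - 2 * side i" "2 * y - 2 * side i < 1"
  shows "digit y = i"
  using assms by (cases i) (auto simp: digit_def)

lemma begins_Cons: "digit y = i \<Longrightarrow> begins w (2 * y - 2 * side i) \<Longrightarrow> begins (i # w) y"
  by (auto simp: begins_def nth_Cons split: nat.split)

lemma letter_inv_cylinder:
  assumes "q \<in> letter_half l" "letter_inv l q \<in> cylinder d w"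
  shows "q \<in> cylinder (d + letter_shift l) (letter_idx l # w)"
proof -
  obtain x y where q: "q = (x, y)" by fastforce
  define i where "i = letter_idx l"
  have y: "-1 < 2 * y - 2 * side i" "2 * y - 2 * side i < 1" "begins w (2 * y - 2 * side i)"
    using assms(2) by (cases l; simp add: q cylinder_def i_def algebra_simps)+
  have "digit y = i" using y(1,2) by (rule digit_side)
  then have "begins (i # w) y" using y(3) by (rule begins_Cons)
  moreover have "-1 < y" "y < 1" using y(1,2) side_cases[of i] by auto
  moreover have "0 < x \<and> x < 1 \<and> level x = d + letter_shift l"
  proof (cases l)
    case (E j)
    then have "0 < x" "x < 1" "level (sqrt x) = d"
      using assms(2) by (auto simp: q cylinder_def)
    then show ?thesis using level_sqrt[of x] by (simp add: E)
  next
    case (F j)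
    have "0 \<le> x" using assms(1) by (simp add: q half_def)
    moreover have "0 < x\<^sup>2" "x\<^sup>2 < 1" "level (x\<^sup>2) = d"
      using assms(2) by (auto simp: F q cylinder_def)
    moreover have "x \<noteq> 0" using \<open>0 < x\<^sup>2\<close> by auto
    moreover have "\<bar>x\<bar> < 1" using \<open>x\<^sup>2 < 1\<close> by (simp only: abs_square_less_1)
    ultimately have "0 < x" "x < 1" by auto
    then show ?thesis using level_square[of x] \<open>level (x\<^sup>2) = d\<close> by (simp add: F)
  qed
  ultimately show ?thesis by (simp add: q cylinder_def i_def)
qed

text \<open>The marker shows where the word ends. If u were shorter than v, then at position length
  u + n the marker after u has its I2, while the marker after v is still in its run of I1, because
  length v <= n.\<close>

lemma begins_append_marker:
  assumes "begins (w @ replicate n I1 @ [I2]) y" "begins (w' @ replicate n I1 @ [I2]) y"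
    and "length w \<le> n" "length w' \<le> n"
  shows "w = w'"
proof -
  have less: False
    if b: "begins (u @ replicate n I1 @ [I2]) y" "begins (v @ replicate n I1 @ [I2]) y"
      and l: "length v \<le> n" "length u < length v" for u v
  proof -
    have "(u @ replicate n I1 @ [I2]) ! (length u + n) = digits (length u + n) y"
      using b(1)[unfolded begins_def, rule_format, of "length u + n"] by simp
    also have "\<dots> = (v @ replicate n I1 @ [I2]) ! (length u + n)"
      using b(2)[unfolded begins_def, rule_format, of "length u + n"] l by simp
    finally have "(u @ replicate n I1 @ [I2]) ! (length u + n) = (v @ replicate n I1 @ [I2]) ! (length u + n)" .
    moreover have "(u @ replicate n I1 @ [I2]) ! (length u + n) = I2" by (simp add: nth_append)
    moreover have "(v @ replicate n I1 @ [I2]) ! (length u + n) = I1" using l by (simp add: nth_append)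
    ultimately show False by simp
  qed
  have "length w = length w'"
    using less[OF assms(1,2,4)] less[OF assms(2,1,3)] by (metis linorder_neqE_nat)
  moreover have "w ! k = w' ! k" if "k < length w" for k
  proof -
    have "(w @ replicate n I1 @ [I2]) ! k = (w' @ replicate n I1 @ [I2]) ! k"
      using assms(1,2) that calculation by (simp add: begins_def)
    then show ?thesis using that calculation by (simp add: nth_append)
  qed
  ultimately show ?thesis by (rule nth_equalityI)
qed

section \<open>Supports of functions transported along words\<close>

primrec word_push :: "letter list \<Rightarrow> (real \<times> real \<Rightarrow> complex) \<Rightarrow> real \<times> real \<Rightarrow> complex" where
  "word_push [] \<phi> = \<phi>"
| "word_push (l # w) \<phi> = letter.push l (word_push w \<phi>)"

lemma word_push_l2: "\<phi> \<in> l2_fun square \<Longrightarrow> word_push w \<phi> \<in> l2_fun square"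
  by (induction w) (simp_all add: letter.push_l2)

lemma word_op_apply: "\<phi> \<in> l2_fun square \<Longrightarrow> word_op w \<cdot> l2vec \<phi> = l2vec (word_push w \<phi>)"
  by (induction w) (simp_all add: letter_op_apply word_push_l2)

text \<open>Each letter contributes its degree difference to the level and its index to the front of
  the expansion, so the support remembers both invariants of the path.\<close>

lemma word_push_cylinder:
  assumes "\<And>p. \<phi> p \<noteq> 0 \<Longrightarrow> p \<in> cylinder d v" and "word_push w \<phi> q \<noteq> 0"
  shows "q \<in> cylinder (d + (int (fst (word_deg w)) - int (snd (word_deg w)))) (map letter_idx w @ v)"
  using assms(2)
proof (induction w arbitrary: q)
  case Nil
  then show ?case using assms(1) by (simp add: word_deg_def)
next
  case (Cons l w)
  then have q: "q \<in> letter_half l" "word_push w \<phi> (letter_inv l q) \<noteq> 0"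
    by (auto simp: letter.push_def split: if_splits)
  have shift: "letter_shift l = int (fst (letter_deg l)) - int (snd (letter_deg l))" by (cases l) auto
  show ?case
    using letter_inv_cylinder[OF q(1) Cons.IH[OF q(2)]] by (simp add: word_deg_def shift algebra_simps)
qed

lemma inner_l2vec_disjoint:
  assumes "\<phi> \<in> l2_fun square" "\<psi> \<in> l2_fun square" and "\<And>p. \<phi> p = 0 \<or> \<psi> p = 0"
  shows "inner (l2vec \<phi>) (l2vec \<psi>) = 0"
proof -
  have "inner (\<phi> p) (\<psi> p) = 0" for p using assms(3)[of p] by auto
  then show ?thesis using assms(1,2) by (simp add: l2vec_simps)
qed

lemma exists_cylinder_function:
  obtains \<phi> where "\<phi> \<in> l2_fun square" "l2vec \<phi> \<noteq> 0" "\<And>p. \<phi> p \<noteq> 0 \<Longrightarrow> p \<in> cylinder 0 []"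
proof
  \<comment> \<open>On B the value of -ln x lies strictly between 1 and 2, hence the level is
    0.\<close>
  define B :: "(real \<times> real) set" where "B = {exp (- 2)<..<exp (- 1)} \<times> {-1<..<1}"
  define \<phi> :: "real \<times> real \<Rightarrow> complex" where "\<phi> = indicator B"
  have B: "open B" "B \<noteq> {}" "B \<subseteq> Q"
  proof -
    show "open B" unfolding B_def by (intro open_Times) auto
    obtain x :: real where "exp (- 2) < x" "x < exp (- 1)" using dense[of "exp (- 2) :: real" "exp (- 1)"] by auto
    then have "(x, 0) \<in> B" by (simp add: B_def)
    then show "B \<noteq> {}" by blast
    have "exp (- 1) \<le> (1::real)" by simp
    then show "B \<subseteq> Q" unfolding B_def
      by (auto intro: less_imp_le order_less_le_trans[OF exp_gt_zero] simp del: exp_le_one_iff)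
        (meson exp_gt_zero less_imp_le order_trans less_trans)+
  qed
  have BM: "B \<in> sets square"
    using B(1,3) Q_sets by (simp add: sets_restrict_space_iff borel_open)
  have "emeasure square B \<le> emeasure square (space square)"
    by (rule emeasure_space)
  also have "\<dots> < \<infinity>"
    using Q_sets by (simp add: space_restrict_space emeasure_restrict_space emeasure_completion lborel_prod[symmetric]
        lborel.emeasure_pair_measure_Times)
  finally have fin: "emeasure square B < \<infinity>" .
  have sq: "(cmod (\<phi> p))\<^sup>2 = indicator B p" for p by (simp add: \<phi>_def indicator_def)
  have "integrable square (\<lambda>p. indicator B p :: real)" using BM fin by simp
  then show \<phi>: "\<phi> \<in> l2_fun square"
    unfolding l2_fun_def using BM by (simp add: sq) (simp add: \<phi>_def)
  show "l2vec \<phi> \<noteq> 0"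
  proof
    assume "l2vec \<phi> = 0"
    then have "AE p in square. \<phi> p = 0"
      using \<phi> l2vec_eq_iff[OF \<phi> l2_fun_zero] by (simp add: zero_square_l2_def)
    then have "AE p in lebesgue. p \<in> Q \<longrightarrow> \<phi> p = 0"
      using Q_sets by (subst (asm) AE_restrict_space_iff) auto
    then have "AE p in lebesgue. p \<notin> B"
      by (rule AE_mp) (use B(3) in \<open>auto intro!: AE_I2 simp: \<phi>_def\<close>)
    then have "B \<in> null_sets lebesgue"
      using B(1) by (simp add: AE_iff_null_sets borel_open)
    then have "negligible B" by (simp add: negligible_iff_null_sets)
    then show False using B open_not_negligible by blast
  qed
  show "p \<in> cylinder 0 []" if "\<phi> p \<noteq> 0" for p
  proof -
    have p: "exp (- 2) < fst p" "fst p < exp (- 1)" "-1 < snd p" "snd p < 1"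
      using that by (auto simp: \<phi>_def B_def indicator_def split: if_splits)
    have pos: "0 < fst p" using p(1) exp_gt_zero[of "- 2 :: real"] by linarith
    have "fst p < 1" using p(2) by (rule less_trans) simp
    have "ln (exp (- 2)) < ln (fst p)" "ln (fst p) < ln (exp (- 1))"
      using p pos by (simp_all only: ln_less_cancel_iff exp_gt_zero)
    then have "1 < - ln (fst p)" "- ln (fst p) < 2" by simp_all
    then have "0 \<le> log 2 (- ln (fst p))" "log 2 (- ln (fst p)) < 1" by simp_all
    then have "level (fst p) = 0" by (simp add: level_def floor_eq_iff)
    then show ?thesis using p pos \<open>fst p < 1\<close> by (simp add: cylinder_def begins_def)
  qed
qed

lemma exists_separating:
  assumes h: "\<And>\<mu>. h (ck_gen \<mu>) = graph_op \<mu>"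
  shows "\<exists>\<zeta>. separating h K \<zeta>"
proof -
  \<comment> \<open>The index word of a path in the box has length d_1 + d_2 <= 2K, the bound
    required of the marker.\<close>
  define n where "n = 2 * K"
  define v where "v = replicate n I1 @ [I2]"
  obtain \<phi> where \<phi>: "\<phi> \<in> l2_fun square" "l2vec \<phi> \<noteq> 0" "\<And>p. \<phi> p \<noteq> 0 \<Longrightarrow> p \<in> cylinder 0 []"
    by (rule exists_cylinder_function) blast
  \<comment> \<open>Transport along a word of F letters with indices v places the marker at the
    front of the expansion and shifts the level by a constant, without losing nonzeroness, since
    word operators are isometries.\<close>
  define \<psi> where "\<psi> = word_push (map F v) \<phi>"
  define d where "d = - int (length v)"
  have \<psi>: "\<psi> \<in> l2_fun square" "\<And>p. \<psi> p \<noteq> 0 \<Longrightarrow> p \<in> cylinder d v"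
    using word_push_cylinder[of \<phi> 0 "[]" "map F v", OF \<phi>(3)] word_push_l2[OF \<phi>(1)]
    by (auto simp: \<psi>_def d_def word_deg_map_F comp_def)
  have nz: "l2vec \<psi> \<noteq> 0"
  proof
    assume "l2vec \<psi> = 0"
    then have "word_op (map F v) \<cdot> l2vec \<phi> = 0" by (simp add: \<psi>_def word_op_apply \<phi>(1))
    then have "(star (word_op (map F v)) * word_op (map F v)) \<cdot> l2vec \<phi> = 0" by (simp add: op_apply_linear)
    then have "op_id \<cdot> l2vec \<phi> = 0" by (metis graph_op_word star_graph_op_mult)
    then show False using \<phi>(2) by simp
  qed
  have "inner (graph_op \<mu> \<cdot> l2vec \<psi>) (graph_op \<nu> \<cdot> l2vec \<psi>) = 0
      \<and> inner (graph_op \<mu> \<cdot> l2vec \<psi>) (imul (graph_op \<nu> \<cdot> l2vec \<psi>)) = 0"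
    if \<mu>: "\<mu> \<in> degree_box K" and \<nu>: "\<nu> \<in> degree_box K" and ne: "\<mu> \<noteq> \<nu>" for \<mu> \<nu>
  proof -
    obtain u where u: "\<mu> = graph_of_word u" by (rule graph_of_word_cases)
    obtain w where w: "\<nu> = graph_of_word w" by (rule graph_of_word_cases)
    have deg: "deg \<mu> = word_deg u" "deg \<nu> = word_deg w"
      by (simp_all add: u w deg_graph_def graph_deg.abs_eq)
    have disj: "word_push u \<psi> p = 0 \<or> word_push w \<psi> p = 0" for p
    proof (rule ccontr)
      assume "\<not> ?thesis"
      then have "p \<in> cylinder (d + (int (fst (word_deg u)) - int (snd (word_deg u)))) (map letter_idx u @ v)"
        "p \<in> cylinder (d + (int (fst (word_deg w)) - int (snd (word_deg w)))) (map letter_idx w @ v)"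
        using word_push_cylinder[of \<psi> d v, OF \<psi>(2)] by auto
      then have b: "begins (map letter_idx u @ replicate n I1 @ [I2]) (snd p)"
          "begins (map letter_idx w @ replicate n I1 @ [I2]) (snd p)"
        and dd: "int (fst (word_deg u)) - int (snd (word_deg u)) = int (fst (word_deg w)) - int (snd (word_deg w))"
        by (auto simp: cylinder_def v_def)
      have len: "length u = fst (word_deg u) + snd (word_deg u)" "length w = fst (word_deg w) + snd (word_deg w)"
        using equivclp_normal_word by metis+
      have idx: "map letter_idx u = map letter_idx w"
        using b by (rule begins_append_marker) (use \<mu> \<nu> len deg in \<open>auto simp: degree_box_def n_def\<close>)
      then have "length u = length w" by (metis length_map)
      \<comment> \<open>The level yields the difference of the two components of the degree, the
        length of the index word their sum; together they determine the degree.\<close>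
      with len dd have "word_deg u = word_deg w" by (auto simp: prod_eq_iff)
      with idx have "\<mu> = \<nu>"
        by (intro graph_eqI) (simp_all add: u w graph_deg.abs_eq graph_idx.abs_eq)
      with ne show False by simp
    qed
    have "inner (l2vec (word_push u \<psi>)) (l2vec (word_push w \<psi>)) = 0"
      by (intro inner_l2vec_disjoint word_push_l2 \<psi>(1) disj)
    moreover have "\<i> * word_push w \<psi> p = 0 \<or> word_push u \<psi> p = 0" for p using disj[of p] by auto
    then have "inner (l2vec (word_push u \<psi>)) (l2vec (\<lambda>p. \<i> * word_push w \<psi> p)) = 0"
      by (intro inner_l2vec_disjoint word_push_l2 l2_fun_scale \<psi>(1)) blast
    ultimately show ?thesis
      using \<psi>(1) by (simp add: u w graph_op_word word_op_apply imul_l2vec word_push_l2)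
  qed
  then show ?thesis
    unfolding separating_def h using nz by blast
qed

section \<open>The representation of the branching system\<close>

abbreviation edge :: "letter \<Rightarrow> graph" where
  "edge l \<equiv> graph_of_word [l]"

text \<open>The value outside \<open>l2 square\<close> is the one prescribed for the extensional
  functions in \<open>bounded_operators\<close>.\<close>

definition op_on_classes ::
  "square_l2 adj_op \<Rightarrow> (real \<times> real \<Rightarrow> complex) set \<Rightarrow> (real \<times> real \<Rightarrow> complex) set" where
  "op_on_classes T A = (if A \<in> l2 square then class_of (T \<cdot> inv class_of A) else undefined)"

lemma class_of_in: "class_of x \<in> l2 square"
  using bij_class_of by (auto simp: bij_betw_def)

lemma class_of_inj: "class_of x = class_of y \<longleftrightarrow> x = y"
  using bij_class_of by (auto simp: bij_betw_def inj_eq)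

lemma class_of_cases:
  assumes "A \<in> l2 square"
  obtains x where "A = class_of x"
  using assms bij_class_of by (auto simp: bij_betw_def)

lemma op_on_classes_class_of: "op_on_classes T (class_of x) = class_of (T \<cdot> x)"
  using bij_class_of by (simp add: op_on_classes_def class_of_in inv_f_f bij_betw_def)

lemma op_on_classes_inj: "op_on_classes S = op_on_classes T \<Longrightarrow> S = T"
  by (rule op_eqI) (metis op_on_classes_class_of class_of_inj)

lemma op_on_classes_bounded: "op_on_classes T \<in> bounded_operators square"
  unfolding bounded_operators_def
proof (intro CollectI conjI ballI allI)
  show "op_on_classes T \<in> l2 square \<rightarrow>\<^sub>E l2 square"
    by (auto simp: op_on_classes_def class_of_in extensional_def)
  have "\<forall>A\<in>l2 square. l2_norm square (op_on_classes T A) \<le> norm T * l2_norm square A"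
    by (metis class_of_cases op_on_classes_class_of l2_norm_class_of norm_op_apply)
  then show "\<exists>C. \<forall>A\<in>l2 square. l2_norm square (op_on_classes T A) \<le> C * l2_norm square A" ..
next
  fix A B c
  assume "A \<in> l2 square"
  then obtain x where x: "A = class_of x" by (rule class_of_cases)
  show "op_on_classes T (l2_scale square c A) = l2_scale square c (op_on_classes T A)"
    by (simp add: x op_on_classes_class_of l2_scale_class_of op_apply_linear)
  assume "B \<in> l2 square"
  then obtain y where y: "B = class_of y" by (rule class_of_cases)
  show "op_on_classes T (l2_add square A B) = l2_add square (op_on_classes T A) (op_on_classes T B)"
    by (simp add: x y op_on_classes_class_of l2_add_class_of op_apply_linear)
qed

lemma l2_star_hom_op_on_classes:
  assumes "star_hom h"
  shows "l2_star_hom square (\<lambda>a. op_on_classes (h a))"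
proof -
  note h = star_hom_simps[OF assms]
  show ?thesis
    unfolding l2_star_hom_def
  proof (intro conjI allI ballI op_on_classes_bounded)
    fix a b c A B
    assume "A \<in> l2 square"
    then obtain x where x: "A = class_of x" by (rule class_of_cases)
    show "op_on_classes (h (a + b)) A = l2_add square (op_on_classes (h a) A) (op_on_classes (h b) A)"
      "op_on_classes (h (c *\<^sub>C a)) A = l2_scale square c (op_on_classes (h a) A)"
      "op_on_classes (h (a * b)) A = op_on_classes (h a) (op_on_classes (h b) A)"
      by (simp_all add: x op_on_classes_class_of l2_add_class_of l2_scale_class_of h)
    assume "B \<in> l2 square"
    then obtain y where y: "B = class_of y" by (rule class_of_cases)
    have "inner (star (h a) \<cdot> x) z = inner x (h a \<cdot> z)" for z
      by (metis inner_commute inner_star_right)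
    then show "l2_inner square (op_on_classes (h (star a)) A) B = l2_inner square A (op_on_classes (h a) B)"
      by (simp add: x y op_on_classes_class_of l2_inner_class_of h op_apply_linear(6)[symmetric])
  qed
qed

text \<open>The adjoint of \<pi> a is at hand, namely \<pi> (star a), so every \<pi> a is
  adjointable and \<pi> factors through the C*-algebra \<open>adj_op\<close>.\<close>

lemma l2_star_hom_imp_star_hom:
  fixes \<pi> :: "'a::star_algebra \<Rightarrow> _"
  assumes "l2_star_hom square \<pi>"
  obtains h where "star_hom h" "\<pi> = (\<lambda>a. op_on_classes (h a))"
proof -
  have bo: "\<pi> a \<in> bounded_operators square" for a
    using assms by (simp add: l2_star_hom_def)
  have ext: "\<pi> a \<in> l2 square \<rightarrow>\<^sub>E l2 square" for a
    using bo[of a] by (simp add: bounded_operators_def)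
  define s where "s a x = inv class_of (\<pi> a (class_of x))" for a x
  have s: "class_of (s a x) = \<pi> a (class_of x)" for a x
  proof -
    have "\<pi> a (class_of x) \<in> range class_of"
      using ext[of a] class_of_in[of x] bij_class_of by (auto simp: bij_betw_def)
    then show ?thesis by (simp add: s_def f_inv_into_f)
  qed
  have "\<exists>T. \<forall>x. T \<cdot> x = s a x" for a
  proof -
    obtain C where C: "\<And>A. A \<in> l2 square \<Longrightarrow> l2_norm square (\<pi> a A) \<le> C * l2_norm square A"
      using bo[of a] unfolding bounded_operators_def by blast
    have "inner (s a x) y = inner x (s (star a) y)" for x y
    proof -
      have "l2_inner square (\<pi> (star (star a)) (class_of x)) (class_of y)
          = l2_inner square (class_of x) (\<pi> (star a) (class_of y))"
        using assms class_of_in by (auto simp: l2_star_hom_def)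
      then show ?thesis by (simp add: s[symmetric] l2_inner_class_of star_star)
    qed
    moreover have "norm (s a x) \<le> C * norm x" for x
      using C[OF class_of_in[of x]] by (simp add: s[symmetric] l2_norm_class_of)
    moreover have "s a (imul x) = imul (s a x)" for x
    proof -
      have "class_of (s a (cscale \<i> x)) = class_of (cscale \<i> (s a x))"
        unfolding l2_scale_class_of[symmetric] s
        using bo[of a] class_of_in[of x] by (simp add: bounded_operators_def)
      then show ?thesis by (simp add: class_of_inj cscale_def)
    qed
    ultimately obtain T where "\<And>x. T \<cdot> x = s a x" by (rule adj_op_exists) blast
    then show ?thesis by blast
  qed
  then obtain h where h: "\<And>a x. h a \<cdot> x = s a x" by metis
  have hc: "class_of (h a \<cdot> x) = \<pi> a (class_of x)" for a x by (simp add: h s)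
  have "\<pi> a = op_on_classes (h a)" for a
  proof
    fix A
    show "\<pi> a A = op_on_classes (h a) A"
    proof (cases "A \<in> l2 square")
      case True
      then show ?thesis by (elim class_of_cases) (simp add: op_on_classes_class_of hc)
    next
      case False
      then show ?thesis using ext[of a] by (auto simp: op_on_classes_def PiE_def extensional_def)
    qed
  qed
  moreover have "star_hom h"
    unfolding star_hom_def
  proof (intro conjI allI)
    show "h (a + b) = h a + h b" for a b
      by (rule op_eqI, rule class_of_inj[THEN iffD1])
        (use assms class_of_in in \<open>simp add: hc l2_star_hom_def flip: l2_add_class_of\<close>)
    show "h (c *\<^sub>C a) = c *\<^sub>C h a" for c a
      by (rule op_eqI, rule class_of_inj[THEN iffD1])
        (use assms class_of_in in \<open>simp add: hc l2_star_hom_def flip: l2_scale_class_of\<close>)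
    show "h (a * b) = h a * h b" for a b
      by (rule op_eqI, rule class_of_inj[THEN iffD1])
        (use assms class_of_in in \<open>simp add: hc l2_star_hom_def\<close>)
    show "h (star a) = star (h a)" for a
    proof (rule sym, rule star_eqI)
      fix x y
      have "l2_inner square (\<pi> (star (star a)) (class_of x)) (class_of y)
          = l2_inner square (class_of x) (\<pi> (star a) (class_of y))"
        using assms class_of_in by (auto simp: l2_star_hom_def)
      then show "inner (h a \<cdot> x) y = inner x (h (star a) \<cdot> y)"
        by (simp add: hc[symmetric] l2_inner_class_of star_star)
    qed
  qed
  ultimately show ?thesis by (intro that[of h]) auto
qed

text \<open>A Radon-Nikodym derivative is determined only almost everywhere; the finite measure of
  the half square gives this uniqueness.\<close>

lemma letter_branching_density:
  assumes "\<And>p. p \<in> Q \<Longrightarrow> f \<mu> p = letter_map l p" and "R \<mu> = letter_half l"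
  shows "AE q in square. q \<in> R \<mu> \<longrightarrow> branching_density square Q R f \<mu> q = letter_density l q"
proof -
  let ?M = "lebesgue_on (letter_half l)"
  have "letter_half l \<in> lmeasurable"
  proof (rule bounded_set_imp_lmeasurable)
    show "bounded (letter_half l)" unfolding half_def by (intro bounded_Times) simp_all
    show "letter_half l \<in> sets lebesgue" using half_sets by simp
  qed
  then interpret finite_measure ?M by (rule finite_measure_lebesgue_on)
  have "distr square ?M (f \<mu>) = density ?M (\<lambda>q. ennreal (letter_density l q))"
    unfolding letter_map_distr(2)[symmetric] using assms by (intro distr_cong) (auto simp: space_restrict_space)
  moreover have "(\<lambda>q. ennreal (letter_density l q)) \<in> borel_measurable ?M"
    by (intro measurable_restrict_space1 measurable_completion) simp
  ultimately have "AE q in ?M. ennreal (letter_density l q) = RN_deriv ?M (distr square ?M (f \<mu>)) q"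
    by (intro RN_deriv_unique) simp_all
  then have "AE q in restrict_space square (letter_half l).
      ennreal (letter_density l q) = RN_deriv ?M (distr square ?M (f \<mu>)) q"
    unfolding restrict_square[OF half_sets half_subset] .
  then have "AE q in square. q \<in> letter_half l \<longrightarrow>
      ennreal (letter_density l q) = RN_deriv ?M (distr square ?M (f \<mu>)) q"
    by (subst (asm) AE_restrict_space_iff) (use half_in_square half_subset in \<open>auto simp: space_restrict_space Int_absorb2\<close>)
  then show ?thesis
  proof (rule AE_mp, intro AE_I2 impI)
    fix q
    assume "q \<in> letter_half l \<longrightarrow> ennreal (letter_density l q) = RN_deriv ?M (distr square ?M (f \<mu>)) q" "q \<in> R \<mu>"
    moreover have "0 \<le> letter_density l q" using \<open>q \<in> R \<mu>\<close> assms(2) by (intro letter.d_nonneg) simp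
    ultimately show "branching_density square Q R f \<mu> q = letter_density l q"
      using assms(2) by (simp add: branching_density_def restrict_square half_sets half_subset Q_sets)
        (metis enn2real_ennreal)
  qed
qed

lemma edges_graph: "(edges :: graph set) = {edge l | l. True}"
proof -
  have "edges = {\<mu>::graph. deg \<mu> = (1, 0)} \<union> {\<mu>. deg \<mu> = (0, 1)}" by (auto simp: edges_def)
  also have "\<dots> = {e1, e2, f1, f2}" unfolding graph_deg_eq_1 by auto
  also have "\<dots> = {edge l | l. True}"
    by (auto; metis letter.exhaust idx.exhaust)
  finally show ?thesis .
qed

lemma deg_letter: "deg (edge l) = letter_deg l"
  by (simp add: deg_graph_def graph_deg.abs_eq word_deg_def)

section \<open>The axioms of the branching system and the representations arising from it\<close>

context
  fixes R :: "graph \<Rightarrow> (real \<times> real) set" and f :: "graph \<Rightarrow> real \<times> real \<Rightarrow> real \<times> real"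
  assumes R_letter: "\<And>l. R (edge l) = letter_half l"
    and f_letter: "\<And>l p. p \<in> Q \<Longrightarrow> f (edge l) p = letter_map l p"
begin

lemma inv_letter: "q \<in> letter_half l \<Longrightarrow> inv_into Q (f (edge l)) q = letter_inv l q"
proof (rule inv_into_f_eq)
  show "inj_on (f (edge l)) Q"
    by (rule inj_on_inverseI[of _ "letter_inv l"]) (simp only: f_letter letter_inv_map)
  assume "q \<in> letter_half l"
  then show "letter_inv l q \<in> Q" "f (edge l) (letter_inv l q) = q"
    by (simp_all only: letter_inv_in_Q f_letter letter_map_inv)
qed

lemma branching_system_square: "branching_system square Q R f (\<lambda>\<mu>. inv_into Q (f \<mu>))"
proof -
  have half_null: "half I1 \<inter> half I2 \<in> null_sets square"
  proof -
    have "AE q in square. q \<notin> half I1 \<inter> half I2"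
      using AE_square_snd[of 0] by (rule AE_mp) (auto intro!: AE_I2 simp: half_def)
    then show ?thesis
      by (subst AE_iff_null_sets) (auto intro: sets.Int half_in_square)
  qed
  have edge_map: "f (edge l) \<in> square \<rightarrow>\<^sub>M lebesgue_on (letter_half l)"
    "inv_into Q (f (edge l)) \<in> lebesgue_on (letter_half l) \<rightarrow>\<^sub>M square"
    "absolutely_continuous square (distr (lebesgue_on (letter_half l)) square (inv_into Q (f (edge l))))"
    "absolutely_continuous (lebesgue_on (letter_half l)) (distr square (lebesgue_on (letter_half l)) (f (edge l)))"
    for l
  proof -
    have f: "f (edge l) p = letter_map l p" if "p \<in> space square" for p
      using that by (intro f_letter) (simp add: space_restrict_space)
    have g: "inv_into Q (f (edge l)) q = letter_inv l q" if "q \<in> space (lebesgue_on (letter_half l))" for q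
      using that by (intro inv_letter) (simp add: space_restrict_space)
    show "f (edge l) \<in> square \<rightarrow>\<^sub>M lebesgue_on (letter_half l)"
      using letter_map_distr(1)[of l] by (subst measurable_cong[OF f])
    show "inv_into Q (f (edge l)) \<in> lebesgue_on (letter_half l) \<rightarrow>\<^sub>M square"
      using letter_inv_distr(1)[of l] by (subst measurable_cong[OF g])
    show "absolutely_continuous square (distr (lebesgue_on (letter_half l)) square (inv_into Q (f (edge l))))"
      using letter_inv_distr(2)[of l] by (subst distr_cong[OF refl refl g])
    have "(\<lambda>q. ennreal (letter_density l q)) \<in> borel_measurable (lebesgue_on (letter_half l))"
      by (intro measurable_restrict_space1 measurable_completion) simp
    then have "absolutely_continuous (lebesgue_on (letter_half l)) (distr square (lebesgue_on (letter_half l)) (letter_map l))"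
      unfolding letter_map_distr(2) by (rule absolutely_continuousI_density)
    then show "absolutely_continuous (lebesgue_on (letter_half l)) (distr square (lebesgue_on (letter_half l)) (f (edge l)))"
      by (subst distr_cong[OF refl refl f])
  qed
  have RQ: "restrict_space square Q = square" "restrict_space square (letter_half l) = lebesgue_on (letter_half l)" for l
    by (simp_all add: restrict_square Q_sets half_sets half_subset)
  have comm: "letter_map a (letter_map b p) = letter_map c (letter_map d p)"
    if "edge a * edge b = edge c * edge d" "p \<in> Q" for a b c d p
  proof -
    \<comment> \<open>Degree and index word are invariants of the product. They leave only trivial
      equalities and exchanges of E and F, where both first coordinates are x.\<close>
    have "graph_of_word [a, b] = graph_of_word [c, d]"
      using that(1) by (simp add: times_graph.abs_eq)
    then have "word_deg [a, b] = word_deg [c, d]" "map letter_idx [a, b] = map letter_idx [c, d]"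
      by (metis graph_deg.abs_eq, metis graph_idx.abs_eq)
    then show ?thesis using \<open>p \<in> Q\<close>
      by (cases a; cases b; cases c; cases d) (auto simp: word_deg_def)
  qed
  show ?thesis
    unfolding branching_system_def
  proof (intro conjI ballI impI)
    show "Q \<in> sets square" using Q_sets by (simp add: sets_restrict_space_iff)
  next
    fix \<mu> :: graph
    assume "\<mu> \<in> edges"
    then obtain l where l: "\<mu> = edge l" by (auto simp: edges_graph)
    show "R \<mu> \<in> sets square" by (simp add: l R_letter half_in_square)
    show "f \<mu> \<in> restrict_space square Q \<rightarrow>\<^sub>M restrict_space square (R \<mu>)"
      "inv_into Q (f \<mu>) \<in> restrict_space square (R \<mu>) \<rightarrow>\<^sub>M restrict_space square Q"
      "absolutely_continuous (restrict_space square Q)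
        (distr (restrict_space square (R \<mu>)) (restrict_space square Q) (inv_into Q (f \<mu>)))"
      "absolutely_continuous (restrict_space square (R \<mu>))
        (distr (restrict_space square Q) (restrict_space square (R \<mu>)) (f \<mu>))"
      unfolding l R_letter RQ by (rule edge_map)+
    show "AE p in restrict_space square Q. inv_into Q (f \<mu>) (f \<mu> p) = p"
      unfolding RQ l by (rule AE_I2) (simp add: space_restrict_space f_letter inv_letter letter_map_in_half letter_inv_map del: mem_Sigma_iff)
    show "AE q in restrict_space square (R \<mu>). f \<mu> (inv_into Q (f \<mu>) q) = q"
      unfolding R_letter RQ l
      by (rule AE_I2) (simp add: space_restrict_space f_letter inv_letter letter_inv_in_Q letter_map_inv del: mem_Sigma_iff)
    fix \<nu> :: graph
    assume "\<nu> \<in> edges"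
    then obtain m where m: "\<nu> = edge m" by (auto simp: edges_graph)
    show "R \<mu> \<inter> R \<nu> \<in> null_sets square" if "deg \<mu> = deg \<nu>" "\<mu> \<noteq> \<nu>"
    proof -
      have "letter_deg l = letter_deg m" "l \<noteq> m" using that by (auto simp: l m deg_letter)
      then have "letter_idx l \<noteq> letter_idx m" by (cases l; cases m) auto
      then have "letter_half l \<inter> letter_half m = half I1 \<inter> half I2"
        by (cases "letter_idx l"; cases "letter_idx m") auto
      then show ?thesis using half_null by (simp only: l m R_letter)
    qed
    fix \<alpha> \<beta> :: graph
    assume "\<alpha> \<in> edges" "\<beta> \<in> edges" and eq: "\<mu> * \<nu> = \<alpha> * \<beta>"
    then obtain a b where ab: "\<alpha> = edge a" "\<beta> = edge b" by (auto simp: edges_graph)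
    have Q: "letter_map k p \<in> Q" if "p \<in> Q" for k p
      using letter_map_in_half[OF that] half_subset by blast
    show "AE p in restrict_space square Q. f \<mu> (f \<nu> p) = f \<alpha> (f \<beta> p)"
      unfolding RQ
    proof (rule AE_I2)
      fix p
      assume "p \<in> space square"
      then have p: "p \<in> Q" by (simp add: space_restrict_space del: mem_Sigma_iff)
      show "f \<mu> (f \<nu> p) = f \<alpha> (f \<beta> p)"
        unfolding l m ab f_letter[OF p] f_letter[OF Q[OF p]]
        by (rule comm[OF eq[unfolded l m ab] p])
    qed
  next
    fix n :: "nat \<times> nat"
    assume "n \<in> {(1, 0), (0, 1)}"
    then have n: "{\<mu>::graph. deg \<mu> = n} = {e1, e2} \<or> {\<mu>::graph. deg \<mu> = n} = {f1, f2}"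
      by (elim insertE emptyE) (simp_all only: graph_deg_eq_1 simp_thms)
    have "R e1 = half I1" "R e2 = half I2" "R f1 = half I1" "R f2 = half I2"
      using R_letter by simp_all
    moreover have "half I1 \<union> half I2 = Q" by (auto simp: half_def)
    ultimately have "(\<Union>\<mu>\<in>{\<mu>. deg \<mu> = n}. R \<mu>) = Q"
      using n by (elim disjE) (simp_all only: UN_insert UN_empty Un_empty_right)
    then show "AE p in square. p \<in> (\<Union>\<mu>\<in>{\<mu>. deg \<mu> = n}. R \<mu>) \<longleftrightarrow> p \<in> Q" by simp
  qed
qed

lemma push_eq_class:
  assumes "\<phi> \<in> l2_fun square"
  shows "l2_class square (letter.push l \<phi>)
    = l2_class square (\<lambda>x. if x \<in> R (edge l)
        then of_real (sqrt (branching_density square Q R f (edge l) x)) * \<phi> (inv_into Q (f (edge l)) x) else 0)"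
  by (rule l2_class_cong, rule AE_mp[OF letter_branching_density[of f "edge l" l R, OF f_letter R_letter]])
    (auto intro!: AE_I2 simp: letter.push_def R_letter inv_letter)

text \<open>The conditions prescribe \<pi> on the edges and on 1 only; multiplicativity along words
  determines it on every path. The densities and inverses agree almost everywhere, which suffices
  for classes.\<close>

lemma arises_iff:
  "arises_from_branching_system square Q R f (\<lambda>\<mu>. inv_into Q (f \<mu>)) \<pi> \<longleftrightarrow>
    (\<exists>h. star_hom h \<and> (\<forall>\<mu>. h (ck_gen \<mu>) = graph_op \<mu>) \<and> \<pi> = (\<lambda>a. op_on_classes (h a)))" (is "?L \<longleftrightarrow> ?R")
proof
  assume L: ?L
  then have "l2_star_hom square \<pi>" by (simp add: arises_from_branching_system_def)
  then obtain h where h: "star_hom h" "\<pi> = (\<lambda>a. op_on_classes (h a))" by (rule l2_star_hom_imp_star_hom)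
  note hs = star_hom_simps[OF h(1)]
  have letter: "h (ck_gen (edge l)) = letter_op l" for l
  proof (rule op_l2vec_eqI)
    fix \<phi> :: "real \<times> real \<Rightarrow> complex"
    assume \<phi>: "\<phi> \<in> l2_fun square"
    have "edge l \<in> edges" by (auto simp: edges_graph)
    then have "\<pi> (ck_gen (edge l)) (l2_class square \<phi>) = l2_class square (letter.push l \<phi>)"
      using L \<phi> unfolding arises_from_branching_system_def push_eq_class[OF \<phi>] by blast
    then have "class_of (h (ck_gen (edge l)) \<cdot> l2vec \<phi>) = class_of (l2vec (letter.push l \<phi>))"
      using \<phi> by (simp add: h(2) class_of_l2vec[symmetric] op_on_classes_class_of letter.push_l2)
    then show "h (ck_gen (edge l)) \<cdot> l2vec \<phi> = letter_op l \<cdot> l2vec \<phi>"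
      using \<phi> by (simp add: class_of_inj letter_op_apply)
  qed
  have one: "h (ck_gen 1) = op_id"
  proof (rule op_l2vec_eqI)
    fix \<phi> :: "real \<times> real \<Rightarrow> complex"
    assume \<phi>: "\<phi> \<in> l2_fun square"
    have "l2_class square (\<lambda>x. indicator Q x * \<phi> x) = l2_class square \<phi>"
      by (rule l2_class_cong, rule AE_I2) (simp add: space_restrict_space)
    then have "\<pi> (ck_gen 1) (l2_class square \<phi>) = l2_class square \<phi>"
      using L \<phi> by (simp add: arises_from_branching_system_def)
    then show "h (ck_gen 1) \<cdot> l2vec \<phi> = op_id \<cdot> l2vec \<phi>"
      using \<phi> by (simp add: h(2) class_of_l2vec[symmetric] op_on_classes_class_of class_of_inj)
  qed
  have "h (ck_gen (graph_of_word w)) = word_op w" for w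
  proof (induction w)
    case Nil
    then show ?case by (simp add: one flip: one_graph_def)
  next
    case (Cons l w)
    have "graph_of_word (l # w) = edge l * graph_of_word w"
      by (simp add: times_graph.abs_eq)
    then show ?case by (simp add: ck_gen_mult hs Cons letter)
  qed
  then have "h (ck_gen \<mu>) = graph_op \<mu>" for \<mu>
    by (cases \<mu> rule: graph_of_word_cases) (simp add: graph_op_word)
  with h show ?R by blast
next
  assume ?R
  then obtain h where h: "star_hom h" "\<And>\<mu>. h (ck_gen \<mu>) = graph_op \<mu>" "\<pi> = (\<lambda>a. op_on_classes (h a))"
    by blast
  show ?L
    unfolding arises_from_branching_system_def
  proof (intro conjI ballI)
    show "l2_star_hom square \<pi>" unfolding h(3) by (rule l2_star_hom_op_on_classes[OF h(1)])
  next
    fix \<mu> :: graph and \<phi> :: "real \<times> real \<Rightarrow> complex"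
    assume "\<mu> \<in> edges" and \<phi>: "\<phi> \<in> l2_fun square"
    then obtain l where l: "\<mu> = edge l" by (auto simp: edges_graph)
    have "\<pi> (ck_gen \<mu>) (l2_class square \<phi>) = l2_class square (letter.push l \<phi>)"
      using \<phi> by (simp add: h l class_of_l2vec[symmetric] op_on_classes_class_of graph_op_word letter_op_apply letter.push_l2)
    then show "\<pi> (ck_gen \<mu>) (l2_class square \<phi>) = l2_class square (\<lambda>x. if x \<in> R \<mu>
        then of_real (sqrt (branching_density square Q R f \<mu> x)) * \<phi> (inv_into Q (f \<mu>) x) else 0)"
      by (simp only: push_eq_class[OF \<phi>] l)
  next
    fix \<phi> :: "real \<times> real \<Rightarrow> complex"
    assume \<phi>: "\<phi> \<in> l2_fun square"
    have "l2_class square (\<lambda>x. indicator Q x * \<phi> x) = l2_class square \<phi>"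
      by (rule l2_class_cong, rule AE_I2) (simp add: space_restrict_space)
    then show "\<pi> (ck_gen 1) (l2_class square \<phi>) = l2_class square (\<lambda>x. indicator Q x * \<phi> x)"
      using \<phi> by (simp add: h class_of_l2vec[symmetric] op_on_classes_class_of graph_op_one)
  qed
qed

end

text \<open>The universal property gives uniqueness among continuous maps, whereas a representation
  is only required to be a *-homomorphism; automatic contractivity closes the gap.\<close>

lemma star_hom_graph_op_unique: "\<exists>!h. star_hom h \<and> (\<forall>\<mu>. h (ck_gen \<mu>) = graph_op \<mu>)"
proof -
  have cont: "continuous_on UNIV h" if h: "star_hom h" "\<forall>\<mu>. h (ck_gen \<mu>) = graph_op \<mu>" for h
  proof -
    have "norm (h a - h b) \<le> norm (a - b)" for a b
      unfolding star_hom_simps(7)[OF h(1), symmetric]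
      by (rule star_hom_contractive[OF h(1) ck_gen_one_mult mult_ck_gen_one star_ck_gen_one])
        (simp add: h(2) graph_op_one)
    then show ?thesis
      unfolding continuous_on_iff dist_norm using le_less_trans by blast
  qed
  from ck_algebra_universal[OF ck_family_graph_op]
  obtain h where h: "star_hom h \<and> continuous_on UNIV h \<and> (\<forall>\<mu>. h (ck_gen \<mu>) = graph_op \<mu>)"
    and uniq: "\<And>g. star_hom g \<and> continuous_on UNIV g \<and> (\<forall>\<mu>. g (ck_gen \<mu>) = graph_op \<mu>) \<Longrightarrow> g = h"
    by (elim ex1E) blast
  show ?thesis
    by (rule ex1I[of _ h]) (use h uniq cont in blast)+
qed

theorem proposition5p8:
  fixes D :: "(real \<times> real) set"
    and \<eta> :: "(real \<times> real) measure"
    and R :: "graph \<Rightarrow> (real \<times> real) set"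
    and f :: "graph \<Rightarrow> real \<times> real \<Rightarrow> real \<times> real"
  assumes "D = {0..1} \<times> {-1..1}"
    and "\<eta> = lebesgue_on ({0..1} \<times> {-1..1})"
    and "R e1 = {0..1} \<times> {0..1}" and "R f1 = {0..1} \<times> {0..1}"
    and "R e2 = {0..1} \<times> {-1..0}" and "R f2 = {0..1} \<times> {-1..0}"
    and "\<And>x y. (x, y) \<in> D \<Longrightarrow> f e1 (x, y) = (x\<^sup>2, y / 2 + 1 / 2)"
    and "\<And>x y. (x, y) \<in> D \<Longrightarrow> f f1 (x, y) = (sqrt x, y / 2 + 1 / 2)"
    and "\<And>x y. (x, y) \<in> D \<Longrightarrow> f e2 (x, y) = (x\<^sup>2, y / 2 - 1 / 2)"
    and "\<And>x y. (x, y) \<in> D \<Longrightarrow> f f2 (x, y) = (sqrt x, y / 2 - 1 / 2)"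
  shows "branching_system \<eta> D R f (\<lambda>\<mu>. inv_into D (f \<mu>))
    \<and> (\<exists>!\<pi>. arises_from_branching_system \<eta> D R f (\<lambda>\<mu>. inv_into D (f \<mu>)) \<pi>)
    \<and> inj (branching_representation \<eta> D R f (\<lambda>\<mu>. inv_into D (f \<mu>)))"
proof -
  have R: "R (edge l) = letter_half l" for l
    using assms(3-6) by (cases l; cases "letter_idx l") (auto simp: half_def)
  have f: "f (edge l) p = letter_map l p" if "p \<in> Q" for l p
    using assms(7-10)[of "fst p" "snd p"] that assms(1)
    by (cases l; cases "letter_idx l") (auto simp: mem_Times_iff)
  obtain h where h: "star_hom h" "\<And>\<mu>. h (ck_gen \<mu>) = graph_op \<mu>"
    and uniq: "\<And>g. star_hom g \<Longrightarrow> (\<And>\<mu>. g (ck_gen \<mu>) = graph_op \<mu>) \<Longrightarrow> g = h"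
    using star_hom_graph_op_unique by (elim ex1E) blast
  define \<pi> where "\<pi> a = op_on_classes (h a)" for a
  \<comment> \<open>Exactly one representation arises, so the definite description in
    \<open>branching_representation\<close> denotes \<pi>.\<close>
  have arises: "arises_from_branching_system square Q R f (\<lambda>\<mu>. inv_into Q (f \<mu>)) \<rho> \<longleftrightarrow> \<rho> = \<pi>" for \<rho>
    using arises_iff[of R f \<rho>, OF R f] h uniq unfolding \<pi>_def[abs_def] by blast
  then have rep: "branching_representation square Q R f (\<lambda>\<mu>. inv_into Q (f \<mu>)) = \<pi>"
    unfolding branching_representation_def by (intro the_equality) (simp_all only: arises)
  have "inj h"
    using h(1) _ orthogonal_ranges_graph exists_separating[OF h(2)]
    by (rule separating_inj) (simp add: h(2) graph_op_one)
  then have "inj \<pi>"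
    unfolding \<pi>_def by (auto intro!: injI dest!: op_on_classes_inj injD)
  then show ?thesis
    unfolding assms(1,2) rep using branching_system_square[of R f, OF R f] by (simp add: arises)
qed

end
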